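(* Let $N=2$ and $\alpha\ge 0$. There exists $\bar p=\bar p(\alpha)>1$ such that for every $p\in(1,\bar p(\alpha))$ the problem $$-\Delta u=|x|^{\alpha}|u|^{p-1}u\ \text{ in } B,\qquad u=0\ \text{ on }\partial B$$ has (at least) $\left\lceil\frac{2+\alpha}{2}\beta-1\right\rceil$ distinct nodal nonradial solutions, where distinct means that no two of them can be obtained from each other by a reflection or a rotation, and no two of them are one the opposite of the other.
   Context: $B$ is the open unit disc of $\mathbb R^2$. A nodal solution is a sign-changing one. $z_i(\nu)$ denotes the $i$-th positive zero of the Bessel function of the first kind of order $\nu$, and $\beta>0$ is the number such that $z_1(\beta)=z_2(0)$ ($\beta\approx2.305$). $\lceil s\rceil=\min\{k\in\mathbb Z:k\ge s\}$. Reflections and rotations are those of the plane fixing the origin. *)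

theory Defs
  imports "HOL-Analysis.Analysis"
begin

text \<open>The power series is used through \<open>powr\<close>, so \<open>bessel_J \<nu> x\<close> is the
  Bessel function of the first kind for \<open>x > 0\<close> only.\<close>

definition bessel_J :: "real \<Rightarrow> real \<Rightarrow> real" where
  "bessel_J \<nu> x =
     (\<Sum>m. (-1) ^ m / (fact m * Gamma (real m + \<nu> + 1)) * (x / 2) powr (2 * real m + \<nu>))"

text \<open>The \<open>i\<close>-th positive zero, for \<open>i \<ge> 1\<close>: exactly \<open>i\<close> positive zeros are at most \<open>z\<close>.\<close>

definition bessel_zero :: "nat \<Rightarrow> real \<Rightarrow> real" where
  "bessel_zero i \<nu> =
     (THE z. 0 < z \<and> bessel_J \<nu> z = 0 \<and> card {y. 0 < y \<and> y \<le> z \<and> bessel_J \<nu> y = 0} = i)"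

definition partial_deriv :: "'n::finite \<Rightarrow> (real^'n \<Rightarrow> real) \<Rightarrow> real^'n \<Rightarrow> real" where
  "partial_deriv i u x = frechet_derivative u (at x) (axis i 1)"

text \<open>Meant for open \<open>S\<close>; continuity of \<open>u\<close> and of its first derivatives is implied by
  differentiability.\<close>

definition C2_on :: "(real^'n::finite) set \<Rightarrow> (real^'n \<Rightarrow> real) \<Rightarrow> bool" where
  "C2_on S u \<longleftrightarrow>
     u differentiable_on S \<and>
     (\<forall>i. partial_deriv i u differentiable_on S) \<and>
     (\<forall>i j. continuous_on S (partial_deriv i (partial_deriv j u)))"

definition laplacian :: "(real^'n::finite \<Rightarrow> real) \<Rightarrow> real^'n \<Rightarrow> real" where
  "laplacian u x = (\<Sum>i\<in>UNIV. partial_deriv i (partial_deriv i u) x)"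

text \<open>The weight \<open>|x|\<^sup>\<alpha>\<close>. Since \<open>0 powr 0 = 0\<close>, the case \<open>\<alpha> = 0\<close> is
  separated, so that the weight is \<open>1\<close> at the origin too.\<close>

definition henon_weight :: "real \<Rightarrow> real^2 \<Rightarrow> real" where
  "henon_weight \<alpha> x = (if \<alpha> = 0 then 1 else norm x powr \<alpha>)"

text \<open>Classical solutions; only the values on the closed disc matter.\<close>

definition henon_solution :: "real \<Rightarrow> real \<Rightarrow> (real^2 \<Rightarrow> real) \<Rightarrow> bool" where
  "henon_solution \<alpha> p u \<longleftrightarrow>
     C2_on (ball 0 1) u \<and> continuous_on (cball 0 1) u \<and>
     (\<forall>x\<in>ball 0 1. - laplacian u x = henon_weight \<alpha> x * \<bar>u x\<bar> powr (p - 1) * u x) \<and>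
     (\<forall>x\<in>sphere 0 1. u x = 0)"

definition nodal :: "(real^2 \<Rightarrow> real) \<Rightarrow> bool" where
  "nodal u \<longleftrightarrow> (\<exists>x\<in>ball 0 1. u x > 0) \<and> (\<exists>x\<in>ball 0 1. u x < 0)"

definition radial :: "(real^2 \<Rightarrow> real) \<Rightarrow> bool" where
  "radial u \<longleftrightarrow> (\<forall>x\<in>ball 0 1. \<forall>y\<in>ball 0 1. norm x = norm y \<longrightarrow> u x = u y)"

definition plane_rotation :: "(real^2 \<Rightarrow> real^2) \<Rightarrow> bool" where
  "plane_rotation T \<longleftrightarrow> (\<exists>Q. rotation_matrix Q \<and> T = (\<lambda>x. Q *v x))"

text \<open>Reflection across the line through the origin spanned by the unit vector \<open>e\<close>.\<close>

definition plane_reflection :: "(real^2 \<Rightarrow> real^2) \<Rightarrow> bool" where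
  "plane_reflection T \<longleftrightarrow> (\<exists>e. norm e = 1 \<and> T = (\<lambda>x. (2 * (x \<bullet> e)) *\<^sub>R e - x))"

text \<open>The identity is a rotation, so distinct functions also differ somewhere on the closed disc.\<close>

definition essentially_distinct :: "(real^2 \<Rightarrow> real) \<Rightarrow> (real^2 \<Rightarrow> real) \<Rightarrow> bool" where
  "essentially_distinct u v \<longleftrightarrow>
     \<not> (\<exists>T. (plane_rotation T \<or> plane_reflection T) \<and> (\<forall>x\<in>cball 0 1. v x = u (T x))) \<and>
     \<not> (\<forall>x\<in>cball 0 1. v x = - u x)"

end

theory Submission
  imports Defs "HOL-Complex_Analysis.Great_Picard"
begin

text \<open>The nonlinearity is odd and the problem is invariant under rotations. So one may look for solutions among the functions that change sign
  under the rotation by \<open>pi / n\<close>. A nonzero function of this kind takes both signs and is not radial. If \<open>m\<close> is an even multiple of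
  \<open>n\<close>, then a function that changes sign under the rotation by \<open>pi / m\<close> is invariant under the rotation by \<open>pi / n\<close>. Rotations commute with
  this rotation, reflections invert it, and multiplication by \<open>-1\<close> does not affect either property; hence no nonzero function of the first class is
  equivalent to one of the second (\<open>essentially_distinctI\<close>). With \<open>n = 1, 2, 4, 8, \<dots>\<close> one gets as many distinct solutions as desired,
  provided that each class contains a solution.

  Existence is shown for a fixed class and a fixed \<open>p > 1\<close>. Let \<open>T v\<close> be the Green operator of the disc applied to
  \<open>\<bar>x\<bar> powr \<alpha> * \<bar>v\<bar> powr (p - 1) * v\<close>. By homogeneity it is enough to find \<open>u \<noteq> 0\<close> and \<open>m > 0\<close> with \<open>T u = m u\<close>; a multiple of \<open>u\<close> then
  solves the equation. One maximises the integral of \<open>\<bar>x\<bar> powr \<alpha> * \<bar>u\<bar> powr (p - 1) * u * T v\<close> over all pairs for which the weighted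
  integrals of \<open>\<bar>u\<bar> powr (p + 1)\<close> and \<open>\<bar>v\<bar> powr (p + 1)\<close> are 1. A Hoelder estimate for \<open>T\<close> (\<open>green_op_holder\<close>) and the
  Arzela-Ascoli theorem give a maximiser within the continuous functions, and the case of equality in Young's inequality yields
  \<open>T u = m v\<close> and \<open>T v = m u\<close> (\<open>eigenpair\<close>). A maximum principle shows \<open>u = v\<close> (\<open>eigenpair_le\<close>).

  It remains to see that \<open>u\<close> is a classical solution. The Green function is the sum of a logarithm and a harmonic part. For a continuous
  density the potential has a gradient that is bounded up to the boundary (\<open>green_grad_bounded\<close>). As \<open>u\<close> vanishes at the origin and on the
  circle, and \<open>p > 1\<close>, the nonlinear density, extended by zero, is therefore continuously differentiable on the whole plane
  (\<open>disc_density_C1_henon\<close>). In the second derivatives of the logarithmic potential one derivative can then be put on the kernel and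
  the other on the density. The Laplacian is found by regularising the kernel to \<open>ln (\<bar>z\<bar>\<^sup>2 + e\<^sup>2)\<close>, whose Laplacian is an approximate
  identity up to a constant factor (\<open>log_potential_laplacian\<close>).\<close>

section \<open>Integrability and invariance of Lebesgue measure\<close>

lemma integrable_real_even:
  fixes f :: "real \<Rightarrow> real"
  assumes "integrable lborel (\<lambda>t. indicator {0..} t * f t)" "\<And>t. f (- t) = f t"
  shows "integrable lborel f"
proof -
  have 1: "integrable lborel (\<lambda>t. indicator {0..} (0 + (-1) * t) * f (0 + (-1) * t))"
    by (rule lborel_integrable_real_affine[OF assms(1)]) simp
  have 2: "integrable lborel (\<lambda>t. indicator {0::real} t * f 0)"
    by (simp add: integrable_real_indicator)
  have "f = (\<lambda>t. indicator {0..} t * f t + indicator {0..} (0 + (-1) * t) * f (0 + (-1) * t)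
      - indicator {0} t * f 0)"
    by (auto simp: fun_eq_iff indicator_def assms(2))
  with Bochner_Integration.integrable_diff[OF Bochner_Integration.integrable_add[OF assms(1) 1] 2]
  show ?thesis by simp
qed

text \<open>Tonelli for a product of functions of the single coordinates. Together with the two bounds below it replaces
  polar coordinates: a radial singularity or decay is compared with a product of one-dimensional ones.\<close>

lemma integrable_lborel_prod:
  fixes f :: "real \<Rightarrow> real"
  assumes "integrable lborel f" "\<And>t. 0 \<le> f t"
  shows "integrable lborel (\<lambda>x::'a::euclidean_space. \<Prod>b\<in>Basis. f (x \<bullet> b))"
proof -
  have [measurable]: "f \<in> borel_measurable borel" using assms(1) by auto
  have "(\<integral>\<^sup>+x. ennreal (\<Prod>b\<in>Basis. f ((x::'a) \<bullet> b)) \<partial>lborel) = (\<Prod>b\<in>(Basis::'a set). (\<integral>\<^sup>+x. f x \<partial>lborel))"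
    by (subst nn_integral_lborel_prod[symmetric]) (auto simp: assms prod_ennreal)
  also have "\<dots> < \<infinity>"
    using assms by (simp add: nn_integral_eq_integral power_less_top_ennreal)
  finally show ?thesis
    by (intro integrableI_bounded) (auto simp: assms prod_nonneg)
qed

lemma integrable_inv_sqrt:
  "integrable lborel (\<lambda>t::real. indicator {- R..R} t * \<bar>t\<bar> powr (-1/2))"
proof (cases "R \<ge> 0")
  case True
  show ?thesis
  proof (rule integrable_real_even)
    have "((\<lambda>x. x powr (-1/2)) has_integral (R powr (-1/2+1) / (-1/2+1))) {0..R}"
      by (rule has_integral_powr_from_0) (use True in auto)
    then have "set_integrable lebesgue {0..R} (\<lambda>x. x powr (-1/2))"
      by (intro nonnegative_absolutely_integrable_1) (auto simp: integrable_on_def)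
    then have "integrable lborel (\<lambda>x. indicator {0..R} x * x powr (-1/2))"
      by (simp add: set_integrable_def integrable_completion)
    also have "(\<lambda>x. indicator {0..R} x * x powr (-1/2)) =
      (\<lambda>t. indicator {0..} t * (indicator {- R..R} t * \<bar>t\<bar> powr (-1/2)))"
      by (auto simp: fun_eq_iff indicator_def)
    finally show "integrable lborel \<dots>" .
  qed (auto simp: indicator_def)
qed simp

lemma integrable_inverse_one_plus_square: "integrable lborel (\<lambda>t::real. 1 / (1 + t\<^sup>2))"
proof (rule integrable_real_even)
  have "(\<integral>\<^sup>+t. ennreal (1 / (1 + t\<^sup>2)) * indicator {0..} t \<partial>lborel) = ennreal (pi / 2 - arctan 0)"
    by (rule nn_integral_FTC_atLeast)
       (auto intro!: derivative_eq_intros tendsto_arctan_at_top simp: inverse_eq_divide)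
  moreover have "(\<integral>\<^sup>+t. ennreal (norm (indicator {0..} t * (1 / (1 + t\<^sup>2)) :: real)) \<partial>lborel)
      = (\<integral>\<^sup>+t. ennreal (1 / (1 + t\<^sup>2)) * indicator {0..} t \<partial>lborel)"
    by (intro nn_integral_cong) (simp add: indicator_def)
  ultimately show "integrable lborel (\<lambda>t::real. indicator {0..} t * (1 / (1 + t\<^sup>2)))"
    by (intro integrableI_bounded) auto
qed simp

lemma AE_lborel_inner_neq: "b \<in> Basis \<Longrightarrow> AE x in lborel. (x::'a::euclidean_space) \<bullet> b \<noteq> 0"
proof -
  assume b: "b \<in> Basis"
  have "negligible {x::'a. x \<bullet> b = 0}"
    by (rule negligible_standard_hyperplane[OF b])
  then have "{x::'a. x \<bullet> b = 0} \<in> null_sets lborel"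
    by (auto simp: negligible_iff_null_sets null_sets_completion_iff)
  from AE_not_in[OF this] show ?thesis by simp
qed

text \<open>Every coordinate satisfies \<open>\<bar>z \<bullet> b\<bar> \<le> norm z\<close>, so in the plane \<open>1 / norm z\<close> is at most the product of the two
  functions \<open>1 / sqrt \<bar>z \<bullet> b\<bar>\<close>. The bound fails only where a coordinate vanishes, which is a null set.\<close>

lemma integrable_inverse_norm:
  "integrable lborel (\<lambda>z::real^2. indicator (cball 0 R) z / norm z)"
proof (rule Bochner_Integration.integrable_bound)
  let ?f = "\<lambda>t::real. indicator {- R..R} t * \<bar>t\<bar> powr (-1/2) :: real"
  show "integrable lborel (\<lambda>x::real^2. \<Prod>b\<in>Basis. ?f (x \<bullet> b))"
    by (rule integrable_lborel_prod[OF integrable_inv_sqrt]) auto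
  have "AE z in lborel. \<forall>b\<in>Basis. (z::real^2) \<bullet> b \<noteq> 0"
    using AE_lborel_inner_neq by (subst AE_ball_countable) (auto intro: countable_finite)
  then show "AE z in lborel. norm (indicator (cball 0 R) z / norm (z::real^2)) \<le> norm (\<Prod>b\<in>Basis. ?f (z \<bullet> b))"
  proof (rule AE_mp, intro AE_I2 impI)
    fix z :: "real^2" assume nz: "\<forall>b\<in>Basis. z \<bullet> b \<noteq> 0"
    show "norm (indicator (cball 0 R) z / norm z) \<le> norm (\<Prod>b\<in>Basis. ?f (z \<bullet> b))"
    proof (cases "norm z \<le> R")
      case True
      obtain b :: "real^2" where "b \<in> Basis" using nonempty_Basis by blast
      then have "z \<noteq> 0" using nz by auto
      have "?f (z \<bullet> b) \<ge> norm z powr (-1/2)" if "b \<in> Basis" for b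
      proof -
        have "\<bar>z \<bullet> b\<bar> \<le> norm z" using Basis_le_norm[OF that] .
        then show ?thesis using nz that True
          by (auto simp: indicator_def intro!: powr_mono2')
      qed
      then have "(\<Prod>b\<in>(Basis::(real^2) set). norm z powr (-1/2)) \<le> (\<Prod>b\<in>Basis. ?f (z \<bullet> b))"
        by (intro prod_mono) auto
      moreover have "(\<Prod>b\<in>(Basis::(real^2) set). norm z powr (-1/2)) = 1 / norm z"
        using \<open>z \<noteq> 0\<close> by (simp add: power2_eq_square powr_add[symmetric] powr_minus_divide)
      ultimately show ?thesis using True by (auto simp: indicator_def)
    qed (auto simp: indicator_def)
  qed
  show "(\<lambda>z::real^2. indicator (cball 0 R) z / norm z) \<in> borel_measurable lborel"
    by (auto intro!: borel_measurable_divide borel_measurable_indicator)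
qed

text \<open>The same comparison at infinity: \<open>(1 + z \<bullet> z)\<^sup>2\<close> dominates the product of the two factors \<open>1 + (z \<bullet> b)\<^sup>2\<close>.\<close>

lemma integrable_inverse_one_plus_norm:
  "integrable lborel (\<lambda>z::real^2. 1 / (1 + z \<bullet> z)\<^sup>2)"
proof (rule Bochner_Integration.integrable_bound)
  show "integrable lborel (\<lambda>x::real^2. \<Prod>b\<in>Basis. 1 / (1 + (x \<bullet> b)\<^sup>2))"
    by (rule integrable_lborel_prod[OF integrable_inverse_one_plus_square]) auto
  show "AE z in lborel. norm (1 / (1 + z \<bullet> z)\<^sup>2) \<le> norm (\<Prod>b\<in>Basis. 1 / (1 + ((z::real^2) \<bullet> b)\<^sup>2))"
  proof (intro AE_I2)
    fix z :: "real^2"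
    have "1 / (1 + z \<bullet> z) \<le> 1 / (1 + (z \<bullet> b)\<^sup>2)" if "b \<in> Basis" for b
    proof -
      have "\<bar>z \<bullet> b\<bar>\<^sup>2 \<le> (norm z)\<^sup>2" using Basis_le_norm[OF that] by (intro power_mono) auto
      then show ?thesis by (intro divide_left_mono) (auto simp: dot_square_norm intro!: mult_pos_pos add_pos_nonneg)
    qed
    then have "(\<Prod>b\<in>(Basis::(real^2) set). 1 / (1 + z \<bullet> z)) \<le> (\<Prod>b\<in>Basis. 1 / (1 + (z \<bullet> b)\<^sup>2))"
      by (intro prod_mono) (auto intro!: divide_nonneg_nonneg)
    then show "norm (1 / (1 + z \<bullet> z)\<^sup>2) \<le> norm (\<Prod>b\<in>Basis. 1 / (1 + (z \<bullet> b)\<^sup>2))"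
      by (simp add: power_divide power2_eq_square abs_if)
  qed
qed simp

lemma lborel_reflect_translate:
  "lborel = distr lborel borel (\<lambda>y::'a::euclidean_space. x - y)"
  using lborel_affine[of "-1" x] by (simp add: density_1)

lemma integrable_reflect_translate:
  fixes f :: "'a::euclidean_space \<Rightarrow> 'b::{banach, second_countable_topology}"
  assumes [measurable]: "f \<in> borel_measurable borel"
  shows "integrable lborel (\<lambda>y. f (x - y)) \<longleftrightarrow> integrable lborel f"
proof -
  have "integrable lborel f \<longleftrightarrow> integrable (distr lborel borel (\<lambda>y. x - y)) f"
    by (subst lborel_reflect_translate[of x]) simp
  then show ?thesis by (simp add: integrable_distr_eq)
qed

lemma integral_reflect_translate:
  fixes f :: "'a::euclidean_space \<Rightarrow> 'b::{banach, second_countable_topology}"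
  assumes [measurable]: "f \<in> borel_measurable borel"
  shows "(LINT y|lborel. f (x - y)) = (LINT y|lborel. f y)"
proof -
  have "(LINT y|lborel. f y) = integral\<^sup>L (distr lborel borel (\<lambda>y. x - y)) f"
    by (subst lborel_reflect_translate[of x]) simp
  then show ?thesis by (simp add: integral_distr)
qed

lemma integral_lborel_scale:
  fixes f :: "'a::euclidean_space \<Rightarrow> real"
  assumes [measurable]: "f \<in> borel_measurable borel" and "c \<noteq> 0"
  shows "(LINT y|lborel. f y) = \<bar>c\<bar> ^ DIM('a) * (LINT y|lborel. f (x + c *\<^sub>R y))"
proof -
  have "(LINT y|lborel. f y) = integral\<^sup>L (density (distr lborel borel (\<lambda>y. x + c *\<^sub>R y)) (\<lambda>_. \<bar>c\<bar>^DIM('a))) f"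
    by (subst lborel_affine[OF assms(2), of x]) simp
  also have "\<dots> = (LINT y|lborel. \<bar>c\<bar> ^ DIM('a) * f (x + c *\<^sub>R y))"
    by (subst integral_density) (auto simp: integral_distr)
  finally show ?thesis by simp
qed

text \<open>Lebesgue measure is determined by its values on boxes, and orthogonal maps preserve the measure of each of them.\<close>

lemma lborel_orthogonal:
  fixes f :: "real^'n::{finite,wellorder} \<Rightarrow> real^'n::_"
  assumes "orthogonal_transformation f"
  shows "distr lborel borel f = lborel"
proof (rule sym, rule lborel_eqI)
  define h where "h = inv f"
  have h: "orthogonal_transformation h" "\<And>x. f (h x) = x" "\<And>x. h (f x) = x"
    using assms orthogonal_transformation_inv[OF assms] orthogonal_transformation_inj[OF assms]
      orthogonal_transformation_surj[OF assms] by (auto simp: h_def surj_f_inv_f)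
  have [measurable]: "f \<in> borel_measurable borel"
    using assms by (intro borel_measurable_continuous_onI linear_continuous_on)
      (auto simp: orthogonal_transformation_linear linear_conv_bounded_linear[symmetric])
  fix l u :: "real^'n::{finite,wellorder}"
  assume lu: "\<And>b. b \<in> Basis \<Longrightarrow> l \<bullet> b \<le> u \<bullet> b"
  have vim: "f -` box l u = h ` box l u"
  proof (intro set_eqI iffI)
    fix x assume "x \<in> f -` box l u"
    then show "x \<in> h ` box l u" using h(3)[of x] by (metis imageI vimageD)
  next
    fix x assume "x \<in> h ` box l u"
    then show "x \<in> f -` box l u" using h(2) by auto
  qed
  have "emeasure (distr lborel borel f) (box l u) = emeasure lborel (h ` box l u)"
    by (subst emeasure_distr) (auto simp: vim)
  also have "h ` box l u \<in> sets borel"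
    unfolding vim[symmetric] by (rule measurable_sets_borel[of f borel]) auto
  then have "emeasure lborel (h ` box l u) = emeasure lebesgue (h ` box l u)"
    by simp
  also have "\<dots> = ennreal (measure lebesgue (h ` box l u))"
    by (rule emeasure_eq_measure2[OF measurable_orthogonal_image[OF h(1) lmeasurable_box]])
  also have "\<dots> = ennreal (measure lebesgue (box l u))"
    using measure_orthogonal_image[OF h(1), of "box l u"] by simp
  also have "\<dots> = (\<Prod>b\<in>Basis. (u - l) \<bullet> b)"
    using lu by (simp add: measure_lborel_box_eq)
  finally show "emeasure (distr lborel borel f) (box l u) = (\<Prod>b\<in>Basis. (u - l) \<bullet> b)" .
qed simp

lemma integral_orthogonal:
  fixes f :: "real^'n::{finite,wellorder} \<Rightarrow> real^'n::_" and g :: "_ \<Rightarrow> real"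
  assumes "orthogonal_transformation f" and [measurable]: "g \<in> borel_measurable borel"
  shows "(LINT y|lborel. g (f y)) = (LINT y|lborel. g y)"
proof -
  have [measurable]: "f \<in> borel_measurable borel"
    using assms by (intro borel_measurable_continuous_onI linear_continuous_on)
      (auto simp: orthogonal_transformation_linear linear_conv_bounded_linear[symmetric])
  have "(LINT y|lborel. g y) = (LINT y|distr lborel borel f. g y)"
    by (simp add: lborel_orthogonal[OF assms(1)])
  then show ?thesis by (simp add: integral_distr)
qed

section \<open>Differentiation under the integral sign\<close>

text \<open>Dominated convergence along sequences.\<close>

lemma continuous_on_integral_dominated:
  fixes k :: "'a::metric_space \<Rightarrow> 'b \<Rightarrow> 'c::{banach, second_countable_topology}"
  assumes meas: "\<And>x. x \<in> U \<Longrightarrow> k x \<in> borel_measurable M"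
    and g: "integrable M g"
    and bound: "\<And>x y. x \<in> U \<Longrightarrow> y \<in> space M \<Longrightarrow> norm (k x y) \<le> g y"
    and cont: "\<And>y. y \<in> space M \<Longrightarrow> continuous_on U (\<lambda>x. k x y)"
  shows "continuous_on U (\<lambda>x. LINT y|M. k x y)"
  unfolding continuous_on_sequentially comp_def
proof (intro allI ballI impI, elim conjE)
  fix X a assume a: "a \<in> U" and X: "\<forall>n. X n \<in> U" "X \<longlonglongrightarrow> a"
  show "(\<lambda>n. LINT y|M. k (X n) y) \<longlonglongrightarrow> (LINT y|M. k a y)"
  proof (rule integral_dominated_convergence[where w = g])
    show "AE y in M. (\<lambda>n. k (X n) y) \<longlonglongrightarrow> k a y"
      using cont a X by (intro AE_I2) (auto simp: continuous_on_sequentially comp_def)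
  qed (use meas g bound a X in auto)
qed

text \<open>By the mean value theorem the difference quotients of the integrand are bounded by twice the bound \<open>g\<close> of the gradients,
  so dominated convergence applies to them. The gradient is taken as a vector, which makes it integrable as a vector-valued function.\<close>

lemma has_derivative_integral_dominated:
  fixes k :: "'a::euclidean_space \<Rightarrow> 'b \<Rightarrow> real" and k' :: "'a \<Rightarrow> 'b \<Rightarrow> 'a"
  assumes U: "open U" "x0 \<in> U"
    and der: "\<And>x y. x \<in> U \<Longrightarrow> y \<in> space M \<Longrightarrow> ((\<lambda>x. k x y) has_derivative (\<lambda>h. k' x y \<bullet> h)) (at x)"
    and int: "\<And>x. x \<in> U \<Longrightarrow> integrable M (k x)"
    and meas: "k' x0 \<in> borel_measurable M"
    and bound: "\<And>x y. x \<in> U \<Longrightarrow> y \<in> space M \<Longrightarrow> norm (k' x y) \<le> g y"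
    and g: "integrable M g"
  shows "((\<lambda>x. LINT y|M. k x y) has_derivative (\<lambda>h. (LINT y|M. k' x0 y) \<bullet> h)) (at x0)"
proof -
  obtain r where r: "r > 0" "ball x0 r \<subseteq> U"
    using U open_contains_ball by blast
  have int': "integrable M (k' x0)"
    by (rule Bochner_Integration.integrable_bound[OF g meas]) (use bound U in \<open>force intro!: AE_I2\<close>)
  let ?D = "\<lambda>h y. (k (x0 + h) y - k x0 y - k' x0 y \<bullet> h) / norm h"
  let ?L = "\<lambda>h. (\<integral>y. k (x0 + h) y \<partial>M) - (\<integral>y. k x0 y \<partial>M) - (\<integral>y. k' x0 y \<partial>M) \<bullet> h"
  have "(\<lambda>h. norm (?L h) / norm h) \<midarrow>0\<rightarrow> 0"
    unfolding tendsto_at_iff_sequentially comp_def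
  proof (intro allI impI)
    fix X :: "nat \<Rightarrow> 'a" assume X: "\<forall>i. X i \<in> UNIV - {0}" "X \<longlonglongrightarrow> 0"
    define E where "E n y = (if norm (X n) < r then ?D (X n) y else 0)" for n y
    have in_U: "x0 + h \<in> U" if "norm h < r" for h
      using that r by (auto simp: dist_norm subset_eq)
    have "(\<lambda>n. \<integral>y. E n y \<partial>M) \<longlonglongrightarrow> (\<integral>y. 0 \<partial>M)"
    proof (rule integral_dominated_convergence[where w = "\<lambda>y. 2 * g y"])
      show "E n \<in> borel_measurable M" for n
        using int[OF in_U, of "X n"] int[OF U(2)] int' unfolding E_def
        by (cases "norm (X n) < r") (auto intro!: borel_measurable_divide borel_measurable_diff borel_measurable_inner)
      show "AE y in M. (\<lambda>n. E n y) \<longlonglongrightarrow> 0"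
      proof (intro AE_I2)
        fix y assume y: "y \<in> space M"
        have "(\<lambda>h. norm (k (x0 + h) y - k x0 y - k' x0 y \<bullet> h) / norm h) \<midarrow>0\<rightarrow> 0"
          using der[OF U(2) y] by (simp add: has_derivative_at)
        then have "(\<lambda>n. norm (k (x0 + X n) y - k x0 y - k' x0 y \<bullet> X n) / norm (X n)) \<longlonglongrightarrow> 0"
          using X unfolding tendsto_at_iff_sequentially comp_def by blast
        then have "(\<lambda>n. ?D (X n) y) \<longlonglongrightarrow> 0"
          by (subst tendsto_norm_zero_iff[symmetric]) (simp add: norm_divide)
        moreover have "\<forall>\<^sub>F n in sequentially. norm (X n) < r"
          using X(2) r(1) by (auto simp: tendsto_iff dist_norm)
        ultimately show "(\<lambda>n. E n y) \<longlonglongrightarrow> 0"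
          by (elim Lim_transform_eventually) (auto elim!: eventually_mono simp: E_def)
      qed
      show "AE y in M. norm (E n y) \<le> 2 * g y" for n
      proof (intro AE_I2)
        fix y assume y: "y \<in> space M"
        have g0: "0 \<le> g y" using bound[OF U(2) y] norm_ge_zero order_trans by blast
        show "norm (E n y) \<le> 2 * g y"
        proof (cases "norm (X n) < r")
          case True
          have "norm (k (x0 + X n) y - k x0 y) \<le> g y * norm (x0 + X n - x0)"
          proof (rule differentiable_bound[where S = "ball x0 r" and f' = "\<lambda>x h. k' x y \<bullet> h"])
            fix x assume x: "x \<in> ball x0 r"
            then have "x \<in> U" using r by auto
            then show "((\<lambda>x. k x y) has_derivative (\<lambda>h. k' x y \<bullet> h)) (at x within ball x0 r)"
              using der y by (auto intro: has_derivative_at_withinI)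
            show "onorm (\<lambda>h. k' x y \<bullet> h) \<le> g y"
              by (rule onorm_bound[OF g0]) (metis Cauchy_Schwarz_ineq2 \<open>x \<in> U\<close> bound y mult_right_mono norm_ge_zero order_trans real_norm_def)
          qed (use True r in \<open>auto simp: dist_norm\<close>)
          moreover have "norm (k' x0 y \<bullet> X n) \<le> g y * norm (X n)"
            using bound[OF U(2) y] by (metis Cauchy_Schwarz_ineq2 mult_right_mono norm_ge_zero order_trans real_norm_def)
          ultimately have "norm (k (x0 + X n) y - k x0 y - k' x0 y \<bullet> X n) \<le> 2 * g y * norm (X n)"
            using norm_triangle_ineq4[of "k (x0 + X n) y - k x0 y" "k' x0 y \<bullet> X n"] by simp
          then show ?thesis using True X(1) by (simp add: E_def norm_divide divide_le_eq)
        qed (use g0 in \<open>simp add: E_def\<close>)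
      qed
    qed (use g in auto)
    then have 1: "(\<lambda>n. norm (\<integral>y. E n y \<partial>M)) \<longlonglongrightarrow> 0"
      by (intro tendsto_norm_zero) simp
    have eq: "norm (\<integral>y. E n y \<partial>M) = norm (?L (X n)) / norm (X n)" if "norm (X n) < r" for n
    proof -
      have "(\<integral>y. E n y \<partial>M) = ?L (X n) / norm (X n)"
        using int[OF in_U[OF that]] int[OF U(2)] int' that by (simp add: E_def)
      then show ?thesis by (simp add: norm_divide)
    qed
    have "\<forall>\<^sub>F n in sequentially. norm (X n) < r"
      using X(2) r(1) by (auto simp: tendsto_iff dist_norm)
    then show "(\<lambda>n. norm (?L (X n)) / norm (X n)) \<longlonglongrightarrow> 0"
      by (intro Lim_transform_eventually[OF 1]) (elim eventually_mono, rule eq)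
  qed
  then show ?thesis
    by (simp add: has_derivative_at bounded_linear_inner_right)
qed

text \<open>The iterated \<open>frechet_derivative\<close>s in \<open>C2_on\<close> are awkward to compute directly. Here they are read off from a gradient
  field \<open>g\<close> and the gradients \<open>k i\<close> of its components.\<close>

lemma C2_onI:
  fixes u :: "real^'n::finite \<Rightarrow> real" and g :: "real^'n \<Rightarrow> real^'n" and k :: "'n \<Rightarrow> real^'n \<Rightarrow> real^'n"
  assumes S: "open S"
    and g: "\<And>x. x \<in> S \<Longrightarrow> (u has_derivative (\<lambda>h. g x \<bullet> h)) (at x)"
    and k: "\<And>x i. x \<in> S \<Longrightarrow> ((\<lambda>x. g x $ i) has_derivative (\<lambda>h. k i x \<bullet> h)) (at x)"
    and cont: "\<And>i. continuous_on S (k i)"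
  shows "C2_on S u" "\<And>x. x \<in> S \<Longrightarrow> laplacian u x = (\<Sum>i\<in>UNIV. k i x $ i)"
proof -
  have p1: "partial_deriv i u x = g x $ i" if "x \<in> S" for x i
    using frechet_derivative_at[OF g[OF that], symmetric]
    by (simp add: partial_deriv_def inner_axis)
  have d1: "(partial_deriv i u has_derivative (\<lambda>h. k i x \<bullet> h)) (at x)" if "x \<in> S" for x i
    by (rule has_derivative_transform_within_open[OF k[OF that] S that]) (simp add: p1)
  have p2: "partial_deriv j (partial_deriv i u) x = k i x $ j" if "x \<in> S" for x i j
    using frechet_derivative_at[OF d1[OF that], symmetric]
    by (simp add: partial_deriv_def[of j] inner_axis)
  show "C2_on S u"
    unfolding C2_on_def
  proof (intro conjI allI)
    show "u differentiable_on S"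
      using g by (auto simp: differentiable_on_def differentiable_def intro: has_derivative_at_withinI)
    show "partial_deriv i u differentiable_on S" for i
      using d1 unfolding differentiable_on_def differentiable_def by (blast intro: has_derivative_at_withinI)
    show "continuous_on S (partial_deriv i (partial_deriv j u))" for i j
      by (rule continuous_on_eq[of _ "\<lambda>x. k j x $ i"])
        (auto simp: p2 intro!: continuous_on_component cont)
  qed
  show "laplacian u x = (\<Sum>i\<in>UNIV. k i x $ i)" if "x \<in> S" for x
    using that by (simp add: laplacian_def p2)
qed

section \<open>Densities on the disc and the singular kernel\<close>

text \<open>Right-hand sides of the Poisson equation, extended by zero. Continuity on the whole plane includes vanishing on the boundary
  circle; it holds because the solutions vanish there.\<close>

definition disc_density :: "(real^2 \<Rightarrow> real) \<Rightarrow> bool" where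
  "disc_density F \<longleftrightarrow> continuous_on UNIV F \<and> (\<forall>y. y \<notin> ball 0 1 \<longrightarrow> F y = 0)"

lemma disc_density_measurable: "disc_density F \<Longrightarrow> F \<in> borel_measurable borel"
  by (auto simp: disc_density_def intro: borel_measurable_continuous_onI)

lemma disc_density_bounded:
  assumes "disc_density F"
  obtains B where "B \<ge> 0" "\<And>y. \<bar>F y\<bar> \<le> B"
proof -
  have "compact (F ` cball 0 1)"
    using assms by (intro compact_continuous_image) (auto simp: disc_density_def intro: continuous_on_subset)
  then obtain B where B: "\<And>y. y \<in> cball 0 1 \<Longrightarrow> \<bar>F y\<bar> \<le> B"
    by (meson bounded_real compact_imp_bounded image_eqI)
  have "0 \<le> B" using B[of 0] by auto
  moreover have "\<bar>F y\<bar> \<le> B" for y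
    using B[of y] assms \<open>0 \<le> B\<close> by (cases "y \<in> ball 0 1") (auto simp: disc_density_def)
  ultimately show ?thesis using that by blast
qed

lemma integrable_continuous_on_disc:
  fixes f :: "real^2 \<Rightarrow> 'b::euclidean_space"
  assumes "continuous_on (cball 0 1) f" "\<And>y. y \<notin> ball 0 1 \<Longrightarrow> f y = 0"
  shows "integrable lborel f"
proof -
  have "integrable lborel (\<lambda>x. indicator (cball 0 1) x *\<^sub>R f x)"
    by (rule borel_integrable_compact) (use assms in auto)
  also have "(\<lambda>x. indicator (cball 0 1) x *\<^sub>R f x) = f"
    using assms(2) by (auto simp: fun_eq_iff indicator_def)
  finally show ?thesis .
qed

lemma integrable_inverse_norm_translate:
  "integrable lborel (\<lambda>y::real^2. indicator (ball 0 1) y / norm (x - y))"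
proof (rule Bochner_Integration.integrable_bound)
  let ?f = "\<lambda>z::real^2. indicator (cball 0 (norm x + 1)) z / norm z"
  show "integrable lborel (\<lambda>y. ?f (x - y))"
    by (subst integrable_reflect_translate)
      (auto intro!: integrable_inverse_norm borel_measurable_divide borel_measurable_indicator)
  show "AE y in lborel. norm (indicator (ball 0 1) y / norm (x - y)) \<le> norm (?f (x - y))"
  proof (intro AE_I2)
    fix y :: "real^2"
    have "norm (x - y) \<le> norm x + norm y" by (rule norm_triangle_ineq4)
    then show "norm (indicator (ball 0 1) y / norm (x - y)) \<le> norm (?f (x - y))"
      by (auto simp: indicator_def)
  qed
qed (auto intro!: borel_measurable_divide borel_measurable_indicator)

text \<open>A bound for the integral of \<open>1 / norm (x - y)\<close> over \<open>y\<close> in the disc that is uniform in \<open>x\<close> from the closed disc: the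
  translate of the disc lies in the disc of radius 2.\<close>

definition inverse_norm_mass :: real where
  "inverse_norm_mass = (LINT z|lborel. indicator (cball 0 2) (z::real^2) / norm z)"

lemma integral_inverse_norm_le:
  assumes "norm (x::real^2) \<le> 1"
  shows "(LINT y|lborel. indicator (ball 0 1) y / norm (x - y)) \<le> inverse_norm_mass"
proof -
  let ?f = "\<lambda>z::real^2. indicator (cball 0 2) z / norm z"
  have m: "?f \<in> borel_measurable borel"
    by (auto intro!: borel_measurable_divide borel_measurable_indicator)
  have "(LINT y|lborel. indicator (ball 0 1) y / norm (x - y)) \<le> (LINT y|lborel. ?f (x - y))"
  proof (rule integral_mono)
    show "integrable lborel (\<lambda>y. ?f (x - y))"
      by (subst integrable_reflect_translate[OF m]) (rule integrable_inverse_norm)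
    show "indicator (ball 0 1) y / norm (x - y) \<le> ?f (x - y)" for y
      using assms norm_triangle_ineq4[of x y] by (auto simp: indicator_def)
  qed (rule integrable_inverse_norm_translate)
  also have "\<dots> = inverse_norm_mass"
    unfolding inverse_norm_mass_def by (rule integral_reflect_translate[OF m])
  finally show ?thesis .
qed

lemma inverse_norm_mass_nonneg: "inverse_norm_mass \<ge> 0"
  unfolding inverse_norm_mass_def by (rule integral_nonneg_AE) auto

section \<open>First derivatives of the logarithmic potential\<close>

text \<open>Convolution with \<open>ln (\<bar>z\<bar>\<^sup>2 + e\<^sup>2)\<close>. The potential proper is the case \<open>e = 0\<close>; for \<open>e > 0\<close> the kernel is smooth and
  all differentiations are immediate.\<close>

definition log_potential :: "real \<Rightarrow> (real^2 \<Rightarrow> real) \<Rightarrow> real^2 \<Rightarrow> real" where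
  "log_potential e F x = (LINT y|lborel. ln ((x - y) \<bullet> (x - y) + e\<^sup>2) * F y)"

text \<open>The formal gradient, already substituted so that the singularity sits at the origin and \<open>x\<close> enters through the density only.\<close>

definition log_potential_grad :: "real \<Rightarrow> (real^2 \<Rightarrow> real) \<Rightarrow> real^2 \<Rightarrow> real^2" where
  "log_potential_grad e F x = (LINT z|lborel. (2 * F (x - z) / (z \<bullet> z + e\<^sup>2)) *\<^sub>R z)"

lemma reg_kernel_bound:
  fixes w :: "'a::real_inner"
  assumes "e > 0"
  shows "norm ((2 * c / (w \<bullet> w + e\<^sup>2)) *\<^sub>R w) \<le> \<bar>c\<bar> / e"
proof -
  have "0 \<le> (norm w - e)\<^sup>2" by simp
  then have "2 * norm w * e \<le> w \<bullet> w + e\<^sup>2"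
    by (simp add: power2_diff dot_square_norm)
  moreover have pos: "w \<bullet> w + e\<^sup>2 > 0" using assms by (simp add: add_nonneg_pos)
  ultimately have "2 * norm w / (w \<bullet> w + e\<^sup>2) \<le> 1 / e"
    using assms by (simp add: field_simps)
  then have "\<bar>c\<bar> * (2 * norm w / (w \<bullet> w + e\<^sup>2)) \<le> \<bar>c\<bar> * (1 / e)"
    by (intro mult_left_mono) auto
  then show ?thesis using pos by (simp add: abs_mult field_simps)
qed

lemma kernel_bound:
  fixes w :: "'a::real_inner"
  shows "norm ((2 * c / (w \<bullet> w + e\<^sup>2)) *\<^sub>R w) \<le> 2 * \<bar>c\<bar> / norm w"
proof (cases "w = 0")
  case False
  then have "2 * \<bar>c\<bar> * norm w / (w \<bullet> w + e\<^sup>2) \<le> 2 * \<bar>c\<bar> * norm w / (w \<bullet> w)"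
    by (intro divide_left_mono) (auto intro!: mult_pos_pos add_pos_nonneg)
  then show ?thesis using False by (simp add: abs_mult dot_square_norm power2_eq_square)
qed simp

lemma tendsto_inverse_Suc: "(\<lambda>n. 1 / real (Suc n)) \<longlonglongrightarrow> 0"
  using LIMSEQ_inverse_real_of_nat by (simp add: inverse_eq_divide)

text \<open>The size of the error made by the regularised gradient kernel, see \<open>norm_kernel_diff\<close>.\<close>

definition kernel_gap :: "real \<Rightarrow> real^2 \<Rightarrow> real" where
  "kernel_gap e z = 2 / norm z - 2 * norm z / (z \<bullet> z + e\<^sup>2)"

lemma kernel_gap_bounds: "0 \<le> kernel_gap e z" "kernel_gap e z \<le> 2 / norm z"
proof -
  show "0 \<le> kernel_gap e z" using kernel_bound[of 1 z e] by (simp add: kernel_gap_def abs_mult)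
  have "0 \<le> 2 * norm z / (z \<bullet> z + e\<^sup>2)" by (intro divide_nonneg_nonneg) auto
  then show "kernel_gap e z \<le> 2 / norm z" by (simp add: kernel_gap_def)
qed

lemma kernel_gap_measurable[measurable]: "kernel_gap e \<in> borel_measurable borel"
  unfolding kernel_gap_def by measurable

lemma norm_kernel_diff:
  "norm ((2 * c / (z \<bullet> z + e\<^sup>2)) *\<^sub>R z - (2 * c / (z \<bullet> z + 0\<^sup>2)) *\<^sub>R z) = \<bar>c\<bar> * kernel_gap e z"
proof (cases "z = 0")
  case False
  have "(2 * c / (z \<bullet> z + e\<^sup>2)) *\<^sub>R z - (2 * c / (z \<bullet> z + 0\<^sup>2)) *\<^sub>R z = (- c * kernel_gap e z / norm z) *\<^sub>R z"
    using False unfolding scaleR_diff_left[symmetric]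
    by (simp add: kernel_gap_def dot_square_norm power2_eq_square right_diff_distrib diff_divide_distrib mult.commute)
  then show ?thesis using False kernel_gap_bounds(1)[of e z] by (simp add: abs_mult)
qed (simp add: kernel_gap_def)

lemma indicator_cball_measurable: "(\<lambda>z::real^2. indicator (cball 0 R) z :: real) \<in> borel_measurable borel"
  by (rule borel_measurable_indicator) simp

text \<open>The derivative of the smooth kernel is bounded by \<open>1 / e\<close>, so it can be taken under the integral.\<close>

lemma reg_log_potential_has_derivative:
  assumes F: "disc_density F" and e: "e > 0"
  shows "(log_potential e F has_derivative (\<lambda>h. log_potential_grad e F x \<bullet> h)) (at x)"
proof -
  have Fc: "continuous_on A F" for A using F by (auto simp: disc_density_def intro: continuous_on_subset)
  note [measurable] = disc_density_measurable[OF F]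
  have pos: "(x - y) \<bullet> (x - y) + e\<^sup>2 > 0" for x y :: "real^2"
    using e by (simp add: add_nonneg_pos)
  let ?k' = "\<lambda>x y. (2 * F y / ((x - y) \<bullet> (x - y) + e\<^sup>2)) *\<^sub>R (x - y)"
  have "((\<lambda>x. LINT y|lborel. ln ((x - y) \<bullet> (x - y) + e\<^sup>2) * F y) has_derivative
     (\<lambda>h. (LINT y|lborel. ?k' x y) \<bullet> h)) (at x)"
  proof (rule has_derivative_integral_dominated[where U = UNIV and g = "\<lambda>y. \<bar>F y\<bar> / e"])
    show "((\<lambda>x. ln ((x - y) \<bullet> (x - y) + e\<^sup>2) * F y) has_derivative (\<lambda>h. ?k' x y \<bullet> h)) (at x)" for x y
      using pos[of x y]
      by (auto intro!: derivative_eq_intros simp: divide_inverse mult_ac) (simp add: inner_commute mult_ac)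
    show "integrable lborel (\<lambda>y. ln ((x - y) \<bullet> (x - y) + e\<^sup>2) * F y)" for x
    proof (rule integrable_continuous_on_disc)
      have "(x - y) \<bullet> (x - y) + e\<^sup>2 \<noteq> 0" for y using pos[of x y] by linarith
      then show "continuous_on (cball 0 1) (\<lambda>y. ln ((x - y) \<bullet> (x - y) + e\<^sup>2) * F y)"
        by (intro continuous_intros Fc) auto
    qed (use F in \<open>simp add: disc_density_def\<close>)
    have "integrable lborel F"
      by (rule integrable_continuous_on_disc[OF Fc]) (use F in \<open>simp add: disc_density_def\<close>)
    then show "integrable lborel (\<lambda>y. \<bar>F y\<bar> / e)" by simp
  qed (use reg_kernel_bound[OF e] in auto)
  also have "(LINT y|lborel. ?k' x y) = (LINT y|lborel. (\<lambda>z. (2 * F (x - z) / (z \<bullet> z + e\<^sup>2)) *\<^sub>R z) (x - y))"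
    by simp
  also have "\<dots> = log_potential_grad e F x"
    unfolding log_potential_grad_def by (rule integral_reflect_translate) measurable
  finally show ?thesis by (simp add: log_potential_def[abs_def])
qed

lemma integrable_log_kernel:
  assumes F: "disc_density F"
  shows "integrable lborel (\<lambda>z. (2 * F (x - z) / (z \<bullet> z + e\<^sup>2)) *\<^sub>R z)"
proof -
  note [measurable] = disc_density_measurable[OF F]
  obtain B where B: "B \<ge> 0" "\<And>y. \<bar>F y\<bar> \<le> B" by (rule disc_density_bounded[OF F]) auto
  let ?g = "\<lambda>z::real^2. 2 * B * (indicator (cball 0 (norm x + 1)) z / norm z)"
  have supp: "\<bar>F (x - z)\<bar> \<le> B * indicator (cball 0 (norm x + 1)) z" for z
  proof (cases "x - z \<in> ball 0 1")
    case True
    have "norm z \<le> norm x + norm (x - z)" using norm_triangle_ineq4[of x "x - z"] by simp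
    then show ?thesis using True B by auto
  next
    case False
    then have "F (x - z) = 0" using F by (simp add: disc_density_def)
    then show ?thesis using B by simp
  qed
  have "integrable lborel ?g"
    by (intro integrable_mult_right integrable_inverse_norm)
  then show ?thesis
  proof (rule Bochner_Integration.integrable_bound, measurable, intro AE_I2)
    fix z
    show "norm ((2 * F (x - z) / (z \<bullet> z + e\<^sup>2)) *\<^sub>R z) \<le> norm (?g z)"
      using kernel_bound[of "F (x - z)" z e] divide_right_mono[OF supp, of "norm z" z] B(1) by simp
  qed
qed

text \<open>The gap tends to zero away from the origin and is dominated by \<open>2 / norm z\<close>.\<close>

lemma kernel_gap_integral_tendsto:
  "(\<lambda>n. LINT z|lborel. indicator (cball 0 R) z * kernel_gap (1 / real (Suc n)) z) \<longlonglongrightarrow> 0"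
proof -
  note [measurable] = indicator_cball_measurable
  have "(\<lambda>n. LINT z|lborel. indicator (cball 0 R) z * kernel_gap (1 / real (Suc n)) z)
      \<longlonglongrightarrow> (LINT z|(lborel :: (real^2) measure). (0::real))"
  proof (rule integral_dominated_convergence[where w = "\<lambda>z::real^2. 2 * (indicator (cball 0 R) z / norm z)"])
    show "integrable lborel (\<lambda>z::real^2. 2 * (indicator (cball 0 R) z / norm z))"
      by (intro integrable_mult_right integrable_inverse_norm)
    show "AE z in lborel. (\<lambda>n. indicator (cball 0 R) z * kernel_gap (1 / real (Suc n)) z) \<longlonglongrightarrow> 0"
    proof (intro AE_I2)
      fix z :: "real^2"
      have "(\<lambda>n. kernel_gap (1 / real (Suc n)) z) \<longlonglongrightarrow> 0"
      proof (cases "z = 0")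
        case False
        have "(\<lambda>n. kernel_gap (1 / real (Suc n)) z) \<longlonglongrightarrow> 2 / norm z - 2 * norm z / (z \<bullet> z + 0\<^sup>2)"
          unfolding kernel_gap_def using False by (intro tendsto_intros tendsto_inverse_Suc) auto
        then show ?thesis using False by (simp add: dot_square_norm power2_eq_square)
      qed (simp add: kernel_gap_def)
      then show "(\<lambda>n. indicator (cball 0 R) z * kernel_gap (1 / real (Suc n)) z) \<longlonglongrightarrow> 0"
        by (rule tendsto_mult_right_zero)
    qed
    show "AE z in lborel. norm (indicator (cball 0 R) z * kernel_gap (1 / real (Suc n)) z) \<le> 2 * (indicator (cball 0 R) z / norm z)" for n
      using kernel_gap_bounds by (intro AE_I2) (simp add: indicator_def)
  qed measurable
  then show ?thesis by simp
qed

lemma disc_density_translate_support: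
  assumes "disc_density F" "x \<in> ball 0 R" "z \<notin> cball 0 (R + 1)"
  shows "F (x - z) = 0"
proof -
  have "norm z \<le> norm x + norm (x - z)" using norm_triangle_ineq4[of x "x - z"] by simp
  then have "x - z \<notin> ball 0 1" using assms(2,3) by auto
  then show ?thesis using assms(1) by (simp add: disc_density_def)
qed

lemma log_potential_tendsto:
  assumes F: "disc_density F"
  shows "(\<lambda>n. log_potential (1 / real (Suc n)) F x) \<longlonglongrightarrow> log_potential 0 F x"
proof -
  note [measurable] = disc_density_measurable[OF F]
  obtain B where B: "B \<ge> 0" "\<And>y. \<bar>F y\<bar> \<le> B" by (rule disc_density_bounded[OF F]) auto
  let ?A = "(norm x + 1)\<^sup>2 + 1"
  let ?w = "\<lambda>y. B * (?A * indicator (ball 0 1) y + 2 * (indicator (ball 0 1) y / norm (x - y)))"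
  have AE: "AE y in lborel. y \<noteq> x" by (rule AE_lborel_singleton)
  show ?thesis
    unfolding log_potential_def
  proof (rule integral_dominated_convergence[where w = ?w])
    show "integrable lborel ?w"
      by (intro integrable_mult_right Bochner_Integration.integrable_add integrable_inverse_norm_translate)
        (use emeasure_lborel_ball_finite[of "0::real^2" 1] in \<open>auto intro!: integrable_real_indicator\<close>)
    show "AE y in lborel. (\<lambda>n. ln ((x - y) \<bullet> (x - y) + (1 / real (Suc n))\<^sup>2) * F y) \<longlonglongrightarrow> ln ((x - y) \<bullet> (x - y) + 0\<^sup>2) * F y"
    proof (rule AE_mp[OF AE], intro AE_I2 impI)
      fix y assume "y \<noteq> x"
      show "(\<lambda>n. ln ((x - y) \<bullet> (x - y) + (1 / real (Suc n))\<^sup>2) * F y) \<longlonglongrightarrow> ln ((x - y) \<bullet> (x - y) + 0\<^sup>2) * F y"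
        using \<open>y \<noteq> x\<close> by (intro tendsto_intros tendsto_inverse_Suc) auto
    qed
    show "AE y in lborel. norm (ln ((x - y) \<bullet> (x - y) + (1 / real (Suc n))\<^sup>2) * F y) \<le> ?w y" for n
    proof (rule AE_mp[OF AE], intro AE_I2 impI)
      fix y assume ne: "y \<noteq> x"
      let ?t = "(x - y) \<bullet> (x - y) + (1 / real (Suc n))\<^sup>2"
      show "norm (ln ?t * F y) \<le> ?w y"
      proof (cases "y \<in> ball 0 1")
        case True
        have pos: "(x - y) \<bullet> (x - y) > 0" using ne by simp
        have e1: "(1 / real (Suc n))\<^sup>2 \<le> 1" by (simp add: power_le_one)
        have "norm (x - y) \<le> norm x + 1" using norm_triangle_ineq4[of x y] True by simp
        then have "(x - y) \<bullet> (x - y) \<le> (norm x + 1)\<^sup>2"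
          by (simp add: dot_square_norm power_mono)
        with e1 have t: "?t \<le> ?A" "?t > 0" using pos by (auto intro: add_pos_nonneg)
        have "ln ?t \<le> ?t - 1" by (rule ln_le_minus_one[OF t(2)])
        moreover have "- ln ?t \<le> 2 / norm (x - y)"
        proof -
          have "ln ((x - y) \<bullet> (x - y)) \<le> ln ?t"
            using pos t(2) by (subst ln_le_cancel_iff) auto
          then have "- ln ?t \<le> - ln ((x - y) \<bullet> (x - y))" by simp
          also have "ln ((x - y) \<bullet> (x - y)) = 2 * ln (norm (x - y))"
            using ne by (simp add: dot_square_norm ln_realpow)
          also have "- (2 * ln (norm (x - y))) = 2 * ln (1 / norm (x - y))"
            using ne by (simp add: ln_div)
          also have "\<dots> \<le> 2 * (1 / norm (x - y))"
            using ne ln_le_minus_one[of "1 / norm (x - y)"] by simp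
          finally show ?thesis by simp
        qed
        moreover have "0 \<le> 2 / norm (x - y)" by simp
        ultimately have "\<bar>ln ?t\<bar> \<le> ?A + 2 / norm (x - y)" using t unfolding abs_le_iff by linarith
        then have "\<bar>ln ?t\<bar> * \<bar>F y\<bar> \<le> (?A + 2 / norm (x - y)) * B"
          using B by (intro mult_mono) (auto intro!: add_nonneg_nonneg)
        then show ?thesis using True by (simp add: abs_mult mult.commute)
      qed (use F in \<open>simp add: disc_density_def\<close>)
    qed
    show "(\<lambda>y. ln ((x - y) \<bullet> (x - y) + 0\<^sup>2) * F y) \<in> borel_measurable lborel"
      "(\<lambda>y. ln ((x - y) \<bullet> (x - y) + (1 / real (Suc n))\<^sup>2) * F y) \<in> borel_measurable lborel" for n
      by measurable
  qed
qed

text \<open>The error is bounded by the integral of the gap uniformly in \<open>x\<close>; this uniformity is what allows the limit of the gradients.\<close>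

lemma log_potential_grad_error:
  assumes F: "disc_density F" and B: "\<And>y. \<bar>F y\<bar> \<le> B" and x: "x \<in> ball 0 R"
  shows "norm (log_potential_grad e F x - log_potential_grad 0 F x) \<le>
    B * (LINT z|lborel. indicator (cball 0 (R + 1)) z * kernel_gap e z)"
    (is "_ \<le> B * (LINT z|lborel. ?E z)")
proof -
  note [measurable] = disc_density_measurable[OF F] indicator_cball_measurable
  have int: "integrable lborel ?E"
  proof (rule Bochner_Integration.integrable_bound)
    show "integrable lborel (\<lambda>z::real^2. 2 * (indicator (cball 0 (R + 1)) z / norm z))"
      by (intro integrable_mult_right integrable_inverse_norm)
    show "AE z in lborel. norm (?E z) \<le> norm (2 * (indicator (cball 0 (R + 1)) z / norm (z::real^2)))"
      using kernel_gap_bounds by (intro AE_I2) (simp add: indicator_def)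
  qed measurable
  let ?d = "\<lambda>z. (2 * F (x - z) / (z \<bullet> z + e\<^sup>2)) *\<^sub>R z - (2 * F (x - z) / (z \<bullet> z + 0\<^sup>2)) *\<^sub>R z"
  have "log_potential_grad e F x - log_potential_grad 0 F x = (LINT z|lborel. ?d z)"
    unfolding log_potential_grad_def
    by (rule Bochner_Integration.integral_diff[symmetric]) (rule integrable_log_kernel[OF F])+
  also have "norm \<dots> \<le> (LINT z|lborel. B * ?E z)"
  proof (rule Bochner_Integration.integral_norm_bound_integral)
    show "integrable lborel ?d"
      by (intro Bochner_Integration.integrable_diff integrable_log_kernel F)
    show "integrable lborel (\<lambda>z. B * ?E z)" by (intro integrable_mult_right int)
    fix z :: "real^2"
    have "\<bar>F (x - z)\<bar> * kernel_gap e z \<le> B * ?E z"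
    proof (cases "z \<in> cball 0 (R + 1)")
      case True
      then show ?thesis using B kernel_gap_bounds(1) by (simp add: mult_right_mono)
    qed (use disc_density_translate_support[OF F x] in simp)
    then show "norm (?d z) \<le> B * ?E z" by (simp only: norm_kernel_diff)
  qed
  finally show ?thesis by simp
qed

text \<open>The regularised potentials converge pointwise and their gradients uniformly on discs.\<close>

lemma log_potential_has_derivative:
  assumes F: "disc_density F"
  shows "(log_potential 0 F has_derivative (\<lambda>h. log_potential_grad 0 F x \<bullet> h)) (at x)"
proof -
  define R where "R = norm x + 1"
  obtain B where B: "B \<ge> 0" "\<And>y. \<bar>F y\<bar> \<le> B" by (rule disc_density_bounded[OF F]) auto
  let ?e = "\<lambda>n. 1 / real (Suc n)"
  let ?I = "\<lambda>n. LINT z|lborel. indicator (cball 0 (R + 1)) z * kernel_gap (?e n) z"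
  have x: "x \<in> ball 0 R" by (simp add: R_def)
  have "\<exists>g. \<forall>y\<in>ball 0 R. (\<lambda>n. log_potential (?e n) F y) \<longlonglongrightarrow> g y \<and>
      (g has_derivative (\<lambda>h. log_potential_grad 0 F y \<bullet> h)) (at y within ball 0 R)"
  proof (rule has_derivative_sequence[where f' = "\<lambda>n y h. log_potential_grad (?e n) F y \<bullet> h", OF _ _ _ x log_potential_tendsto[OF F]])
    show "(log_potential (?e n) F has_derivative (\<lambda>h. log_potential_grad (?e n) F y \<bullet> h)) (at y within ball 0 R)" for n and y :: "real^2"
      by (rule has_derivative_at_withinI[OF reg_log_potential_has_derivative[OF F]]) simp
    fix \<epsilon> :: real assume "\<epsilon> > 0"
    have "(\<lambda>n. B * ?I n) \<longlonglongrightarrow> 0"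
      using tendsto_mult_right_zero[OF kernel_gap_integral_tendsto[of "R + 1"], of B] by simp
    then have "\<forall>\<^sub>F n in sequentially. B * ?I n < \<epsilon>"
      using \<open>\<epsilon> > 0\<close> by (rule order_tendstoD)
    then show "\<forall>\<^sub>F n in sequentially. \<forall>y\<in>ball 0 R. \<forall>h.
        norm (log_potential_grad (?e n) F y \<bullet> h - log_potential_grad 0 F y \<bullet> h) \<le> \<epsilon> * norm h"
    proof (rule eventually_mono, intro ballI allI)
      fix n and y h :: "real^2" assume n: "B * ?I n < \<epsilon>" and y: "y \<in> ball 0 R"
      have "norm (log_potential_grad (?e n) F y \<bullet> h - log_potential_grad 0 F y \<bullet> h)
        \<le> norm (log_potential_grad (?e n) F y - log_potential_grad 0 F y) * norm h"
        by (simp add: inner_diff_left[symmetric] Cauchy_Schwarz_ineq2)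
      also have "\<dots> \<le> \<epsilon> * norm h"
        using log_potential_grad_error[OF F B(2) y, of "?e n"] n by (intro mult_right_mono) auto
      finally show "norm (log_potential_grad (?e n) F y \<bullet> h - log_potential_grad 0 F y \<bullet> h) \<le> \<epsilon> * norm h" .
    qed
  qed simp
  then obtain g where g: "\<And>y. y \<in> ball 0 R \<Longrightarrow> (\<lambda>n. log_potential (?e n) F y) \<longlonglongrightarrow> g y"
      "\<And>y. y \<in> ball 0 R \<Longrightarrow> (g has_derivative (\<lambda>h. log_potential_grad 0 F y \<bullet> h)) (at y within ball 0 R)"
    by blast
  have eq: "g y = log_potential 0 F y" if "y \<in> ball 0 R" for y
    using LIMSEQ_unique[OF g(1)[OF that] log_potential_tendsto[OF F]] .
  have "(g has_derivative (\<lambda>h. log_potential_grad 0 F x \<bullet> h)) (at x)"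
    using g(2)[OF x] at_within_open[OF x] by simp
  then show ?thesis
    by (rule has_derivative_transform_within_open[OF _ open_ball x]) (rule eq)
qed

lemma log_potential_grad_continuous:
  assumes F: "disc_density F"
  shows "continuous_on UNIV (log_potential_grad 0 F)"
proof -
  note [measurable] = disc_density_measurable[OF F]
  have Fc: "continuous_on UNIV F" using F by (simp add: disc_density_def)
  obtain B where B: "B \<ge> 0" "\<And>y. \<bar>F y\<bar> \<le> B" by (rule disc_density_bounded[OF F]) auto
  have "continuous_on (ball 0 R) (log_potential_grad 0 F)" for R
    unfolding log_potential_grad_def
  proof (rule continuous_on_integral_dominated[where g = "\<lambda>z. 2 * B * (indicator (cball 0 (R + 1)) z / norm z)"])
    show "integrable lborel (\<lambda>z::real^2. 2 * B * (indicator (cball 0 (R + 1)) z / norm z))"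
      by (intro integrable_mult_right integrable_inverse_norm)
    show "continuous_on (ball 0 R) (\<lambda>x. (2 * F (x - z) / (z \<bullet> z + 0\<^sup>2)) *\<^sub>R z)" for z
      unfolding divide_inverse
      by (intro continuous_intros continuous_on_compose2[OF Fc]) auto
    fix x z :: "real^2" assume x: "x \<in> ball 0 R"
    show "norm ((2 * F (x - z) / (z \<bullet> z + 0\<^sup>2)) *\<^sub>R z) \<le> 2 * B * (indicator (cball 0 (R + 1)) z / norm z)"
    proof (cases "z \<in> cball 0 (R + 1)")
      case True
      then show ?thesis
        using kernel_bound[of "F (x - z)" z 0] divide_right_mono[of "2 * \<bar>F (x - z)\<bar>" "2 * B" "norm z"] B(2)[of "x - z"]
        by simp
    qed (use disc_density_translate_support[OF F x] in simp)
  qed measurable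
  then have "continuous (at x) (log_potential_grad 0 F)" for x
    by (metis centre_in_ball continuous_on_eq_continuous_at dist_0_norm linordered_field_no_ub mem_ball open_ball)
  then show ?thesis by (simp add: continuous_at_imp_continuous_on)
qed

lemma log_potential_grad_bounded:
  assumes F: "disc_density F" and B: "\<And>y. \<bar>F y\<bar> \<le> B" and x: "norm x \<le> 1"
  shows "norm (log_potential_grad 0 F x) \<le> 2 * B * inverse_norm_mass"
proof -
  have "norm (log_potential_grad 0 F x) \<le> (LINT z|lborel. 2 * B * (indicator (cball 0 2) (z::real^2) / norm z))"
    unfolding log_potential_grad_def
  proof (rule Bochner_Integration.integral_norm_bound_integral)
    fix z
    show "norm ((2 * F (x - z) / (z \<bullet> z + 0\<^sup>2)) *\<^sub>R z) \<le> 2 * B * (indicator (cball 0 2) z / norm z)"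
    proof (cases "z \<in> cball 0 2")
      case True
      then show ?thesis
        using kernel_bound[of "F (x - z)" z 0] divide_right_mono[of "2 * \<bar>F (x - z)\<bar>" "2 * B" "norm z"] B[of "x - z"]
        by simp
    next
      case False
      have "norm z \<le> norm x + norm (x - z)" using norm_triangle_ineq4[of x "x - z"] by simp
      then have "x - z \<notin> ball 0 1" using False x by auto
      then show ?thesis using F False by (simp add: disc_density_def)
    qed
  qed (intro integrable_log_kernel F integrable_mult_right integrable_inverse_norm)+
  also have "\<dots> = 2 * B * inverse_norm_mass"
    unfolding inverse_norm_mass_def by (rule integral_mult_right_zero)
  finally show ?thesis .
qed

section \<open>Second derivatives and the Laplacian of the logarithmic potential\<close>

text \<open>Densities with a continuous gradient on the whole plane, again extended by zero.\<close>

definition disc_density_C1 :: "(real^2 \<Rightarrow> real) \<Rightarrow> (real^2 \<Rightarrow> real^2) \<Rightarrow> bool" where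
  "disc_density_C1 F F' \<longleftrightarrow> disc_density F \<and> (\<forall>x. (F has_derivative (\<lambda>h. F' x \<bullet> h)) (at x)) \<and>
     continuous_on UNIV F' \<and> (\<forall>y. y \<notin> ball 0 1 \<longrightarrow> F' y = 0)"

lemma disc_density_C1_bounded:
  assumes "disc_density_C1 F F'"
  obtains B where "B \<ge> 0" "\<And>y. norm (F' y) \<le> B"
proof -
  have "compact (F' ` cball 0 1)"
    using assms by (intro compact_continuous_image) (auto simp: disc_density_C1_def intro: continuous_on_subset)
  then obtain B where B: "\<And>y. y \<in> cball 0 1 \<Longrightarrow> norm (F' y) \<le> B"
    by (meson bounded_iff compact_imp_bounded image_eqI)
  have "0 \<le> norm (F' 0)" by simp
  also have "\<dots> \<le> B" using B[of 0] by simp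
  finally have "0 \<le> B" .
  moreover have "norm (F' y) \<le> B" for y
    using B[of y] assms \<open>0 \<le> B\<close> by (cases "y \<in> ball 0 1") (auto simp: disc_density_C1_def)
  ultimately show ?thesis using that by blast
qed

lemma disc_density_C1_measurable: "disc_density_C1 F F' \<Longrightarrow> F' \<in> borel_measurable borel"
  by (auto simp: disc_density_C1_def intro: borel_measurable_continuous_onI)

text \<open>The component in direction \<open>v\<close> of the gradient of \<open>ln (\<bar>z\<bar>\<^sup>2 + e\<^sup>2)\<close>.\<close>

definition conv_kernel :: "real \<Rightarrow> real^2 \<Rightarrow> real^2 \<Rightarrow> real" where
  "conv_kernel e v z = 2 * (z \<bullet> v) / (z \<bullet> z + e\<^sup>2)"

text \<open>The second derivative of the kernel is not integrable, so the second derivative of the potential is written with one derivative on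
  the kernel and the other on the density.\<close>

definition conv_hess :: "real \<Rightarrow> (real^2 \<Rightarrow> real^2) \<Rightarrow> real^2 \<Rightarrow> real^2 \<Rightarrow> real^2" where
  "conv_hess e F' v x = (LINT z|lborel. conv_kernel e v z *\<^sub>R F' (x - z))"

lemma conv_kernel_measurable[measurable]: "conv_kernel e v \<in> borel_measurable borel"
  unfolding conv_kernel_def by measurable

lemma conv_kernel_bound:
  assumes "norm v \<le> 1"
  shows "\<bar>conv_kernel e v z\<bar> \<le> 2 / norm z"
proof -
  let ?w = "(2 * 1 / (z \<bullet> z + e\<^sup>2)) *\<^sub>R z"
  have "\<bar>conv_kernel e v z\<bar> = \<bar>?w \<bullet> v\<bar>" by (simp add: conv_kernel_def)
  also have "\<dots> \<le> norm ?w * norm v" by (rule Cauchy_Schwarz_ineq2)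
  also have "\<dots> \<le> norm ?w" using assms by (intro mult_left_le) auto
  also have "\<dots> \<le> 2 / norm z" using kernel_bound[of 1 z e] by simp
  finally show ?thesis .
qed

lemma conv_kernel_dominated:
  assumes F: "\<And>y. norm (f y) \<le> B" "\<And>y. y \<notin> ball 0 1 \<Longrightarrow> f y = 0" and v: "norm v \<le> 1" and x: "x \<in> ball 0 R"
  shows "\<bar>conv_kernel e v z\<bar> * norm (f (x - z)) \<le> 2 * B * (indicator (cball 0 (R + 1)) z / norm z)"
proof (cases "z \<in> cball 0 (R + 1)")
  case True
  have "0 \<le> norm (f 0)" by simp
  also have "\<dots> \<le> B" by (rule F(1))
  finally have "B \<ge> 0" .
  have "\<bar>conv_kernel e v z\<bar> * norm (f (x - z)) \<le> 2 / norm z * B"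
    using conv_kernel_bound[OF v] F(1) \<open>B \<ge> 0\<close> by (intro mult_mono) auto
  then show ?thesis using True by (simp add: mult.commute)
next
  case False
  have "norm z \<le> norm x + norm (x - z)" using norm_triangle_ineq4[of x "x - z"] by simp
  then have "x - z \<notin> ball 0 1" using False x by auto
  then show ?thesis using F(2) False by simp
qed

text \<open>Only the density depends on \<open>x\<close> here, and its gradient is bounded with compact support, so the
  integrable singularity \<open>2 / norm z\<close> dominates everything.\<close>

lemma conv_has_derivative:
  assumes F: "disc_density_C1 F F'" and v: "norm v \<le> 1"
  shows "((\<lambda>x. LINT z|lborel. conv_kernel e v z * F (x - z)) has_derivative (\<lambda>h. conv_hess e F' v x \<bullet> h)) (at x)"
    and "integrable lborel (\<lambda>z. conv_kernel e v z *\<^sub>R F' (x - z))"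
    and "continuous_on UNIV (conv_hess e F' v)"
proof -
  have dF: "disc_density F" using F by (simp add: disc_density_C1_def)
  note [measurable] = disc_density_measurable[OF dF] disc_density_C1_measurable[OF F]
  obtain B where B: "B \<ge> 0" "\<And>y. \<bar>F y\<bar> \<le> B" using disc_density_bounded[OF dF] by metis
  obtain B' where B': "B' \<ge> 0" "\<And>y. norm (F' y) \<le> B'" using disc_density_C1_bounded[OF F] by metis
  have supp: "\<And>y. y \<notin> ball 0 1 \<Longrightarrow> F y = 0" "\<And>y. y \<notin> ball 0 1 \<Longrightarrow> F' y = 0"
    using F dF by (auto simp: disc_density_C1_def disc_density_def)
  have Fc: "continuous_on UNIV F'" using F by (simp add: disc_density_C1_def)
  have g: "integrable lborel (\<lambda>z::real^2. 2 * C * (indicator (cball 0 (R + 1)) z / norm z))" for C R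
    by (intro integrable_mult_right integrable_inverse_norm)
  have dom': "norm (conv_kernel e v z *\<^sub>R F' (x - z)) \<le> 2 * B' * (indicator (cball 0 (R + 1)) z / norm z)"
    if "x \<in> ball 0 R" for R x z
    using conv_kernel_dominated[of F', OF B'(2) supp(2) v that] by simp
  show "((\<lambda>x. LINT z|lborel. conv_kernel e v z * F (x - z)) has_derivative (\<lambda>h. conv_hess e F' v x \<bullet> h)) (at x)"
    unfolding conv_hess_def
  proof (rule has_derivative_integral_dominated[where U = "ball 0 (norm x + 1)"])
    show "integrable lborel (\<lambda>z::real^2. 2 * B' * (indicator (cball 0 (norm x + 1 + 1)) z / norm z))" by (rule g)
    show "norm (conv_kernel e v z *\<^sub>R F' (y - z)) \<le> 2 * B' * (indicator (cball 0 (norm x + 1 + 1)) z / norm z)"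
      if "y \<in> ball 0 (norm x + 1)" for y z by (rule dom'[OF that])
    show "integrable lborel (\<lambda>z. conv_kernel e v z * F (y - z))" if "y \<in> ball 0 (norm x + 1)" for y
    proof (rule Bochner_Integration.integrable_bound[OF g[of B "norm x + 1"]], measurable, intro AE_I2)
      fix z
      show "norm (conv_kernel e v z * F (y - z)) \<le> norm (2 * B * (indicator (cball 0 (norm x + 1 + 1)) z / norm z))"
        using conv_kernel_dominated[of F, OF _ supp(1) v that, of B e z] B by (simp add: abs_mult)
    qed
    show "((\<lambda>x. conv_kernel e v z * F (x - z)) has_derivative (\<lambda>h. (conv_kernel e v z *\<^sub>R F' (y - z)) \<bullet> h)) (at y)" for y z
    proof -
      have F': "(F has_derivative (\<lambda>h. F' (y - z) \<bullet> h)) (at (y - z))" using F by (simp add: disc_density_C1_def)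
      have "((\<lambda>x. x - z) has_derivative (\<lambda>h. h)) (at y)"
        by (auto intro!: derivative_eq_intros)
      from has_derivative_compose[OF this, of F "\<lambda>h. F' (y - z) \<bullet> h"] F'
      have "((\<lambda>x. F (x - z)) has_derivative (\<lambda>h. F' (y - z) \<bullet> h)) (at y)" by simp
      then show ?thesis by (auto intro!: derivative_eq_intros)
    qed
    show "(\<lambda>z. conv_kernel e v z *\<^sub>R F' (x - z)) \<in> borel_measurable lborel" by measurable
  qed auto
  show "integrable lborel (\<lambda>z. conv_kernel e v z *\<^sub>R F' (x - z))"
  proof (rule Bochner_Integration.integrable_bound[OF g[of B' "norm x + 1"]], measurable, intro AE_I2)
    fix z
    show "norm (conv_kernel e v z *\<^sub>R F' (x - z)) \<le> norm (2 * B' * (indicator (cball 0 (norm x + 1 + 1)) z / norm z))"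
      using dom'[of x "norm x + 1" z] B'(1) by simp
  qed
  have "continuous_on (ball 0 R) (conv_hess e F' v)" for R
    unfolding conv_hess_def
  proof (rule continuous_on_integral_dominated[OF _ g[of B' R] dom'])
    show "continuous_on (ball 0 R) (\<lambda>x. conv_kernel e v z *\<^sub>R F' (x - z))" for z
      by (intro continuous_intros continuous_on_compose2[OF Fc]) auto
  qed measurable
  then have "continuous (at x) (conv_hess e F' v)" for x
    by (metis centre_in_ball continuous_on_eq_continuous_at dist_0_norm linordered_field_no_ub mem_ball open_ball)
  then show "continuous_on UNIV (conv_hess e F' v)" by (simp add: continuous_at_imp_continuous_on)
qed

lemma conv_hess_tendsto:
  assumes F: "disc_density_C1 F F'" and v: "norm v \<le> 1"
  shows "(\<lambda>n. conv_hess (1 / real (Suc n)) F' v x) \<longlonglongrightarrow> conv_hess 0 F' v x"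
proof -
  note [measurable] = disc_density_C1_measurable[OF F]
  obtain B' where B': "B' \<ge> 0" "\<And>y. norm (F' y) \<le> B'" using disc_density_C1_bounded[OF F] by metis
  have supp: "\<And>y. y \<notin> ball 0 1 \<Longrightarrow> F' y = 0" using F by (auto simp: disc_density_C1_def)
  show ?thesis
    unfolding conv_hess_def
  proof (rule integral_dominated_convergence[where w = "\<lambda>z. 2 * B' * (indicator (cball 0 (norm x + 1 + 1)) z / norm z)"])
    show "integrable lborel (\<lambda>z::real^2. 2 * B' * (indicator (cball 0 (norm x + 1 + 1)) z / norm z))"
      by (intro integrable_mult_right integrable_inverse_norm)
    show "AE z in lborel. (\<lambda>n. conv_kernel (1 / real (Suc n)) v z *\<^sub>R F' (x - z)) \<longlonglongrightarrow> conv_kernel 0 v z *\<^sub>R F' (x - z)"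
    proof (intro AE_I2)
      fix z :: "real^2"
      show "(\<lambda>n. conv_kernel (1 / real (Suc n)) v z *\<^sub>R F' (x - z)) \<longlonglongrightarrow> conv_kernel 0 v z *\<^sub>R F' (x - z)"
      proof (cases "z = 0")
        case False
        then show ?thesis
          unfolding conv_kernel_def by (intro tendsto_intros tendsto_inverse_Suc) simp
      qed (simp add: conv_kernel_def)
    qed
    show "AE z in lborel. norm (conv_kernel (1 / real (Suc n)) v z *\<^sub>R F' (x - z)) \<le> 2 * B' * (indicator (cball 0 (norm x + 1 + 1)) z / norm z)" for n
      using conv_kernel_dominated[of F', OF B'(2) supp v, of x "norm x + 1"] by (intro AE_I2) simp
  qed measurable
qed

text \<open>The total mass of the Laplacian of \<open>ln (\<bar>z\<bar>\<^sup>2 + 1)\<close>. Its value is \<open>4 * pi\<close>, but the equation will be solved up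
  to a positive factor first, so positivity suffices.\<close>

definition laplace_const :: real where
  "laplace_const = 4 * (LINT z|lborel. 1 / (1 + (z::real^2) \<bullet> z)\<^sup>2)"

lemma laplace_const_pos: "laplace_const > 0"
proof -
  let ?f = "\<lambda>z::real^2. 1 / (1 + z \<bullet> z)\<^sup>2"
  have "integral\<^sup>L lborel ?f \<noteq> 0"
  proof
    assume "integral\<^sup>L lborel ?f = 0"
    then have "AE z in lborel. ?f z = 0"
      by (subst (asm) integral_nonneg_eq_0_iff_AE[OF integrable_inverse_one_plus_norm]) auto
    moreover have "?f z \<noteq> 0" for z :: "real^2"
      using add_pos_nonneg[OF zero_less_one inner_ge_zero[of z]] by simp
    ultimately have "AE z in (lborel :: (real^2) measure). False" by simp
    then show False by (simp add: AE_iff_null emeasure_lborel_UNIV null_sets_def)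
  qed
  moreover have "integral\<^sup>L lborel ?f \<ge> 0" by (rule integral_nonneg_AE) auto
  ultimately show ?thesis by (auto simp: laplace_const_def order.strict_iff_order)
qed

lemma log_potential_grad_inner:
  assumes F: "disc_density F"
  shows "log_potential_grad e F x \<bullet> v = (LINT z|lborel. conv_kernel e v z * F (x - z))"
  using integrable_log_kernel[OF F, where x = x]
  unfolding log_potential_grad_def
  by (simp add: integral_inner_left[symmetric] conv_kernel_def field_simps del: integral_inner_left)

text \<open>The Hessian of \<open>ln D\<close> for a quadratic function \<open>D\<close> with gradient \<open>2 w\<close> and Hessian \<open>2 s\<close> times the identity, applied to \<open>v\<close>.
  Used with \<open>D = \<bar>w\<bar>\<^sup>2 + e\<^sup>2\<close> and with \<open>D = image_sq x y\<close>, where \<open>s = y \<bullet> y\<close>.\<close>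

lemma hess_kernel_bound:
  fixes w v :: "'a::real_inner"
  assumes D: "w \<bullet> w \<le> D" "0 < d" "d \<le> D" and v: "norm v \<le> 1" and s: "0 \<le> s" "s \<le> 1"
  shows "norm ((2 * s / D) *\<^sub>R v - (4 * (w \<bullet> v) / D\<^sup>2) *\<^sub>R w) \<le> 6 / d"
proof -
  have D0: "D > 0" using D by linarith
  have "norm ((2 * s / D) *\<^sub>R v) \<le> 2 / D * norm v"
    using D0 s by (auto intro!: mult_right_mono divide_right_mono)
  also have "\<dots> \<le> 2 / D * 1" using v D0 by (intro mult_left_mono) auto
  finally have 1: "norm ((2 * s / D) *\<^sub>R v) \<le> 2 / D" by simp
  have "\<bar>w \<bullet> v\<bar> \<le> norm w * norm v" by (rule Cauchy_Schwarz_ineq2)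
  also have "\<dots> \<le> norm w" using v by (simp add: mult_left_le)
  finally have "\<bar>w \<bullet> v\<bar> * norm w \<le> w \<bullet> w" by (simp add: dot_square_norm power2_eq_square mult_right_mono)
  then have "4 * (\<bar>w \<bullet> v\<bar> * norm w) / D\<^sup>2 \<le> 4 * D / D\<^sup>2"
    using D by (intro divide_right_mono) auto
  also have "\<dots> = 4 / D" using D0 by (simp add: power2_eq_square)
  finally have 2: "norm ((4 * (w \<bullet> v) / D\<^sup>2) *\<^sub>R w) \<le> 4 / D" by (simp add: abs_mult mult.assoc)
  have "norm ((2 * s / D) *\<^sub>R v - (4 * (w \<bullet> v) / D\<^sup>2) *\<^sub>R w) \<le> 6 / D"
    using norm_triangle_ineq4[of "(2 * s / D) *\<^sub>R v"] 1 2 by (smt (verit) add_divide_distrib)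
  also have "\<dots> \<le> 6 / d" using D by (intro frac_le) auto
  finally show ?thesis .
qed

text \<open>For the smooth kernel both derivatives may fall on the kernel.\<close>

lemma reg_log_potential_hess:
  assumes F: "disc_density F" and e: "e > 0" and v: "norm v \<le> 1"
  defines "K \<equiv> \<lambda>x y. F y *\<^sub>R ((2 / ((x - y) \<bullet> (x - y) + e\<^sup>2)) *\<^sub>R v
        - (4 * ((x - y) \<bullet> v) / ((x - y) \<bullet> (x - y) + e\<^sup>2)\<^sup>2) *\<^sub>R (x - y))"
  shows "((\<lambda>x. log_potential_grad e F x \<bullet> v) has_derivative (\<lambda>h. (LINT y|lborel. K x y) \<bullet> h)) (at x)"
    and "integrable lborel (K x)"
proof -
  note [measurable] = disc_density_measurable[OF F]
  have Fc: "continuous_on A F" for A using F by (auto simp: disc_density_def intro: continuous_on_subset)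
  have pos: "(x - y) \<bullet> (x - y) + e\<^sup>2 > 0" for x y :: "real^2"
    using e by (simp add: add_nonneg_pos)
  have "integrable lborel F"
    by (rule integrable_continuous_on_disc[OF Fc]) (use F in \<open>simp add: disc_density_def\<close>)
  then have g: "integrable lborel (\<lambda>y. \<bar>F y\<bar> * (6 / e\<^sup>2))" by simp
  have K_meas: "K x \<in> borel_measurable lborel" for x unfolding K_def by measurable
  have K_bound: "norm (K x y) \<le> \<bar>F y\<bar> * (6 / e\<^sup>2)" for x y
    using hess_kernel_bound[of "x - y" "(x - y) \<bullet> (x - y) + e\<^sup>2" "e\<^sup>2" v 1] e v
    unfolding K_def norm_scaleR real_norm_def by (intro mult_left_mono) auto
  show "integrable lborel (K x)"
    by (rule Bochner_Integration.integrable_bound[OF g K_meas]) (use K_bound in \<open>force intro!: AE_I2 order_trans[OF K_bound]\<close>)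
  let ?k = "\<lambda>x y. conv_kernel e v (x - y) * F y"
  have "((\<lambda>x. LINT y|lborel. ?k x y) has_derivative (\<lambda>h. (LINT y|lborel. K x y) \<bullet> h)) (at x)"
  proof (rule has_derivative_integral_dominated[where U = UNIV, OF _ _ _ _ K_meas K_bound g])
    fix x y
    have "((\<lambda>x. 2 * ((x - y) \<bullet> v) * F y / ((x - y) \<bullet> (x - y) + e\<^sup>2)) has_derivative
       (\<lambda>h. F y * (2 * (h \<bullet> v) / ((x - y) \<bullet> (x - y) + e\<^sup>2)
          - 4 * ((x - y) \<bullet> v) * ((x - y) \<bullet> h) / ((x - y) \<bullet> (x - y) + e\<^sup>2)\<^sup>2))) (at x)"
    proof -
      define D where "D = (x - y) \<bullet> (x - y) + e\<^sup>2"
      have D: "D \<noteq> 0" using pos[of x y] by (simp add: D_def)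
      have dD: "((\<lambda>x. (x - y) \<bullet> (x - y) + e\<^sup>2) has_derivative (\<lambda>h. 2 * ((x - y) \<bullet> h))) (at x)"
        by (auto intro!: derivative_eq_intros simp: inner_commute)
      have dN: "((\<lambda>x. 2 * ((x - y) \<bullet> v) * F y) has_derivative (\<lambda>h. 2 * (h \<bullet> v) * F y)) (at x)"
        by (auto intro!: derivative_eq_intros)
      have quot: "(2 * a * c * D - 2 * b * c * (2 * d)) / (D * D) = c * (2 * a / D - 4 * b * d / D\<^sup>2)" for a b c d
        using D by (simp add: field_simps power2_eq_square)
      show ?thesis
        by (rule has_derivative_eq_rhs[OF has_derivative_divide'[OF dN dD]])
          (use D in \<open>simp_all only: D_def[symmetric] quot not_False_eq_True\<close>)
    qed
    moreover have "K x y \<bullet> h = F y * (2 * (h \<bullet> v) / ((x - y) \<bullet> (x - y) + e\<^sup>2)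
          - 4 * ((x - y) \<bullet> v) * ((x - y) \<bullet> h) / ((x - y) \<bullet> (x - y) + e\<^sup>2)\<^sup>2)" for h
      unfolding K_def inner_scaleR_left inner_diff_left[of "_ *\<^sub>R v"] by (simp add: inner_commute[of v])
    moreover have "?k x y = 2 * ((x - y) \<bullet> v) * F y / ((x - y) \<bullet> (x - y) + e\<^sup>2)" for x
      by (simp add: conv_kernel_def)
    ultimately show "((\<lambda>x. ?k x y) has_derivative (\<lambda>h. K x y \<bullet> h)) (at x)"
      by simp
  next
    fix x
    show "integrable lborel (\<lambda>y. ?k x y)"
    proof (rule integrable_continuous_on_disc)
      have "(x - y) \<bullet> (x - y) + e\<^sup>2 \<noteq> 0" for y using pos[of x y] by linarith
      then show "continuous_on (cball 0 1) (\<lambda>y. ?k x y)"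
        unfolding conv_kernel_def by (intro continuous_intros Fc) auto
    qed (use F in \<open>simp add: disc_density_def\<close>)
  qed auto
  moreover have "(LINT y|lborel. ?k x y) = log_potential_grad e F x \<bullet> v" for x
  proof -
    have "(LINT y|lborel. ?k x y) = (LINT y|lborel. (\<lambda>z. conv_kernel e v z * F (x - z)) (x - y))" by simp
    also have "\<dots> = log_potential_grad e F x \<bullet> v"
      unfolding log_potential_grad_inner[OF F] by (rule integral_reflect_translate) measurable
    finally show ?thesis .
  qed
  ultimately show "((\<lambda>x. log_potential_grad e F x \<bullet> v) has_derivative (\<lambda>h. (LINT y|lborel. K x y) \<bullet> h)) (at x)"
    by simp
qed

lemma inner_axis_sum:
  fixes x y :: "real^'n::finite"
  shows "(\<Sum>i\<in>UNIV. (x \<bullet> axis i 1) * (y \<bullet> axis i 1)) = x \<bullet> y"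
  by (simp only: inner_axis) (simp add: inner_vec_def)

text \<open>The second derivatives of the regularised potential have two expressions, one with both derivatives on the kernel and one with a
  derivative on the density. They agree because derivatives are unique. The trace of the first
  expression is the convolution with \<open>4 e\<^sup>2 / (\<bar>z\<bar>\<^sup>2 + e\<^sup>2)\<^sup>2\<close>, and rescaling \<open>z\<close> by \<open>e\<close> moves \<open>e\<close> into the density.\<close>

lemma reg_laplacian:
  assumes F: "disc_density_C1 F F'" and e: "e > 0"
  shows "(\<Sum>i\<in>UNIV. conv_hess e F' (axis i 1) x \<bullet> axis i 1) =
     (LINT w|lborel. 4 / (1 + w \<bullet> w)\<^sup>2 * F (x - e *\<^sub>R w))"
proof -
  have dF: "disc_density F" using F by (simp add: disc_density_C1_def)
  note [measurable] = disc_density_measurable[OF dF]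
  let ?D = "\<lambda>y. (x - y) \<bullet> (x - y) + e\<^sup>2"
  have D: "?D y > 0" for y using e by (simp add: add_nonneg_pos)
  define K where "K v y = F y *\<^sub>R ((2 / ?D y) *\<^sub>R v - (4 * ((x - y) \<bullet> v) / (?D y)\<^sup>2) *\<^sub>R (x - y))" for v y
  have eq: "conv_hess e F' v x = (LINT y|lborel. K v y)" if v: "norm v \<le> 1" for v
  proof -
    have "((\<lambda>x. log_potential_grad e F x \<bullet> v) has_derivative (\<lambda>h. conv_hess e F' v x \<bullet> h)) (at x)"
      unfolding log_potential_grad_inner[OF dF] by (rule conv_has_derivative(1)[OF F v])
    from has_derivative_unique[OF this reg_log_potential_hess(1)[OF dF e v]]
    have "conv_hess e F' v x \<bullet> h = (LINT y|lborel. K v y) \<bullet> h" for h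
      unfolding K_def by (rule fun_cong)
    then show ?thesis by (metis vector_eq_rdot)
  qed
  have intK: "integrable lborel (K (axis i 1))" for i
    unfolding K_def by (rule reg_log_potential_hess(2)[OF dF e]) simp
  have "(\<Sum>i\<in>UNIV. conv_hess e F' (axis i 1) x \<bullet> axis i 1) =
     (\<Sum>i\<in>UNIV. (LINT y|lborel. K (axis i 1) y \<bullet> axis i 1))"
    by (intro sum.cong refl, subst eq, simp, rule integral_inner_left[symmetric]) (rule intK)
  also have "\<dots> = (LINT y|lborel. (\<Sum>i\<in>UNIV. K (axis i 1) y \<bullet> axis i 1))"
    using intK by (intro Bochner_Integration.integral_sum[symmetric]) auto
  also have "(\<lambda>y. \<Sum>i\<in>UNIV. K (axis i 1) y \<bullet> axis i 1) = (\<lambda>y. F y * (4 * e\<^sup>2 / (?D y)\<^sup>2))"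
  proof
    fix y
    have "(\<Sum>i\<in>UNIV. K (axis i 1) y \<bullet> axis i 1) =
       (\<Sum>i\<in>(UNIV::2 set). F y * (2 / ?D y - 4 / (?D y)\<^sup>2 * (((x - y) \<bullet> axis i 1) * ((x - y) \<bullet> axis i 1))))"
      unfolding K_def inner_scaleR_left inner_diff_left[of "_ *\<^sub>R _"] by (simp add: inner_axis_axis mult.assoc)
    also have "\<dots> = F y * (4 / ?D y - 4 / (?D y)\<^sup>2 * ((x - y) \<bullet> (x - y)))"
      by (simp only: sum_distrib_left[symmetric] sum_subtractf inner_axis_sum) simp
    also have "4 / ?D y - 4 / (?D y)\<^sup>2 * ((x - y) \<bullet> (x - y)) = 4 * e\<^sup>2 / (?D y)\<^sup>2"
    proof -
      have "4 / D - 4 / D\<^sup>2 * (D - s) = 4 * s / D\<^sup>2" if "D > 0" for D s :: real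
        using that by (simp add: field_simps power2_eq_square)
      from this[OF D[of y], of "e\<^sup>2"] show ?thesis by simp
    qed
    finally show "(\<Sum>i\<in>UNIV. K (axis i 1) y \<bullet> axis i 1) = F y * (4 * e\<^sup>2 / (?D y)\<^sup>2)" .
  qed
  also have "(LINT y|lborel. F y * (4 * e\<^sup>2 / (?D y)\<^sup>2)) =
     \<bar>- e\<bar> ^ DIM(real^2) * (LINT w|lborel. (\<lambda>y. F y * (4 * e\<^sup>2 / (?D y)\<^sup>2)) (x + (- e) *\<^sub>R w))"
    by (rule integral_lborel_scale) (use e in auto)
  also have "\<dots> = e\<^sup>2 * (LINT w|lborel. F (x - e *\<^sub>R w) * (4 * e\<^sup>2 / ((e *\<^sub>R w) \<bullet> (e *\<^sub>R w) + e\<^sup>2)\<^sup>2))"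
    by simp
  also have "\<dots> = (LINT w|lborel. e\<^sup>2 * (F (x - e *\<^sub>R w) * (4 * e\<^sup>2 / ((e *\<^sub>R w) \<bullet> (e *\<^sub>R w) + e\<^sup>2)\<^sup>2)))"
    by (rule integral_mult_right_zero[symmetric])
  also have "(\<lambda>w. e\<^sup>2 * (F (x - e *\<^sub>R w) * (4 * e\<^sup>2 / ((e *\<^sub>R w) \<bullet> (e *\<^sub>R w) + e\<^sup>2)\<^sup>2))) =
     (\<lambda>w. 4 / (1 + w \<bullet> w)\<^sup>2 * F (x - e *\<^sub>R w))"
  proof
    fix w :: "real^2"
    have "(e *\<^sub>R w) \<bullet> (e *\<^sub>R w) + e\<^sup>2 = e\<^sup>2 * (1 + w \<bullet> w)" by (simp add: power2_eq_square algebra_simps)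
    then show "e\<^sup>2 * (F (x - e *\<^sub>R w) * (4 * e\<^sup>2 / ((e *\<^sub>R w) \<bullet> (e *\<^sub>R w) + e\<^sup>2)\<^sup>2)) = 4 / (1 + w \<bullet> w)\<^sup>2 * F (x - e *\<^sub>R w)"
      using e by (simp add: power_mult_distrib power2_eq_square)
  qed
  finally show ?thesis .
qed

text \<open>The limit \<open>e \<rightarrow> 0\<close> of \<open>reg_laplacian\<close>: the right-hand side is an approximate identity.\<close>

lemma log_potential_laplacian:
  assumes F: "disc_density_C1 F F'"
  shows "(\<Sum>i\<in>UNIV. conv_hess 0 F' (axis i 1) x \<bullet> axis i 1) = laplace_const * F x"
proof -
  have dF: "disc_density F" using F by (simp add: disc_density_C1_def)
  note [measurable] = disc_density_measurable[OF dF]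
  have Fc: "continuous_on UNIV F" using dF by (simp add: disc_density_def)
  obtain B where B: "B \<ge> 0" "\<And>y. \<bar>F y\<bar> \<le> B" using disc_density_bounded[OF dF] by metis
  have 1: "(\<lambda>n. \<Sum>i\<in>UNIV. conv_hess (1 / real (Suc n)) F' (axis i 1) x \<bullet> axis i 1)
      \<longlonglongrightarrow> (\<Sum>i\<in>UNIV. conv_hess 0 F' (axis i 1) x \<bullet> axis i 1)"
    by (intro tendsto_intros conv_hess_tendsto[OF F]) auto
  have "(\<lambda>n. LINT w|lborel. 4 / (1 + w \<bullet> w)\<^sup>2 * F (x - (1 / real (Suc n)) *\<^sub>R w))
      \<longlonglongrightarrow> (LINT w|lborel. 4 / (1 + (w::real^2) \<bullet> w)\<^sup>2 * F x)"
  proof (rule integral_dominated_convergence[where w = "\<lambda>w. 4 * B * (1 / (1 + w \<bullet> w)\<^sup>2)"])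
    show "integrable lborel (\<lambda>w::real^2. 4 * B * (1 / (1 + w \<bullet> w)\<^sup>2))"
      by (intro integrable_mult_right integrable_inverse_one_plus_norm)
    show "AE w in lborel. (\<lambda>n. 4 / (1 + w \<bullet> w)\<^sup>2 * F (x - (1 / real (Suc n)) *\<^sub>R w)) \<longlonglongrightarrow> 4 / (1 + w \<bullet> w)\<^sup>2 * F x"
    proof (intro AE_I2 tendsto_mult tendsto_const)
      fix w :: "real^2"
      have "(\<lambda>n. x - (1 / real (Suc n)) *\<^sub>R w) \<longlonglongrightarrow> x - 0 *\<^sub>R w" by (intro tendsto_intros tendsto_inverse_Suc)
      then have "(\<lambda>n. x - (1 / real (Suc n)) *\<^sub>R w) \<longlonglongrightarrow> x" by simp
      then show "(\<lambda>n. F (x - (1 / real (Suc n)) *\<^sub>R w)) \<longlonglongrightarrow> F x"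
        using Fc by (intro continuous_on_tendsto_compose[OF Fc]) auto
    qed
    show "AE w in lborel. norm (4 / (1 + w \<bullet> w)\<^sup>2 * F (x - (1 / real (Suc n)) *\<^sub>R w)) \<le> 4 * B * (1 / (1 + w \<bullet> w)\<^sup>2)" for n
      using B by (intro AE_I2) (auto simp: abs_mult intro!: divide_right_mono)
  qed measurable
  also have "(LINT w|lborel. 4 / (1 + (w::real^2) \<bullet> w)\<^sup>2 * F x) = laplace_const * F x"
  proof -
    have "(LINT w|lborel. 4 / (1 + (w::real^2) \<bullet> w)\<^sup>2 * F x) = (LINT w|lborel. (4 * F x) * (1 / (1 + (w::real^2) \<bullet> w)\<^sup>2))"
      by (simp add: mult.commute)
    also have "\<dots> = (4 * F x) * (LINT w|lborel. 1 / (1 + (w::real^2) \<bullet> w)\<^sup>2)"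
      by (rule integral_mult_right_zero)
    also have "\<dots> = laplace_const * F x"
      by (simp add: laplace_const_def)
    finally show ?thesis .
  qed
  finally have "(\<lambda>n. \<Sum>i\<in>UNIV. conv_hess (1 / real (Suc n)) F' (axis i 1) x \<bullet> axis i 1) \<longlonglongrightarrow> laplace_const * F x"
    by (simp add: reg_laplacian[OF F])
  from LIMSEQ_unique[OF 1 this] show ?thesis .
qed

section \<open>The harmonic part of the Green function\<close>

text \<open>The squared distance of \<open>\<bar>y\<bar> x\<close> from \<open>y / \<bar>y\<bar>\<close>, that is \<open>\<bar>y\<bar>\<^sup>2\<close> times the squared distance of \<open>x\<close> from the
  mirror image of \<open>y\<close> in the unit circle. In complex notation it is \<open>\<bar>1 - x cnj y\<bar>\<^sup>2\<close>. The formula also makes sense for \<open>y = 0\<close>.\<close>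

definition image_sq :: "real^2 \<Rightarrow> real^2 \<Rightarrow> real" where
  "image_sq x y = 1 - 2 * (x \<bullet> y) + (x \<bullet> x) * (y \<bullet> y)"

text \<open>Half the gradient of \<open>image_sq\<close> in its first argument.\<close>

definition image_dir :: "real^2 \<Rightarrow> real^2 \<Rightarrow> real^2" where
  "image_dir x y = (y \<bullet> y) *\<^sub>R x - y"

text \<open>The difference of the two sides is \<open>(1 - \<bar>x\<bar>\<^sup>2) (1 - \<bar>y\<bar>\<^sup>2)\<close>. Thus the mirror image is never closer than the pole, and
  every bound for the logarithmic potential carries over to the harmonic part.\<close>

lemma image_sq_ge_dist:
  assumes "norm x \<le> 1" "norm y \<le> 1"
  shows "(x - y) \<bullet> (x - y) \<le> image_sq x y"
proof -
  have "x \<bullet> x \<le> 1" "y \<bullet> y \<le> 1"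
    using assms by (auto simp: dot_square_norm power_le_one)
  then have "0 \<le> (1 - x \<bullet> x) * (1 - y \<bullet> y)" by (intro mult_nonneg_nonneg) auto
  then show ?thesis by (simp add: image_sq_def inner_diff_left inner_diff_right inner_commute algebra_simps)
qed

lemma image_sq_ge: "(1 - norm x * norm y)\<^sup>2 \<le> image_sq x y"
  using norm_cauchy_schwarz[of x y]
  by (simp add: image_sq_def power2_diff power_mult_distrib dot_square_norm)

lemma image_sq_lower:
  assumes "x \<in> ball 0 \<rho>" "\<rho> < 1" "norm y \<le> 1"
  shows "(1 - \<rho>)\<^sup>2 \<le> image_sq x y"
proof -
  have "norm x * norm y \<le> norm x" using assms by (simp add: mult_left_le)
  then have "1 - \<rho> \<le> 1 - norm x * norm y" using assms by simp
  then have "(1 - \<rho>)\<^sup>2 \<le> (1 - norm x * norm y)\<^sup>2" using assms by (intro power_mono) auto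
  then show ?thesis using image_sq_ge order_trans by blast
qed

lemma image_dir_sq: "image_dir x y \<bullet> image_dir x y = (y \<bullet> y) * image_sq x y"
  by (simp add: image_dir_def image_sq_def inner_diff_left inner_diff_right inner_commute algebra_simps)

lemma image_sq_has_derivative:
  "((\<lambda>x. image_sq x y) has_derivative (\<lambda>h. 2 * (image_dir x y \<bullet> h))) (at x)"
  unfolding image_sq_def
  by (auto intro!: derivative_eq_intros simp: image_dir_def inner_diff_left inner_commute algebra_simps)

definition harmonic_part :: "(real^2 \<Rightarrow> real) \<Rightarrow> real^2 \<Rightarrow> real" where
  "harmonic_part F x = (LINT y|lborel. ln (image_sq x y) * F y)"

definition harmonic_grad :: "(real^2 \<Rightarrow> real) \<Rightarrow> real^2 \<Rightarrow> real^2" where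
  "harmonic_grad F x = (LINT y|lborel. (2 * F y / image_sq x y) *\<^sub>R image_dir x y)"

text \<open>The Hessian of \<open>ln (image_sq x y)\<close> in \<open>x\<close>, applied to \<open>v\<close> and weighted by the density.\<close>

definition harmonic_hess_kernel :: "(real^2 \<Rightarrow> real) \<Rightarrow> real^2 \<Rightarrow> real^2 \<Rightarrow> real^2 \<Rightarrow> real^2" where
  "harmonic_hess_kernel F v x y = F y *\<^sub>R ((2 * (y \<bullet> y) / image_sq x y) *\<^sub>R v
      - (4 * (image_dir x y \<bullet> v) / (image_sq x y)\<^sup>2) *\<^sub>R image_dir x y)"

definition harmonic_hess :: "(real^2 \<Rightarrow> real) \<Rightarrow> real^2 \<Rightarrow> real^2 \<Rightarrow> real^2" where
  "harmonic_hess F v x = (LINT y|lborel. harmonic_hess_kernel F v x y)"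

lemma image_dir_measurable[measurable]: "image_dir x \<in> borel_measurable borel"
  unfolding image_dir_def by measurable

lemma image_sq_measurable[measurable]: "image_sq x \<in> borel_measurable borel"
  unfolding image_sq_def by measurable

lemma image_dir_norm_le: "norm x \<le> 1 \<Longrightarrow> norm y \<le> 1 \<Longrightarrow> norm (image_dir x y) \<le> 2"
proof -
  assume *: "norm x \<le> 1" "norm y \<le> 1"
  have "norm (image_dir x y) \<le> norm ((y \<bullet> y) *\<^sub>R x) + norm y"
    unfolding image_dir_def by (rule norm_triangle_ineq4)
  moreover have "norm ((y \<bullet> y) *\<^sub>R x) \<le> 1"
    using * by (simp add: dot_square_norm power_le_one mult_le_one)
  ultimately show ?thesis using * by simp
qed

lemma integrable_disc_bound:
  fixes f :: "real^2 \<Rightarrow> 'b::{banach, second_countable_topology}"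
  assumes [measurable]: "f \<in> borel_measurable borel"
    and "\<And>y. norm (f y) \<le> C * indicator (ball 0 1) y"
  shows "integrable lborel f"
proof (rule Bochner_Integration.integrable_bound)
  show "integrable lborel (\<lambda>y::real^2. C * indicator (ball 0 1) y)"
    using emeasure_lborel_ball_finite[of "0::real^2" 1] by (auto intro!: integrable_real_indicator)
  show "AE y in lborel. norm (f y) \<le> norm (C * indicator (ball 0 1) y)"
    using assms(2) by (intro AE_I2) (metis abs_ge_self order_trans real_norm_def)
qed simp

lemma integrable_indicator_disc: "integrable lborel (\<lambda>y::real^2. C * indicator (ball 0 1) y :: real)"
  using emeasure_lborel_ball_finite[of "0::real^2" 1] by (auto intro!: integrable_real_indicator)

lemma harmonic_grad_kernel_bound:
  assumes F: "disc_density F" "\<And>y. \<bar>F y\<bar> \<le> B" and x: "x \<in> ball 0 \<rho>" "\<rho> < 1"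
  shows "norm ((2 * F y / image_sq x y) *\<^sub>R image_dir x y) \<le> (4 * B / (1 - \<rho>)\<^sup>2) * indicator (ball 0 1) y"
proof (cases "y \<in> ball 0 1")
  case True
  then have q: "(1 - \<rho>)\<^sup>2 \<le> image_sq x y" using image_sq_lower[OF x] by simp
  moreover have "(1 - \<rho>)\<^sup>2 > 0" using x by simp
  moreover have "0 \<le> B" using F(2)[of 0] by linarith
  ultimately have "2 * \<bar>F y\<bar> / image_sq x y \<le> 2 * B / (1 - \<rho>)\<^sup>2"
    using F(2) by (intro frac_le) auto
  then have "2 * \<bar>F y\<bar> / image_sq x y * norm (image_dir x y) \<le> 2 * B / (1 - \<rho>)\<^sup>2 * 2"
    using True x \<open>0 \<le> B\<close> by (intro mult_mono image_dir_norm_le) auto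
  moreover have "image_sq x y > 0" using q \<open>(1 - \<rho>)\<^sup>2 > 0\<close> by linarith
  ultimately show ?thesis using True by (simp add: abs_mult)
qed (use F in \<open>simp add: disc_density_def\<close>)

lemma harmonic_hess_kernel_bound:
  assumes F: "disc_density F" "\<And>y. \<bar>F y\<bar> \<le> B" and x: "x \<in> ball 0 \<rho>" "\<rho> < 1" and v: "norm v \<le> 1"
  shows "norm (harmonic_hess_kernel F v x y) \<le> (B * (6 / (1 - \<rho>)\<^sup>2)) * indicator (ball 0 1) y"
proof (cases "y \<in> ball 0 1")
  case True
  let ?q = "image_sq x y" and ?d = "image_dir x y"
  have q: "(1 - \<rho>)\<^sup>2 \<le> ?q" using True image_sq_lower[OF x] by simp
  have r: "(1 - \<rho>)\<^sup>2 > 0" using x by simp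
  then have q0: "?q > 0" using q by linarith
  have B: "0 \<le> B" using F(2)[of 0] by linarith
  have yy: "y \<bullet> y \<le> 1" using True by (simp add: dot_square_norm power_le_one)
  have "?d \<bullet> ?d \<le> ?q" using yy q0 by (simp add: image_dir_sq mult_left_le_one_le)
  then have "norm ((2 * (y \<bullet> y) / ?q) *\<^sub>R v - (4 * (?d \<bullet> v) / ?q\<^sup>2) *\<^sub>R ?d) \<le> 6 / (1 - \<rho>)\<^sup>2"
    using yy by (intro hess_kernel_bound r q v) auto
  then have "\<bar>F y\<bar> * norm ((2 * (y \<bullet> y) / ?q) *\<^sub>R v - (4 * (?d \<bullet> v) / ?q\<^sup>2) *\<^sub>R ?d) \<le> B * (6 / (1 - \<rho>)\<^sup>2)"
    using F(2) B by (intro mult_mono) auto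
  then show ?thesis using True by (simp add: harmonic_hess_kernel_def)
qed (use F in \<open>simp add: disc_density_def harmonic_hess_kernel_def\<close>)

lemma image_sq_pos: "norm x < 1 \<Longrightarrow> norm y \<le> 1 \<Longrightarrow> image_sq x y > 0"
proof -
  assume "norm x < 1" "norm y \<le> 1"
  then have "norm x * norm y < 1" by (metis le_less_trans mult_left_le norm_ge_zero)
  then have "0 < (1 - norm x * norm y)\<^sup>2" by simp
  then show ?thesis using image_sq_ge[of x y] by linarith
qed

lemma continuous_image_sq: "continuous_on A (image_sq x)" "continuous_on A (\<lambda>x. image_sq x y)"
  unfolding image_sq_def by (intro continuous_intros)+

lemma continuous_image_dir: "continuous_on A (\<lambda>x. image_dir x y)"
  unfolding image_dir_def by (intro continuous_intros)

lemma harmonic_hess_kernel_measurable: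
  assumes [measurable]: "F \<in> borel_measurable borel"
  shows "harmonic_hess_kernel F v x \<in> borel_measurable borel"
  unfolding harmonic_hess_kernel_def by measurable

text \<open>On each smaller disc the image distance is bounded below, so the integrand is smooth with uniform bounds.\<close>

lemma harmonic_part_has_derivative:
  assumes F: "disc_density F" and x: "x \<in> ball 0 1"
  shows "(harmonic_part F has_derivative (\<lambda>h. harmonic_grad F x \<bullet> h)) (at x)"
  unfolding harmonic_part_def[abs_def] harmonic_grad_def
proof -
  note [measurable] = disc_density_measurable[OF F]
  have Fc: "continuous_on A F" for A using F by (auto simp: disc_density_def intro: continuous_on_subset)
  obtain B where B: "B \<ge> 0" "\<And>y. \<bar>F y\<bar> \<le> B" using disc_density_bounded[OF F] by metis
  (* The bounds below blow up at the circle, so differentiate in a smaller disc. *)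
  obtain \<rho> where \<rho>: "\<rho> < 1" "x \<in> ball 0 \<rho>" using x dense[of "norm x" 1] by auto
  show "((\<lambda>x. LINT y|lborel. ln (image_sq x y) * F y) has_derivative
     (\<lambda>h. (LINT y|lborel. (2 * F y / image_sq x y) *\<^sub>R image_dir x y) \<bullet> h)) (at x)"
  proof (rule has_derivative_integral_dominated[OF open_ball \<rho>(2) _ _ _ _ integrable_indicator_disc])
    fix x y assume x: "x \<in> ball (0::real^2) \<rho>"
    show "((\<lambda>x. ln (image_sq x y) * F y) has_derivative (\<lambda>h. (2 * F y / image_sq x y) *\<^sub>R image_dir x y \<bullet> h)) (at x)"
    proof (cases "y \<in> ball 0 1")
      case True
      then have "image_sq x y > 0" using image_sq_pos[of x y] x \<rho> by auto
      then show ?thesis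
        by (auto intro!: derivative_eq_intros image_sq_has_derivative simp: field_simps)
    qed (use F in \<open>simp add: disc_density_def\<close>)
    show "norm ((2 * F y / image_sq x y) *\<^sub>R image_dir x y) \<le> (4 * B / (1 - \<rho>)\<^sup>2) * indicator (ball 0 1) y"
      by (rule harmonic_grad_kernel_bound[OF F B(2) x \<rho>(1)])
  next
    fix x assume x: "x \<in> ball (0::real^2) \<rho>"
    show "integrable lborel (\<lambda>y. ln (image_sq x y) * F y)"
    proof (rule integrable_continuous_on_disc)
      have "image_sq x y \<noteq> 0" if "y \<in> cball 0 1" for y using image_sq_pos[of x y] x \<rho> that by auto
      then show "continuous_on (cball 0 1) (\<lambda>y. ln (image_sq x y) * F y)"
        by (intro continuous_intros Fc continuous_image_sq) auto
    qed (use F in \<open>simp add: disc_density_def\<close>)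
  qed measurable
qed

lemma harmonic_grad_has_derivative:
  assumes F: "disc_density F" and x: "x \<in> ball 0 1" and v: "norm v \<le> 1"
  shows "((\<lambda>x. harmonic_grad F x \<bullet> v) has_derivative (\<lambda>h. harmonic_hess F v x \<bullet> h)) (at x)"
    and "continuous (at x) (harmonic_hess F v)"
    and "continuous (at x) (harmonic_grad F)"
    and "integrable lborel (harmonic_hess_kernel F v x)"
proof -
  note [measurable] = disc_density_measurable[OF F] harmonic_hess_kernel_measurable[OF disc_density_measurable[OF F]]
  obtain B where B: "B \<ge> 0" "\<And>y. \<bar>F y\<bar> \<le> B" using disc_density_bounded[OF F] by metis
  obtain \<rho> where \<rho>: "\<rho> < 1" "x \<in> ball 0 \<rho>" using x dense[of "norm x" 1] by auto
  have pos: "image_sq x y \<noteq> 0" if "x \<in> ball 0 \<rho>" "y \<in> ball 0 1" for x y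
    using image_sq_pos[of x y] that \<rho> by auto
  have int_grad: "integrable lborel (\<lambda>y. (2 * F y / image_sq x y) *\<^sub>R image_dir x y)" if "x \<in> ball 0 \<rho>" for x
    by (rule integrable_disc_bound[OF _ harmonic_grad_kernel_bound[OF F B(2) that \<rho>(1)]]) measurable
  have "continuous_on (ball 0 \<rho>) (harmonic_hess F v)"
    unfolding harmonic_hess_def
  proof (rule continuous_on_integral_dominated[OF _ integrable_indicator_disc harmonic_hess_kernel_bound[OF F B(2) _ \<rho>(1) v]])
    show "continuous_on (ball 0 \<rho>) (\<lambda>x. harmonic_hess_kernel F v x y)" for y
    proof (cases "y \<in> ball 0 1")
      case True
      show ?thesis unfolding harmonic_hess_kernel_def
        by (intro continuous_intros continuous_image_sq continuous_image_dir) (use pos True in auto)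
    qed (use F in \<open>simp add: disc_density_def harmonic_hess_kernel_def\<close>)
  qed measurable
  then show "continuous (at x) (harmonic_hess F v)"
    using \<rho> continuous_on_eq_continuous_at open_ball by blast
  have "continuous_on (ball 0 \<rho>) (harmonic_grad F)"
    unfolding harmonic_grad_def
  proof (rule continuous_on_integral_dominated[OF _ integrable_indicator_disc harmonic_grad_kernel_bound[OF F B(2) _ \<rho>(1)]])
    show "continuous_on (ball 0 \<rho>) (\<lambda>x. (2 * F y / image_sq x y) *\<^sub>R image_dir x y)" for y
    proof (cases "y \<in> ball 0 1")
      case True
      show ?thesis
        by (intro continuous_intros continuous_image_sq continuous_image_dir) (use pos True in auto)
    qed (use F in \<open>simp add: disc_density_def\<close>)
  qed measurable
  then show "continuous (at x) (harmonic_grad F)"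
    using \<rho> continuous_on_eq_continuous_at open_ball by blast
  show "integrable lborel (harmonic_hess_kernel F v x)"
    by (rule integrable_disc_bound[OF _ harmonic_hess_kernel_bound[OF F B(2) \<rho>(2,1) v]]) measurable
  let ?k = "\<lambda>x y. 2 * F y * (image_dir x y \<bullet> v) / image_sq x y"
  have "((\<lambda>x. LINT y|lborel. ?k x y) has_derivative (\<lambda>h. harmonic_hess F v x \<bullet> h)) (at x)"
    unfolding harmonic_hess_def
  proof (rule has_derivative_integral_dominated[OF open_ball \<rho>(2) _ _ _ _ integrable_indicator_disc])
    fix x y assume x: "x \<in> ball (0::real^2) \<rho>"
    show "norm (harmonic_hess_kernel F v x y) \<le> (B * (6 / (1 - \<rho>)\<^sup>2)) * indicator (ball 0 1) y"
      by (rule harmonic_hess_kernel_bound[OF F B(2) x \<rho>(1) v])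
    show "((\<lambda>x. ?k x y) has_derivative (\<lambda>h. harmonic_hess_kernel F v x y \<bullet> h)) (at x)"
    proof (cases "y \<in> ball 0 1")
      case True
      define D where "D = image_sq x y"
      have D: "D \<noteq> 0" using pos[OF x True] by (simp add: D_def)
      have dD: "((\<lambda>x. image_sq x y) has_derivative (\<lambda>h. 2 * (image_dir x y \<bullet> h))) (at x)"
        by (rule image_sq_has_derivative)
      have dN: "((\<lambda>x. 2 * F y * (image_dir x y \<bullet> v)) has_derivative (\<lambda>h. 2 * F y * ((y \<bullet> y) * (v \<bullet> h)))) (at x)"
        unfolding image_dir_def by (auto intro!: derivative_eq_intros simp: inner_commute)
      have quot: "(2 * c * (s * a) * D - 2 * c * b * (2 * d)) / (D * D) = c * (2 * s / D * a - 4 * b / D\<^sup>2 * d)" for a b c d s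
        using D by (simp add: field_simps power2_eq_square)
      have "harmonic_hess_kernel F v x y \<bullet> h = F y * (2 * (y \<bullet> y) / D * (v \<bullet> h) - 4 * (image_dir x y \<bullet> v) / D\<^sup>2 * (image_dir x y \<bullet> h))" for h
        unfolding harmonic_hess_kernel_def D_def inner_scaleR_left inner_diff_left ..
      then show ?thesis
        by (intro has_derivative_eq_rhs[OF has_derivative_divide'[OF dN dD]])
          (use D in \<open>simp_all only: D_def[symmetric] quot not_False_eq_True\<close>)
    qed (use F in \<open>simp add: disc_density_def harmonic_hess_kernel_def\<close>)
  next
    fix x assume x: "x \<in> ball (0::real^2) \<rho>"
    have "integrable lborel (\<lambda>y. ((2 * F y / image_sq x y) *\<^sub>R image_dir x y) \<bullet> v)"
      using int_grad[OF x] by (intro integrable_inner_left) auto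
    then show "integrable lborel (\<lambda>y. ?k x y)" by simp
  qed measurable
  moreover have "(LINT y|lborel. ?k z y) = harmonic_grad F z \<bullet> v" if "z \<in> ball 0 \<rho>" for z
  proof -
    have "(LINT y|lborel. ((2 * F y / image_sq z y) *\<^sub>R image_dir z y) \<bullet> v) = harmonic_grad F z \<bullet> v"
      unfolding harmonic_grad_def using int_grad[OF that] by (intro integral_inner_left) auto
    then show ?thesis by simp
  qed
  ultimately show "((\<lambda>x. harmonic_grad F x \<bullet> v) has_derivative (\<lambda>h. harmonic_hess F v x \<bullet> h)) (at x)"
    by (rule has_derivative_transform_within_open[OF _ open_ball \<rho>(2)]) auto
qed

text \<open>The gradient of \<open>ln (image_sq x y)\<close> has norm at most \<open>2 / norm (x - y)\<close>. Hence the bound is uniform up to the boundary, although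
  the second derivatives are not bounded there.\<close>

lemma harmonic_grad_bounded:
  assumes F: "disc_density F" and B: "\<And>y. \<bar>F y\<bar> \<le> B" and x: "x \<in> ball 0 1"
  shows "norm (harmonic_grad F x) \<le> 2 * B * inverse_norm_mass"
proof -
  note [measurable] = disc_density_measurable[OF F]
  have B0: "0 \<le> B" using B[of 0] by linarith
  obtain \<rho> where \<rho>: "\<rho> < 1" "x \<in> ball 0 \<rho>" using x dense[of "norm x" 1] by auto
  have AE: "AE y in lborel. y \<noteq> x" by (rule AE_lborel_singleton)
  have g: "integrable lborel (\<lambda>y. 2 * B * (indicator (ball 0 1) y / norm (x - y)))"
    by (intro integrable_mult_right integrable_inverse_norm_translate)
  have f: "integrable lborel (\<lambda>y. (2 * F y / image_sq x y) *\<^sub>R image_dir x y)"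
    by (rule integrable_disc_bound[OF _ harmonic_grad_kernel_bound[OF F B \<rho>(2,1)]]) measurable
  have "norm (harmonic_grad F x) \<le> (LINT y|lborel. norm ((2 * F y / image_sq x y) *\<^sub>R image_dir x y))"
    unfolding harmonic_grad_def by (rule integral_norm_bound)
  also have "\<dots> \<le> (LINT y|lborel. 2 * B * (indicator (ball 0 1) y / norm (x - y)))"
  proof (rule integral_mono_AE[OF integrable_norm[OF f] g], rule AE_mp[OF AE], intro AE_I2 impI)
    fix y assume ne: "y \<noteq> x"
    show "norm ((2 * F y / image_sq x y) *\<^sub>R image_dir x y) \<le> 2 * B * (indicator (ball 0 1) y / norm (x - y))"
    proof (cases "y \<in> ball 0 1")
      case True
      let ?q = "image_sq x y"
      have q: "?q > 0" using image_sq_pos[of x y] x True by auto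
      have "norm (image_dir x y) = sqrt ((y \<bullet> y) * ?q)" by (simp add: norm_eq_sqrt_inner image_dir_sq)
      also have "\<dots> \<le> sqrt ?q"
        using True q by (intro real_sqrt_le_mono) (simp add: dot_square_norm power_le_one mult_left_le_one_le)
      finally have "norm (image_dir x y) / ?q \<le> sqrt ?q / ?q" using q by (intro divide_right_mono) auto
      also have "\<dots> = 1 / sqrt ?q" using q by (simp add: divide_simps)
      also have "\<dots> \<le> 1 / norm (x - y)"
      proof -
        have "norm (x - y) \<le> sqrt ?q"
          unfolding norm_eq_sqrt_inner using image_sq_ge_dist[of x y] x True by (intro real_sqrt_le_mono) auto
        then show ?thesis using ne by (intro divide_left_mono mult_pos_pos) (auto simp: q)
      qed
      finally have "2 * \<bar>F y\<bar> * (norm (image_dir x y) / ?q) \<le> 2 * B * (1 / norm (x - y))"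
        using B B0 q by (intro mult_mono) auto
      then show ?thesis using True q by (simp add: abs_mult)
    qed (use F in \<open>simp add: disc_density_def\<close>)
  qed
  also have "\<dots> = 2 * B * (LINT y|lborel. indicator (ball 0 1) y / norm (x - y))"
    by (rule integral_mult_right_zero)
  also have "\<dots> \<le> 2 * B * inverse_norm_mass"
    using x B0 by (intro mult_left_mono integral_inverse_norm_le) auto
  finally show ?thesis .
qed

text \<open>\<open>ln (image_sq x y)\<close> is harmonic in \<open>x\<close> because \<open>\<bar>image_dir x y\<bar>\<^sup>2 = \<bar>y\<bar>\<^sup>2 image_sq x y\<close>.\<close>

lemma harmonic_laplacian:
  assumes F: "disc_density F" and x: "x \<in> ball 0 1"
  shows "(\<Sum>i\<in>UNIV. harmonic_hess F (axis i 1) x \<bullet> axis i 1) = 0"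
proof -
  have intK: "integrable lborel (harmonic_hess_kernel F (axis i 1) x)" for i
    by (rule harmonic_grad_has_derivative(4)[OF F x]) simp
  have "(\<Sum>i\<in>UNIV. harmonic_hess F (axis i 1) x \<bullet> axis i 1) =
      (\<Sum>i\<in>UNIV. (LINT y|lborel. harmonic_hess_kernel F (axis i 1) x y \<bullet> axis i 1))"
    unfolding harmonic_hess_def by (intro sum.cong refl integral_inner_left[symmetric]) (rule intK)
  also have "\<dots> = (LINT y|lborel. (\<Sum>i\<in>UNIV. harmonic_hess_kernel F (axis i 1) x y \<bullet> axis i 1))"
    using intK by (intro Bochner_Integration.integral_sum[symmetric]) auto
  also have "(\<lambda>y. \<Sum>i\<in>UNIV. harmonic_hess_kernel F (axis i 1) x y \<bullet> axis i 1) = (\<lambda>y. 0)"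
  proof
    fix y
    show "(\<Sum>i\<in>UNIV. harmonic_hess_kernel F (axis i 1) x y \<bullet> axis i 1) = 0"
    proof (cases "y \<in> ball 0 1")
      case True
      let ?q = "image_sq x y" and ?d = "image_dir x y"
      have q: "?q > 0" using image_sq_pos[of x y] x True by auto
      have "(\<Sum>i\<in>UNIV. harmonic_hess_kernel F (axis i 1) x y \<bullet> axis i 1) =
         (\<Sum>i\<in>(UNIV::2 set). F y * (2 * (y \<bullet> y) / ?q - 4 / ?q\<^sup>2 * ((?d \<bullet> axis i 1) * (?d \<bullet> axis i 1))))"
        unfolding harmonic_hess_kernel_def inner_scaleR_left inner_diff_left by (simp add: inner_axis_axis mult.assoc)
      also have "\<dots> = F y * (4 * (y \<bullet> y) / ?q - 4 / ?q\<^sup>2 * (\<Sum>i\<in>UNIV. (?d \<bullet> axis i 1) * (?d \<bullet> axis i 1)))"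
        by (simp only: sum_distrib_left[symmetric] sum_subtractf) simp
      also have "(\<Sum>i\<in>UNIV. (?d \<bullet> axis i 1) * (?d \<bullet> axis i 1)) = (y \<bullet> y) * ?q"
        unfolding image_dir_sq[symmetric] by (simp only: inner_axis) (simp add: inner_vec_def)
      also have "4 * (y \<bullet> y) / ?q - 4 / ?q\<^sup>2 * ((y \<bullet> y) * ?q) = 0"
        using q by (simp add: power2_eq_square)
      finally show ?thesis by simp
    qed (use F in \<open>simp add: disc_density_def harmonic_hess_kernel_def\<close>)
  qed
  finally show ?thesis by simp
qed

section \<open>The Green operator of the disc\<close>

text \<open>A positive multiple of the Green function of the unit disc with Dirichlet boundary values.\<close>

definition green_kernel :: "real^2 \<Rightarrow> real^2 \<Rightarrow> real" where
  "green_kernel x y = ln (image_sq x y) - ln ((x - y) \<bullet> (x - y))"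

definition green :: "(real^2 \<Rightarrow> real) \<Rightarrow> real^2 \<Rightarrow> real" where
  "green F x = (LINT y|lborel. green_kernel x y * F y)"

definition green_grad :: "(real^2 \<Rightarrow> real) \<Rightarrow> real^2 \<Rightarrow> real^2" where
  "green_grad F x = harmonic_grad F x - log_potential_grad 0 F x"

text \<open>Hoelder estimate for the logarithm away from 0. It follows from \<open>ln (1 + s) \<le> (2 / \<gamma>) s powr \<gamma>\<close> for \<open>s = \<bar>A - B\<bar> / min A B\<close>.\<close>

lemma ln_diff_le:
  fixes A B \<gamma> :: real
  assumes "0 < \<gamma>" "\<gamma> \<le> 1" "A > 0" "B > 0"
  shows "\<bar>ln A - ln B\<bar> \<le> (2 / \<gamma>) * \<bar>A - B\<bar> powr \<gamma> * (A powr (- \<gamma>) + B powr (- \<gamma>))"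
proof -
  have *: "ln (1 + s) \<le> (2 / \<gamma>) * s powr \<gamma>" if "s \<ge> 0" for s :: real
  proof (cases "s \<le> 1")
    case True
    show ?thesis
    proof (cases "s = 0")
      case False
      then have "s > 0" using that by simp
      have "ln (1 + s) \<le> s" using ln_add_one_self_le_self[OF that] .
      also have "s = s powr 1" using \<open>s > 0\<close> by simp
      also have "\<dots> \<le> s powr \<gamma>" using True \<open>s > 0\<close> assms by (intro powr_mono') auto
      also have "\<dots> \<le> (2 / \<gamma>) * s powr \<gamma>" using assms by (intro mult_le_cancel_right1[THEN iffD2]) (auto simp: field_simps)
      finally show ?thesis .
    qed simp
  next
    case False
    then have s: "s > 1" by simp
    have "ln (1 + s) \<le> ln (2 * s)" using s by simp
    also have "\<dots> = ln 2 + ln s" using s by (simp add: ln_mult)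
    also have "ln 2 \<le> (1::real)" using ln_le_minus_one[of 2] by simp
    also have "1 \<le> (1 / \<gamma>) * s powr \<gamma>"
    proof -
      have "1 * 1 \<le> (1 / \<gamma>) * s powr \<gamma>"
        using assms s by (intro mult_mono) (auto simp: ge_one_powr_ge_zero)
      then show ?thesis by simp
    qed
    also have "ln s \<le> (1 / \<gamma>) * s powr \<gamma>"
    proof -
      have "\<gamma> * ln s = ln (s powr \<gamma>)" using s by (simp add: ln_powr)
      also have "\<dots> \<le> s powr \<gamma>" using ln_le_minus_one[of "s powr \<gamma>"] s by simp
      finally show ?thesis using assms by (simp add: field_simps)
    qed
    finally show ?thesis by (simp add: add_divide_distrib)
  qed
  have main: "\<bar>ln a - ln b\<bar> \<le> (2 / \<gamma>) * \<bar>a - b\<bar> powr \<gamma> * (a powr (- \<gamma>) + b powr (- \<gamma>))"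
    if "b \<le> a" "b > 0" for a b :: real
  proof -
    have "\<bar>ln a - ln b\<bar> = ln (a / b)" using that by (simp add: ln_div)
    also have "a / b = 1 + (a - b) / b" using that by (simp add: field_simps)
    also have "ln \<dots> \<le> (2 / \<gamma>) * ((a - b) / b) powr \<gamma>" using that by (intro *) auto
    also have "\<dots> = (2 / \<gamma>) * \<bar>a - b\<bar> powr \<gamma> * b powr (- \<gamma>)"
      using that by (simp add: powr_divide powr_minus_divide)
    also have "\<dots> \<le> (2 / \<gamma>) * \<bar>a - b\<bar> powr \<gamma> * (a powr (- \<gamma>) + b powr (- \<gamma>))"
      using assms by (intro mult_left_mono) auto
    finally show ?thesis .
  qed
  show ?thesis
  proof (cases "B \<le> A")
    case True
    then show ?thesis using main[of B A] assms by simp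
  next
    case False
    then show ?thesis using main[of A B] assms by (simp add: abs_minus_commute add.commute)
  qed
qed

lemma sqrt_image_sq_lipschitz:
  assumes "norm y \<le> 1"
  shows "\<bar>sqrt (image_sq x y) - sqrt (image_sq x' y)\<bar> \<le> norm (x - x')"
proof (cases "y = 0")
  case True then show ?thesis by (simp add: image_sq_def)
next
  case False
  define w where "w x = norm y *\<^sub>R x - (1 / norm y) *\<^sub>R y" for x
  have *: "sqrt (image_sq x y) = norm (w x)" for x
  proof -
    have "w x \<bullet> w x = image_sq x y"
      unfolding w_def image_sq_def inner_diff_left inner_diff_right inner_scaleR_left inner_scaleR_right
      using False by (simp add: inner_commute[of y x] dot_square_norm power2_eq_square field_simps)
    then show ?thesis by (simp add: norm_eq_sqrt_inner)
  qed
  have "\<bar>norm (w x) - norm (w x')\<bar> \<le> norm (w x - w x')" by (rule norm_triangle_ineq3)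
  also have "w x - w x' = norm y *\<^sub>R (x - x')" by (simp add: w_def algebra_simps)
  also have "norm (norm y *\<^sub>R (x - x')) \<le> norm (x - x')" using assms by (simp add: mult_left_le_one_le)
  finally show ?thesis by (simp add: *)
qed

lemma image_sq_ge_norm:
  assumes "norm x \<le> 1" "norm y \<le> 1"
  shows "norm (x - y) \<le> sqrt (image_sq x y)"
  unfolding norm_eq_sqrt_inner using image_sq_ge_dist[OF assms] by (rule real_sqrt_le_mono)

text \<open>Both logarithms are of functions that are Lipschitz in \<open>x\<close>, namely \<open>norm (x - y)\<close> and the image distance \<open>sqrt (image_sq x y)\<close>, and the
  latter is the larger one.\<close>

lemma green_kernel_diff:
  assumes \<gamma>: "0 < \<gamma>" "\<gamma> \<le> 1" and xy: "norm x \<le> 1" "norm x' \<le> 1" "norm y \<le> 1" "x \<noteq> y" "x' \<noteq> y"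
  shows "\<bar>green_kernel x y - green_kernel x' y\<bar> \<le>
    (8 / \<gamma>) * norm (x - x') powr \<gamma> * (norm (x - y) powr (- \<gamma>) + norm (x' - y) powr (- \<gamma>))"
proof -
  let ?R = "(2 / \<gamma>) * norm (x - x') powr \<gamma> * (norm (x - y) powr (- \<gamma>) + norm (x' - y) powr (- \<gamma>))"
  let ?s = "\<lambda>x. sqrt (image_sq x y)"
  have n: "norm (x - y) > 0" "norm (x' - y) > 0" using xy by auto
  have s: "norm (x - y) \<le> ?s x" "norm (x' - y) \<le> ?s x'" using image_sq_ge_norm xy by auto
  have s0: "?s x > 0" "?s x' > 0" using s n by linarith+
  have q0: "image_sq x y > 0" "image_sq x' y > 0" using s0 by auto
  have "\<bar>ln (?s x) - ln (?s x')\<bar> \<le> (2 / \<gamma>) * \<bar>?s x - ?s x'\<bar> powr \<gamma> * (?s x powr (- \<gamma>) + ?s x' powr (- \<gamma>))"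
    by (rule ln_diff_le[OF \<gamma> s0])
  also have "\<dots> \<le> ?R"
    using \<gamma> s n sqrt_image_sq_lipschitz[OF xy(3), of x x']
    by (intro mult_mono add_mono powr_mono2 powr_mono2' mult_nonneg_nonneg add_nonneg_nonneg) auto
  finally have 1: "\<bar>ln (?s x) - ln (?s x')\<bar> \<le> ?R" .
  have "\<bar>ln (norm (x - y)) - ln (norm (x' - y))\<bar> \<le> (2 / \<gamma>) * \<bar>norm (x - y) - norm (x' - y)\<bar> powr \<gamma> * (norm (x - y) powr (- \<gamma>) + norm (x' - y) powr (- \<gamma>))"
    by (rule ln_diff_le[OF \<gamma> n])
  also have "\<dots> \<le> ?R"
    using \<gamma> norm_triangle_ineq3[of "x - y" "x' - y"]
    by (intro mult_right_mono mult_left_mono powr_mono2 add_nonneg_nonneg) auto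
  finally have 2: "\<bar>ln (norm (x - y)) - ln (norm (x' - y))\<bar> \<le> ?R" .
  have G: "green_kernel z y = 2 * ln (?s z) - 2 * ln (norm (z - y))" if "image_sq z y > 0" "norm (z - y) > 0" for z
    using that by (simp add: green_kernel_def ln_sqrt dot_square_norm ln_realpow)
  have "green_kernel x y - green_kernel x' y = 2 * (ln (?s x) - ln (?s x')) - 2 * (ln (norm (x - y)) - ln (norm (x' - y)))"
    using G[OF q0(1) n(1)] G[OF q0(2) n(2)] by simp
  moreover have "\<bar>2 * a - 2 * b\<bar> \<le> 4 * r" if "\<bar>a\<bar> \<le> r" "\<bar>b\<bar> \<le> r" for a b r :: real using that by linarith
  note this[OF 1 2]
  ultimately have "\<bar>green_kernel x y - green_kernel x' y\<bar> \<le> 4 * ?R" by metis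
  also have "4 * ?R = (8 / \<gamma>) * norm (x - x') powr \<gamma> * (norm (x - y) powr (- \<gamma>) + norm (x' - y) powr (- \<gamma>))"
    by simp
  finally show ?thesis .
qed

lemma green_kernel_sphere: "norm x = 1 \<Longrightarrow> green_kernel x y = 0"
proof -
  assume "norm x = 1"
  then have "x \<bullet> x = 1" by (simp add: dot_square_norm)
  then have "image_sq x y = (x - y) \<bullet> (x - y)"
    unfolding image_sq_def inner_diff_left inner_diff_right by (simp add: inner_commute)
  then show ?thesis by (simp add: green_kernel_def)
qed

lemma green_kernel_sym: "green_kernel x y = green_kernel y x"
  unfolding green_kernel_def image_sq_def
  by (simp add: inner_diff_left inner_diff_right inner_commute algebra_simps)

text \<open>The kernel vanishes at the boundary point \<open>axis 1 1\<close>, so a bound for the kernel is a bound for a difference.\<close>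

lemma green_kernel_bound:
  assumes "norm x \<le> 1" "y \<in> ball 0 1" "x \<noteq> y"
  shows "\<bar>green_kernel x y\<bar> \<le> 16 * (1 / norm (x - y) + 1 / norm (axis 1 1 - y))"
proof -
  let ?e = "axis 1 1 :: real^2"
  have e: "norm ?e = 1" by simp
  have ne: "?e \<noteq> y" using assms(2) e by auto
  have "\<bar>green_kernel x y\<bar> = \<bar>green_kernel x y - green_kernel ?e y\<bar>"
    using green_kernel_sphere[OF e] by simp
  also have "\<dots> \<le> (8 / 1) * norm (x - ?e) powr 1 * (norm (x - y) powr (- 1) + norm (?e - y) powr (- 1))"
    using assms e ne by (intro green_kernel_diff) auto
  also have "\<dots> = 8 * norm (x - ?e) * (1 / norm (x - y) + 1 / norm (?e - y))"
    using assms(3) ne by (simp add: powr_minus_divide)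
  also have "\<dots> \<le> 8 * 2 * (1 / norm (x - y) + 1 / norm (?e - y))"
    using norm_triangle_ineq4[of x ?e] assms(1) e by (intro mult_right_mono mult_left_mono) auto
  finally show ?thesis by simp
qed

lemma green_kernel_measurable2:
  "(\<lambda>z. green_kernel (fst z) (snd z)) \<in> borel_measurable (borel \<Otimes>\<^sub>M borel)"
  unfolding green_kernel_def image_sq_def by measurable

lemma green_kernel_measurable[measurable]: "green_kernel x \<in> borel_measurable borel"
  unfolding green_kernel_def by measurable

lemma integrable_two_poles:
  "integrable lborel (\<lambda>y::real^2. c * (indicator (ball 0 1) y / norm (x - y) + indicator (ball 0 1) y / norm (x' - y)))"
  by (intro integrable_mult_right Bochner_Integration.integrable_add integrable_inverse_norm_translate)

text \<open>Only the singularities \<open>1 / norm (x - y)\<close> and \<open>1 / norm (x' - y)\<close> occur when kernels at two points are compared.\<close>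

lemma integral_two_poles:
  assumes "norm (x::real^2) \<le> 1" "norm x' \<le> 1" "c \<ge> 0"
  shows "(LINT y|lborel. c * (indicator (ball 0 1) y / norm (x - y) + indicator (ball 0 1) y / norm (x' - y)))
     \<le> c * (2 * inverse_norm_mass)"
proof -
  have "(LINT y|lborel. c * (indicator (ball 0 1) y / norm (x - y) + indicator (ball 0 1) y / norm (x' - y)))
     = c * (LINT y|lborel. (indicator (ball 0 1) y / norm (x - y) + indicator (ball 0 1) y / norm (x' - y)))"
    by (rule integral_mult_right_zero)
  also have "(LINT y|lborel. (indicator (ball 0 1) y / norm (x - y) + indicator (ball 0 1) y / norm (x' - y))) =
     (LINT y|lborel. indicator (ball 0 1) y / norm (x - y)) + (LINT y|lborel. indicator (ball 0 1) y / norm (x' - y))"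
    by (intro Bochner_Integration.integral_add integrable_inverse_norm_translate)
  also have "c * \<dots> \<le> c * (inverse_norm_mass + inverse_norm_mass)"
    using assms by (intro mult_left_mono add_mono integral_inverse_norm_le) auto
  finally show ?thesis by simp
qed

lemma green_integrand_bound:
  assumes F: "disc_density F" "\<And>y. \<bar>F y\<bar> \<le> B" and x: "norm x \<le> 1" and ne: "y \<noteq> x"
  shows "\<bar>green_kernel x y * F y\<bar> \<le> 16 * B * (indicator (ball 0 1) y / norm (x - y) + indicator (ball 0 1) y / norm (axis 1 1 - y))"
proof (cases "y \<in> ball 0 1")
  case True
  have "0 \<le> B" using F(2)[of 0] by linarith
  have "\<bar>green_kernel x y\<bar> * \<bar>F y\<bar> \<le> 16 * (1 / norm (x - y) + 1 / norm (axis 1 1 - y)) * B"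
    using green_kernel_bound[OF x True] ne F(2) \<open>0 \<le> B\<close> by (intro mult_mono) auto
  then show ?thesis using True by (simp add: abs_mult mult_ac)
qed (use F in \<open>simp add: disc_density_def\<close>)

lemma green_integrable:
  assumes F: "disc_density F" and x: "norm x \<le> 1"
  shows "integrable lborel (\<lambda>y. green_kernel x y * F y)"
proof -
  note [measurable] = disc_density_measurable[OF F]
  obtain B where B: "B \<ge> 0" "\<And>y. \<bar>F y\<bar> \<le> B" using disc_density_bounded[OF F] by metis
  have AE: "AE y in lborel. y \<noteq> x" by (rule AE_lborel_singleton)
  show ?thesis
  proof (rule Bochner_Integration.integrable_bound[OF integrable_two_poles[of "16 * B" x "axis 1 1"]], measurable, rule AE_mp[OF AE], intro AE_I2 impI)
    fix y assume "y \<noteq> x"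
    from green_integrand_bound[OF F B(2) x this]
    show "norm (green_kernel x y * F y) \<le> norm (16 * B * (indicator (ball 0 1) y / norm (x - y) + indicator (ball 0 1) y / norm (axis 1 1 - y)))"
      unfolding real_norm_def by (rule order_trans[OF _ abs_ge_self])
  qed
qed

lemma green_eq:
  assumes F: "disc_density F" and x: "x \<in> ball 0 1"
  shows "green F x = harmonic_part F x - log_potential 0 F x"
proof -
  have Fc: "continuous_on A F" for A using F by (auto simp: disc_density_def intro: continuous_on_subset)
  have h: "integrable lborel (\<lambda>y. ln (image_sq x y) * F y)"
  proof (rule integrable_continuous_on_disc)
    have "image_sq x y \<noteq> 0" if "y \<in> cball 0 1" for y using image_sq_pos[of x y] x that by auto
    then show "continuous_on (cball 0 1) (\<lambda>y. ln (image_sq x y) * F y)"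
      by (intro continuous_intros Fc continuous_image_sq) auto
  qed (use F in \<open>simp add: disc_density_def\<close>)
  have g: "integrable lborel (\<lambda>y. green_kernel x y * F y)" using green_integrable[OF F] x by simp
  have "log_potential 0 F x = (LINT y|lborel. ln (image_sq x y) * F y - green_kernel x y * F y)"
    unfolding log_potential_def green_kernel_def by (simp add: algebra_simps)
  also have "\<dots> = harmonic_part F x - green F x"
    unfolding green_def harmonic_part_def by (rule Bochner_Integration.integral_diff[OF h g])
  finally show ?thesis by simp
qed

lemma green_has_derivative:
  assumes F: "disc_density F" and x: "x \<in> ball 0 1"
  shows "(green F has_derivative (\<lambda>h. green_grad F x \<bullet> h)) (at x)"
proof -
  have "((\<lambda>x. harmonic_part F x - log_potential 0 F x) has_derivative (\<lambda>h. green_grad F x \<bullet> h)) (at x)"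
    unfolding green_grad_def inner_diff_left
    by (intro has_derivative_diff harmonic_part_has_derivative log_potential_has_derivative F x)
  then show ?thesis
    by (rule has_derivative_transform_within_open[OF _ open_ball x]) (simp add: green_eq[OF F])
qed

lemma green_grad_continuous:
  assumes F: "disc_density F"
  shows "continuous_on (ball 0 1) (green_grad F)"
  unfolding green_grad_def
  using harmonic_grad_has_derivative(3)[OF F, of _ 0] log_potential_grad_continuous[OF F]
  by (intro continuous_on_diff) (auto intro: continuous_at_imp_continuous_on continuous_on_subset)

text \<open>Boundedness up to the boundary is the point: it makes the solutions Lipschitz, hence the nonlinear density continuously
  differentiable across the boundary.\<close>

lemma green_grad_bounded:
  assumes F: "disc_density F"
  obtains C where "C \<ge> 0" "\<And>x. x \<in> ball 0 1 \<Longrightarrow> norm (green_grad F x) \<le> C"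
proof -
  obtain B where B: "B \<ge> 0" "\<And>y. \<bar>F y\<bar> \<le> B" using disc_density_bounded[OF F] by metis
  have "norm (green_grad F x) \<le> 2 * B * inverse_norm_mass + 2 * B * inverse_norm_mass" if "x \<in> ball 0 1" for x
    unfolding green_grad_def
    using harmonic_grad_bounded[OF F B(2) that] log_potential_grad_bounded[OF F B(2), of x] that
    by (intro order_trans[OF norm_triangle_ineq4 add_mono]) auto
  moreover have "2 * B * inverse_norm_mass + 2 * B * inverse_norm_mass \<ge> 0"
    using B inverse_norm_mass_nonneg by simp
  ultimately show ?thesis using that by blast
qed

text \<open>The solution operator with values extended by zero; on the circle nothing changes because the kernel vanishes there.\<close>

definition green_op :: "(real^2 \<Rightarrow> real) \<Rightarrow> real^2 \<Rightarrow> real" where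
  "green_op F x = (if x \<in> ball 0 1 then green F x else 0)"

lemma green_op_has_derivative:
  assumes F: "disc_density F" and x: "x \<in> ball 0 1"
  shows "(green_op F has_derivative (\<lambda>h. green_grad F x \<bullet> h)) (at x)"
  by (rule has_derivative_transform_within_open[OF green_has_derivative[OF F x] open_ball x])
    (simp add: green_op_def)

text \<open>The harmonic part contributes nothing to the Laplacian, and the logarithmic potential contributes the density.\<close>

lemma green_op_C2:
  assumes F: "disc_density_C1 F F'"
  shows "C2_on (ball 0 1) (green_op F)"
    and "x \<in> ball 0 1 \<Longrightarrow> laplacian (green_op F) x = - laplace_const * F x"
proof -
  have dF: "disc_density F" using F by (simp add: disc_density_C1_def)
  define k where "k i x = harmonic_hess F (axis i 1) x - conv_hess 0 F' (axis i 1) x" for i x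
  have grad: "(green_op F has_derivative (\<lambda>h. green_grad F x \<bullet> h)) (at x)" if "x \<in> ball 0 1" for x
    by (rule green_op_has_derivative[OF dF that])
  have hess: "((\<lambda>x. green_grad F x $ i) has_derivative (\<lambda>h. k i x \<bullet> h)) (at x)" if "x \<in> ball 0 1" for x i
  proof -
    have "((\<lambda>x. harmonic_grad F x \<bullet> axis i 1 - log_potential_grad 0 F x \<bullet> axis i 1) has_derivative (\<lambda>h. k i x \<bullet> h)) (at x)"
      unfolding k_def inner_diff_left log_potential_grad_inner[OF dF]
      by (intro has_derivative_diff harmonic_grad_has_derivative[OF dF that] conv_has_derivative[OF F]) auto
    then show ?thesis by (simp add: green_grad_def inner_axis)
  qed
  have cont: "continuous_on (ball 0 1) (k i)" for i
    unfolding k_def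
    using harmonic_grad_has_derivative(2)[OF dF, of _ "axis i 1"] conv_has_derivative(3)[OF F, of "axis i 1"]
    by (intro continuous_on_diff) (auto intro: continuous_at_imp_continuous_on continuous_on_subset)
  show "C2_on (ball 0 1) (green_op F)"
    by (rule C2_onI(1)[OF open_ball grad hess cont])
  show "laplacian (green_op F) x = - laplace_const * F x" if x: "x \<in> ball 0 1"
  proof -
    have "laplacian (green_op F) x = (\<Sum>i\<in>UNIV. k i x $ i)"
      by (rule C2_onI(2)[OF open_ball grad hess cont x])
    also have "\<dots> = (\<Sum>i\<in>UNIV. harmonic_hess F (axis i 1) x \<bullet> axis i 1) - (\<Sum>i\<in>UNIV. conv_hess 0 F' (axis i 1) x \<bullet> axis i 1)"
      by (simp add: k_def inner_axis sum_subtractf)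
    also have "\<dots> = - laplace_const * F x"
      by (simp add: harmonic_laplacian[OF dF x] log_potential_laplacian[OF F])
    finally show ?thesis .
  qed
qed

lemma green_op_cball: "norm x \<le> 1 \<Longrightarrow> green_op F x = green F x"
  by (auto simp: green_op_def green_def green_kernel_sphere)

text \<open>Fubini and the symmetry of the kernel.\<close>

lemma green_op_symmetric:
  assumes F: "disc_density F" and H: "disc_density H"
  shows "(LINT x|lborel. F x * green_op H x) = (LINT x|lborel. H x * green_op F x)"
proof -
  note [measurable] = disc_density_measurable[OF F] disc_density_measurable[OF H] green_kernel_measurable2
  obtain B where B: "B \<ge> 0" "\<And>y. \<bar>H y\<bar> \<le> B" using disc_density_bounded[OF H] by metis
  obtain A where A: "A \<ge> 0" "\<And>y. \<bar>F y\<bar> \<le> A" using disc_density_bounded[OF F] by metis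
  let ?f = "\<lambda>x y. F x * (green_kernel x y * H y)"
  have op: "F x * green_op H x = (LINT y|lborel. F x * (green_kernel x y * H y))" if "disc_density F" for F H x
  proof (cases "x \<in> ball 0 1")
    case True
    then show ?thesis by (simp add: green_op_def green_def)
  qed (use that in \<open>simp add: disc_density_def\<close>)
  have zero: "F x = 0" if "x \<notin> ball 0 1" for x using that F by (simp add: disc_density_def)
  have meas: "(\<lambda>z. ?f (fst z) (snd z)) \<in> borel_measurable (lborel \<Otimes>\<^sub>M lborel)"
  proof -
    have "(\<lambda>z. ?f (fst z) (snd z)) \<in> borel_measurable (borel \<Otimes>\<^sub>M borel)" by measurable
    then show ?thesis by (simp cong: measurable_cong_sets sets_pair_measure_cong)
  qed
  have int: "integrable (lborel \<Otimes>\<^sub>M lborel) (\<lambda>z. ?f (fst z) (snd z))"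
  proof (rule lborel_pair.Fubini_integrable[OF meas])
    show "AE x in lborel. integrable lborel (\<lambda>y. ?f (fst (x, y)) (snd (x, y)))"
    proof (intro AE_I2)
      fix x :: "real^2"
      show "integrable lborel (\<lambda>y. ?f (fst (x, y)) (snd (x, y)))"
        using green_integrable[OF H, of x] zero[of x] by (cases "x \<in> ball 0 1") auto
    qed
    show "integrable lborel (\<lambda>x. LINT y|lborel. norm (?f (fst (x, y)) (snd (x, y))))"
    proof (rule integrable_disc_bound[where C = "A * (16 * B * (2 * inverse_norm_mass))"])
      have "(\<lambda>z. norm (?f (fst z) (snd z))) \<in> borel_measurable (borel \<Otimes>\<^sub>M lborel)"
        using meas by (simp cong: measurable_cong_sets sets_pair_measure_cong)
      then have "(\<lambda>x. LINT y|lborel. norm (?f (fst (x, y)) (snd (x, y)))) \<in> borel_measurable borel"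
        by (intro lborel.borel_measurable_lebesgue_integral) (simp add: case_prod_beta')
      then show "(\<lambda>x. LINT y|lborel. norm (?f (fst (x, y)) (snd (x, y)))) \<in> borel_measurable borel" .
      fix x :: "real^2"
      show "norm (LINT y|lborel. norm (?f (fst (x, y)) (snd (x, y)))) \<le> A * (16 * B * (2 * inverse_norm_mass)) * indicator (ball 0 1) x"
      proof (cases "x \<in> ball 0 1")
        case True
        then have x: "norm x \<le> 1" by simp
        have AE: "AE y in lborel. y \<noteq> x" by (rule AE_lborel_singleton)
        have "(LINT y|lborel. \<bar>green_kernel x y * H y\<bar>) \<le>
            (LINT y|lborel. 16 * B * (indicator (ball 0 1) y / norm (x - y) + indicator (ball 0 1) y / norm (axis 1 1 - y)))"
        proof (rule integral_mono_AE)
          show "AE y in lborel. \<bar>green_kernel x y * H y\<bar> \<le> 16 * B * (indicator (ball 0 1) y / norm (x - y) + indicator (ball 0 1) y / norm (axis 1 1 - y))"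
            by (rule AE_mp[OF AE], intro AE_I2 impI) (rule green_integrand_bound[OF H B(2) x])
        qed (rule integrable_two_poles integrable_abs[OF green_integrable[OF H x]])+
        also have "\<dots> \<le> 16 * B * (2 * inverse_norm_mass)"
          using B x by (intro integral_two_poles) auto
        finally have 1: "(LINT y|lborel. \<bar>green_kernel x y * H y\<bar>) \<le> 16 * B * (2 * inverse_norm_mass)" .
        have "norm (LINT y|lborel. norm (?f (fst (x, y)) (snd (x, y)))) = \<bar>F x\<bar> * (LINT y|lborel. \<bar>green_kernel x y * H y\<bar>)"
          by (simp add: abs_mult)
        also have "\<dots> \<le> A * (16 * B * (2 * inverse_norm_mass))"
          using A 1 by (intro mult_mono) auto
        finally show ?thesis using True by simp
      qed (use zero in simp)
    qed
  qed
  have "(LINT x|lborel. F x * green_op H x) = (LINT x|lborel. LINT y|lborel. ?f x y)"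
    by (simp add: op[OF F])
  also have "\<dots> = (LINT y|lborel. LINT x|lborel. ?f x y)"
    using int by (intro lborel_pair.Fubini_integral[symmetric]) (simp add: case_prod_beta')
  also have "\<dots> = (LINT y|lborel. LINT x|lborel. H y * (green_kernel y x * F x))"
    by (subst green_kernel_sym) (simp add: mult_ac)
  also have "\<dots> = (LINT x|lborel. H x * green_op F x)"
    by (simp add: op[OF H])
  finally show ?thesis .
qed

lemma green_kernel_orthogonal:
  assumes "orthogonal_transformation R"
  shows "green_kernel (R x) (R y) = green_kernel x y"
proof -
  have "R x \<bullet> R y = x \<bullet> y" "R x \<bullet> R x = x \<bullet> x" "R y \<bullet> R y = y \<bullet> y"
    using assms by (auto simp: orthogonal_transformation_def)
  then show ?thesis
    by (simp add: green_kernel_def image_sq_def inner_diff_left inner_diff_right inner_commute)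
qed

text \<open>The kernel and Lebesgue measure are invariant under orthogonal maps.\<close>

lemma green_op_antisymmetric:
  assumes F: "disc_density F" and R: "orthogonal_transformation R" and anti: "\<And>y. F (R y) = - F y"
  shows "green_op F (R x) = - green_op F x"
proof -
  note [measurable] = disc_density_measurable[OF F]
  have "green F (R x) = (LINT y|lborel. green_kernel (R x) (R y) * F (R y))"
    unfolding green_def by (rule integral_orthogonal[OF R, symmetric]) measurable
  also have "\<dots> = - green F x"
    by (simp add: green_kernel_orthogonal[OF R] anti green_def)
  finally show ?thesis using R by (simp add: green_op_def orthogonal_transformation_norm)
qed

section \<open>The odd power and its Young inequality\<close>

text \<open>The odd extension of \<open>t powr p\<close>; it is the nonlinearity of the equation.\<close>

definition signed_pow :: "real \<Rightarrow> real \<Rightarrow> real" where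
  "signed_pow p t = \<bar>t\<bar> powr (p - 1) * t"

lemma signed_pow_0[simp]: "signed_pow p 0 = 0" by (simp add: signed_pow_def)

lemma signed_pow_minus: "signed_pow p (- t) = - signed_pow p t" by (simp add: signed_pow_def)

lemma abs_powr_mult_self: "\<bar>t\<bar> powr a * \<bar>t\<bar> = \<bar>t\<bar> powr (a + 1)" for t a :: real
  by (cases "t = 0") (auto simp: powr_add)

lemma abs_signed_pow: "\<bar>signed_pow p t\<bar> = \<bar>t\<bar> powr p"
  using abs_powr_mult_self[of t "p - 1"] by (simp add: signed_pow_def abs_mult)

lemma signed_pow_mult_self: "signed_pow p t * t = \<bar>t\<bar> powr (p + 1)"
proof -
  have "signed_pow p t * t = \<bar>t\<bar> powr (p - 1) * \<bar>t\<bar> * \<bar>t\<bar>"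
    by (simp add: signed_pow_def)
  also have "\<dots> = \<bar>t\<bar> powr (p + 1)" by (simp add: abs_powr_mult_self)
  finally show ?thesis .
qed

lemma signed_pow_nonneg: "t \<ge> 0 \<Longrightarrow> signed_pow p t = t powr p"
  using abs_powr_mult_self[of t "p - 1"] by (simp add: signed_pow_def)

lemma signed_pow_nonpos: "t \<le> 0 \<Longrightarrow> signed_pow p t = - ((- t) powr p)"
  using signed_pow_nonneg[of "- t" p] by (simp add: signed_pow_minus)

lemma signed_pow_scale: "signed_pow p (c * t) = c powr p * signed_pow p t" if "c > 0"
proof -
  have "c powr (p - 1) * c = c powr p" using abs_powr_mult_self[of c "p - 1"] that by simp
  then show ?thesis using that by (simp add: signed_pow_def abs_mult powr_mult algebra_simps)
qed

lemma continuous_signed_pow: "p > 1 \<Longrightarrow> continuous_on UNIV (signed_pow p)"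
  unfolding signed_pow_def by (intro continuous_intros continuous_on_powr') auto

text \<open>Differentiability at 0 uses \<open>p > 1\<close>.\<close>

lemma DERIV_signed_pow:
  assumes "p > 1"
  shows "(signed_pow p has_real_derivative p * \<bar>t\<bar> powr (p - 1)) (at t)"
proof -
  consider "t > 0" | "t < 0" | "t = 0" by linarith
  then show ?thesis
  proof cases
    case 1
    have "((\<lambda>t. t powr p) has_real_derivative p * t powr (p - 1)) (at t)"
      using 1 by (rule has_real_derivative_powr)
    then have "((\<lambda>t. t powr p) has_real_derivative p * \<bar>t\<bar> powr (p - 1)) (at t)" using 1 by simp
    then show ?thesis
      by (rule has_field_derivative_transform_within_open[where S = "{0<..}"])
        (use 1 in \<open>auto simp: signed_pow_nonneg\<close>)
  next
    case 2
    have "((\<lambda>t. - ((- t) powr p)) has_real_derivative - (p * (- t) powr (p - 1) * (- 1))) (at t)"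
      using 2 by (auto intro!: derivative_eq_intros)
    then have "((\<lambda>t. - ((- t) powr p)) has_real_derivative p * \<bar>t\<bar> powr (p - 1)) (at t)" using 2 by simp
    then show ?thesis
      by (rule has_field_derivative_transform_within_open[where S = "{..<0}"])
        (use 2 in \<open>auto simp: signed_pow_nonpos\<close>)
  next
    case 3
    have "((\<lambda>h. \<bar>h\<bar> powr (p - 1)) \<longlongrightarrow> \<bar>0\<bar> powr (p - 1)) (at (0::real))"
    proof -
      have "continuous_on UNIV (\<lambda>h::real. \<bar>h\<bar> powr (p - 1))"
        using assms by (intro continuous_intros continuous_on_powr') auto
      then show ?thesis unfolding continuous_on_def by blast
    qed
    then have "((\<lambda>h. \<bar>h\<bar> powr (p - 1)) \<longlongrightarrow> 0) (at (0::real))" by simp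
    then have "((\<lambda>h. (signed_pow p (0 + h) - signed_pow p 0) / h) \<longlongrightarrow> 0) (at 0)"
      by (rule Lim_transform_eventually) (use assms in \<open>auto simp: signed_pow_def eventually_at_filter\<close>)
    then show ?thesis using 3 assms by (simp add: DERIV_def)
  qed
qed

lemma signed_pow_strict_mono:
  assumes "p > 1" "s < t"
  shows "signed_pow p s < signed_pow p t"
proof -
  have pos: "signed_pow p a < signed_pow p b" if "0 \<le> a" "a < b" for a b
    using that assms(1) by (simp add: signed_pow_nonneg powr_less_mono2)
  show ?thesis
  proof (cases "0 \<le> s")
    case True
    then show ?thesis using pos assms by simp
  next
    case s: False
    show ?thesis
    proof (cases "t \<le> 0")
      case True
      then have "signed_pow p (- t) < signed_pow p (- s)" using assms s by (intro pos) auto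
      then show ?thesis by (simp add: signed_pow_minus)
    next
      case False
      have "signed_pow p 0 < signed_pow p t" "signed_pow p 0 < signed_pow p (- s)"
        using pos[of 0 t] pos[of 0 "- s"] False s by simp_all
      then show ?thesis by (simp add: signed_pow_minus)
    qed
  qed
qed

lemma DERIV_abs_powr:
  assumes "p > 1"
  shows "((\<lambda>t. \<bar>t\<bar> powr (p + 1)) has_real_derivative (p + 1) * signed_pow p t) (at t)"
proof -
  have "((\<lambda>t. signed_pow p t * t) has_real_derivative (p + 1) * signed_pow p t) (at t)"
    by (rule derivative_eq_intros DERIV_signed_pow[OF assms] refl)+
      (simp add: signed_pow_def algebra_simps)
  then show ?thesis by (simp add: signed_pow_mult_self)
qed

text \<open>For fixed \<open>s\<close> the gap is the difference between the convex function \<open>\<bar>t\<bar> powr (p + 1) / (p + 1)\<close> and its tangent at \<open>s\<close>. Its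
  derivative \<open>signed_pow p t - signed_pow p s\<close> changes sign exactly at \<open>s\<close>, which gives the strict inequality.\<close>

lemma young_signed_pow:
  assumes p: "p > 1"
  defines "gap \<equiv> \<lambda>s t. p / (p + 1) * \<bar>s\<bar> powr (p + 1) + 1 / (p + 1) * \<bar>t\<bar> powr (p + 1) - signed_pow p s * t"
  shows "s \<noteq> t \<Longrightarrow> gap s t > 0" and "gap s t \<ge> 0"
proof -
  have gs: "gap s s = 0"
  proof -
    have "p / (p + 1) + 1 / (p + 1) = 1" using p by (simp add: add_divide_distrib[symmetric])
    then have "(p / (p + 1) + 1 / (p + 1)) * \<bar>s\<bar> powr (p + 1) = \<bar>s\<bar> powr (p + 1)" by simp
    then show ?thesis unfolding gap_def signed_pow_mult_self by (simp add: distrib_right)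
  qed
  have d: "(gap s has_real_derivative signed_pow p t - signed_pow p s) (at t)" for t
  proof -
    have "((\<lambda>t. p / (p + 1) * \<bar>s\<bar> powr (p + 1) + 1 / (p + 1) * \<bar>t\<bar> powr (p + 1) - signed_pow p s * t)
        has_real_derivative (0 + 1 / (p + 1) * ((p + 1) * signed_pow p t) - signed_pow p s * 1)) (at t)"
      by (intro DERIV_add DERIV_diff DERIV_const DERIV_cmult DERIV_abs_powr p DERIV_ident)
    then show ?thesis using p by (simp add: gap_def)
  qed
  show *: "gap s t > 0" if "s \<noteq> t"
  proof (cases "s < t")
    case True
    obtain z where z: "z > s" "z < t" "gap s t - gap s s = (t - s) * (signed_pow p z - signed_pow p s)"
      using MVT2[OF True, of "gap s" "\<lambda>z. signed_pow p z - signed_pow p s"] d by blast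
    have "(t - s) * (signed_pow p z - signed_pow p s) > 0"
      using signed_pow_strict_mono[OF p z(1)] True by (intro mult_pos_pos) auto
    then show ?thesis using z gs by simp
  next
    case False
    then have "t < s" using that by simp
    then obtain z where z: "z > t" "z < s" "gap s s - gap s t = (s - t) * (signed_pow p z - signed_pow p s)"
      using MVT2[of t s "gap s" "\<lambda>z. signed_pow p z - signed_pow p s"] d by blast
    have "(s - t) * (signed_pow p z - signed_pow p s) < 0"
      using signed_pow_strict_mono[OF p z(2)] \<open>t < s\<close> by (intro mult_pos_neg) auto
    then show ?thesis using z gs by simp
  qed
  show "gap s t \<ge> 0" using * gs by (cases "s = t") (auto intro: less_imp_le)
qed

section \<open>The weighted nonlinearity and compactness of the Green operator\<close>

lemma henon_weight_powr: "x \<noteq> 0 \<Longrightarrow> henon_weight \<alpha> x = norm x powr \<alpha>"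
  by (simp add: henon_weight_def)

lemma henon_weight_nonneg: "henon_weight \<alpha> x \<ge> 0" by (simp add: henon_weight_def)

lemma henon_weight_pos: "x \<noteq> 0 \<Longrightarrow> henon_weight \<alpha> x > 0" by (simp add: henon_weight_def)

lemma henon_weight_le_1: "\<alpha> \<ge> 0 \<Longrightarrow> norm x \<le> 1 \<Longrightarrow> henon_weight \<alpha> x \<le> 1"
  using powr_mono2[of \<alpha> "norm x" 1] by (simp add: henon_weight_def)

lemma continuous_henon_weight: "\<alpha> \<ge> 0 \<Longrightarrow> continuous_on UNIV (henon_weight \<alpha>)"
proof (cases "\<alpha> = 0")
  case False
  assume "\<alpha> \<ge> 0"
  then show ?thesis
    using False unfolding henon_weight_def by (auto intro!: continuous_intros continuous_on_powr')
qed (simp add: henon_weight_def)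

definition henon_density :: "real \<Rightarrow> real \<Rightarrow> (real^2 \<Rightarrow> real) \<Rightarrow> real^2 \<Rightarrow> real" where
  "henon_density \<alpha> p v x = henon_weight \<alpha> x * signed_pow p (v x)"

lemma disc_density_henon:
  assumes "\<alpha> \<ge> 0" "p > 1" "disc_density v"
  shows "disc_density (henon_density \<alpha> p v)"
  unfolding disc_density_def henon_density_def
proof (intro conjI)
  show "continuous_on UNIV (\<lambda>x. henon_weight \<alpha> x * signed_pow p (v x))"
    using assms unfolding disc_density_def
    by (intro continuous_on_mult continuous_henon_weight continuous_on_compose2[OF continuous_signed_pow]) auto
qed (use assms in \<open>simp add: disc_density_def\<close>)

definition henon_energy :: "real \<Rightarrow> real \<Rightarrow> (real^2 \<Rightarrow> real) \<Rightarrow> real" where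
  "henon_energy \<alpha> p v = (LINT x|lborel. henon_weight \<alpha> x * \<bar>v x\<bar> powr (p + 1))"

lemma disc_density_abs_powr:
  assumes "\<alpha> \<ge> 0" "p > 1" "disc_density v"
  shows "disc_density (\<lambda>x. henon_weight \<alpha> x * \<bar>v x\<bar> powr (p + 1))"
  unfolding disc_density_def
proof (intro conjI)
  have "continuous_on UNIV (\<lambda>x. \<bar>v x\<bar>)" using assms by (auto simp: disc_density_def intro!: continuous_intros)
  then show "continuous_on UNIV (\<lambda>x. henon_weight \<alpha> x * \<bar>v x\<bar> powr (p + 1))"
    using assms(1,2) continuous_henon_weight
    by (intro continuous_on_mult continuous_on_powr' continuous_on_const) auto
qed (use assms in \<open>simp add: disc_density_def\<close>)

lemma disc_density_integrable: "disc_density F \<Longrightarrow> integrable lborel F"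
  by (rule integrable_continuous_on_disc) (auto simp: disc_density_def intro: continuous_on_subset)

lemma henon_energy_nonneg: "henon_energy \<alpha> p v \<ge> 0"
  unfolding henon_energy_def by (rule integral_nonneg_AE) (auto simp: henon_weight_nonneg)

text \<open>The estimate depends on \<open>v\<close> through its energy alone, which gives compactness on bounded sets of energy. Young's inequality separates
  \<open>\<bar>v\<bar> powr p\<close> from the kernel difference; with the exponent \<open>1 / (p + 1)\<close> the power \<open>p + 1\<close> of the kernel difference has just the
  integrable singularities \<open>1 / norm (x - y)\<close> and \<open>1 / norm (x' - y)\<close>.\<close>

lemma green_op_holder:
  assumes \<alpha>: "\<alpha> \<ge> 0" and p: "p > 1"
  obtains C where "C \<ge> 0"
    "\<And>v x x'. disc_density v \<Longrightarrow>
       \<bar>green_op (henon_density \<alpha> p v) x - green_op (henon_density \<alpha> p v) x'\<bar>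
         \<le> (henon_energy \<alpha> p v + C) * norm (x - x') powr (1 / (p + 1))"
proof -
  define \<gamma> where "\<gamma> = 1 / (p + 1)"
  have \<gamma>: "0 < \<gamma>" "\<gamma> \<le> 1" "\<gamma> * (p + 1) = 1" using p by (auto simp: \<gamma>_def)
  define K where "K = (16 / \<gamma>) powr (p + 1)"
  define C where "C = K * (2 * inverse_norm_mass)"
  have K: "K \<ge> 0" by (simp add: K_def)
  have C: "C \<ge> 0" using K inverse_norm_mass_nonneg by (simp add: C_def)
  have point: "\<bar>(green_kernel x y - green_kernel x' y) * henon_density \<alpha> p v y\<bar> \<le>
      norm (x - x') powr \<gamma> * (henon_weight \<alpha> y * \<bar>v y\<bar> powr (p + 1) +
         K * (indicator (ball 0 1) y / norm (x - y) + indicator (ball 0 1) y / norm (x' - y)))"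
    if v: "disc_density v" and x: "norm x \<le> 1" "norm x' \<le> 1" and ne: "y \<noteq> x" "y \<noteq> x'" "x \<noteq> x'" for v x x' y
  proof (cases "y \<in> ball 0 1")
    case True
    then have y: "norm y \<le> 1" by simp
    (* The kernel difference k is of size \<delta>; dividing by \<delta> leaves a function with integrable power p + 1. *)
    define \<delta> where "\<delta> = norm (x - x') powr \<gamma>"
    have \<delta>: "\<delta> > 0" using ne by (simp add: \<delta>_def)
    define k where "k = \<bar>green_kernel x y - green_kernel x' y\<bar>"
    define A where "A = norm (x - y) powr (- \<gamma>)"
    define B where "B = norm (x' - y) powr (- \<gamma>)"
    have AB: "A \<ge> 0" "B \<ge> 0" by (auto simp: A_def B_def)
    have pw: "(norm (z - y) powr (- \<gamma>)) powr (p + 1) = 1 / norm (z - y)" if "z \<noteq> y" for z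
    proof -
      have e: "- \<gamma> * (p + 1) = - 1" using \<gamma>(3) by (simp only: mult_minus_left)
      have "(norm (z - y) powr (- \<gamma>)) powr (p + 1) = norm (z - y) powr (- \<gamma> * (p + 1))" by (rule powr_powr)
      also have "\<dots> = 1 / norm (z - y)" unfolding e using that by (simp add: powr_minus_divide)
      finally show ?thesis .
    qed
    have "k \<le> (8 / \<gamma>) * \<delta> * (A + B)"
      unfolding k_def A_def B_def \<delta>_def using \<gamma> x y ne by (intro green_kernel_diff) auto
    then have kd: "k / \<delta> \<le> (8 / \<gamma>) * (A + B)" using \<delta> by (simp add: field_simps)
    also have "\<dots> \<le> (8 / \<gamma>) * (2 * max A B)" using \<gamma> by (intro mult_left_mono) auto
    finally have "(k / \<delta>) powr (p + 1) \<le> ((16 / \<gamma>) * max A B) powr (p + 1)"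
      using \<delta> p by (intro powr_mono2) (auto simp: k_def)
    also have "\<dots> = K * max A B powr (p + 1)"
      unfolding K_def using \<gamma> AB by (subst powr_mult) auto
    also have "\<dots> \<le> K * (A powr (p + 1) + B powr (p + 1))"
      using K by (intro mult_left_mono) (auto simp: max_def)
    also have "\<dots> = K * (1 / norm (x - y) + 1 / norm (x' - y))"
      using pw[of x] pw[of x'] ne by (simp add: A_def B_def)
    finally have kp: "(k / \<delta>) powr (p + 1) \<le> K * (1 / norm (x - y) + 1 / norm (x' - y))" .
    have "\<bar>v y\<bar> powr p * (k / \<delta>) \<le> \<bar>v y\<bar> powr (p + 1) + (k / \<delta>) powr (p + 1)"
    proof -
      have "signed_pow p \<bar>v y\<bar> * (k / \<delta>) \<le> p / (p + 1) * \<bar>v y\<bar> powr (p + 1) + 1 / (p + 1) * (k / \<delta>) powr (p + 1)"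
        using young_signed_pow(2)[OF p, of "\<bar>v y\<bar>" "k / \<delta>"] \<delta> by (simp add: k_def)
      also have "\<dots> \<le> 1 * \<bar>v y\<bar> powr (p + 1) + 1 * (k / \<delta>) powr (p + 1)"
        using p by (intro add_mono mult_right_mono) auto
      also have "signed_pow p \<bar>v y\<bar> = \<bar>v y\<bar> powr p"
        by (simp add: signed_pow_nonneg)
      finally show ?thesis by simp
    qed
    with kp have "\<bar>v y\<bar> powr p * (k / \<delta>) \<le> \<bar>v y\<bar> powr (p + 1) + K * (1 / norm (x - y) + 1 / norm (x' - y))"
      by linarith
    then have "henon_weight \<alpha> y * (\<bar>v y\<bar> powr p * (k / \<delta>)) \<le>
        henon_weight \<alpha> y * (\<bar>v y\<bar> powr (p + 1) + K * (1 / norm (x - y) + 1 / norm (x' - y)))"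
      by (rule mult_left_mono) (rule henon_weight_nonneg)
    also have "\<dots> \<le> henon_weight \<alpha> y * \<bar>v y\<bar> powr (p + 1) + 1 * (K * (1 / norm (x - y) + 1 / norm (x' - y)))"
      unfolding distrib_left[of "henon_weight \<alpha> y"]
      using henon_weight_le_1[OF \<alpha> y] K by (intro add_left_mono mult_right_mono mult_nonneg_nonneg add_nonneg_nonneg) auto
    finally have "\<delta> * (henon_weight \<alpha> y * (\<bar>v y\<bar> powr p * (k / \<delta>))) \<le>
        \<delta> * (henon_weight \<alpha> y * \<bar>v y\<bar> powr (p + 1) + K * (1 / norm (x - y) + 1 / norm (x' - y)))"
      using \<delta> by (intro mult_left_mono) auto
    moreover have "\<delta> * (henon_weight \<alpha> y * (\<bar>v y\<bar> powr p * (k / \<delta>))) =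
       \<bar>(green_kernel x y - green_kernel x' y) * henon_density \<alpha> p v y\<bar>"
      using \<delta> by (simp add: henon_density_def abs_mult abs_signed_pow k_def henon_weight_nonneg)
    ultimately show ?thesis using True by (simp add: \<delta>_def)
  next
    case False
    then show ?thesis using v by (simp add: henon_density_def disc_density_def)
  qed
  have disc: "\<bar>green_op (henon_density \<alpha> p v) x - green_op (henon_density \<alpha> p v) x'\<bar> \<le> (henon_energy \<alpha> p v + C) * norm (x - x') powr \<gamma>"
    if v: "disc_density v" and x: "norm x \<le> 1" "norm x' \<le> 1" for v x x'
  proof (cases "x = x'")
    case False
    let ?F = "henon_density \<alpha> p v"
    let ?E = "\<lambda>y. henon_weight \<alpha> y * \<bar>v y\<bar> powr (p + 1)"
    let ?P = "\<lambda>y. K * (indicator (ball 0 1) y / norm (x - y) + indicator (ball 0 1) y / norm (x' - y))"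
    have F: "disc_density ?F" by (rule disc_density_henon[OF \<alpha> p v])
    have int: "integrable lborel (\<lambda>y. green_kernel x y * ?F y)" "integrable lborel (\<lambda>y. green_kernel x' y * ?F y)"
      using green_integrable[OF F] x by auto
    have E: "integrable lborel ?E" by (rule disc_density_integrable[OF disc_density_abs_powr[OF \<alpha> p v]])
    have P: "integrable lborel ?P" by (rule integrable_two_poles)
    have "green F x - green F x' = (LINT y|lborel. (green_kernel x y - green_kernel x' y) * F y)"
      if "integrable lborel (\<lambda>y. green_kernel x y * F y)" "integrable lborel (\<lambda>y. green_kernel x' y * F y)" for F
      using that by (simp add: green_def left_diff_distrib)
    from this[OF int] have "\<bar>green_op ?F x - green_op ?F x'\<bar> = \<bar>LINT y|lborel. (green_kernel x y - green_kernel x' y) * ?F y\<bar>"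
      by (simp only: green_op_cball[OF x(1)] green_op_cball[OF x(2)])
    also have "\<dots> \<le> (LINT y|lborel. \<bar>(green_kernel x y - green_kernel x' y) * ?F y\<bar>)"
      by (rule integral_abs_bound)
    also have "\<dots> \<le> (LINT y|lborel. norm (x - x') powr \<gamma> * (?E y + ?P y))"
    proof (rule integral_mono_AE)
      have "integrable lborel (\<lambda>y. green_kernel x y * ?F y - green_kernel x' y * ?F y)"
        by (intro Bochner_Integration.integrable_diff int)
      then show "integrable lborel (\<lambda>y. \<bar>(green_kernel x y - green_kernel x' y) * ?F y\<bar>)"
        by (simp add: left_diff_distrib)
      show "integrable lborel (\<lambda>y. norm (x - x') powr \<gamma> * (?E y + ?P y))"
        by (intro integrable_mult_right Bochner_Integration.integrable_add E P)
      have "AE y in lborel. y \<noteq> x" "AE y in lborel. y \<noteq> x'" by (rule AE_lborel_singleton)+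
      then show "AE y in lborel. \<bar>(green_kernel x y - green_kernel x' y) * ?F y\<bar> \<le> norm (x - x') powr \<gamma> * (?E y + ?P y)"
        by eventually_elim (rule point[OF v x _ _ False])
    qed
    also have "\<dots> = norm (x - x') powr \<gamma> * (henon_energy \<alpha> p v + (LINT y|lborel. ?P y))"
      unfolding henon_energy_def by (subst integral_mult_right_zero, subst Bochner_Integration.integral_add[OF E P]) simp
    also have "\<dots> \<le> norm (x - x') powr \<gamma> * (henon_energy \<alpha> p v + C)"
      unfolding C_def using integral_two_poles[OF x K] by (intro mult_left_mono add_mono) auto
    finally show ?thesis by (simp add: mult.commute)
  qed simp
  have half: "\<bar>green_op (henon_density \<alpha> p v) x - green_op (henon_density \<alpha> p v) x'\<bar> \<le> (henon_energy \<alpha> p v + C) * norm (x - x') powr \<gamma>"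
    if v: "disc_density v" and x: "norm x \<le> 1" "x' \<notin> ball 0 1" for v x x'
  proof -
    (* x' lies outside the disc, where the operator is zero, so it can be replaced by the boundary point nearest to x. *)
  define b where "b = (if x = 0 then axis 1 1 else x /\<^sub>R norm x)"
    have b: "norm b = 1" by (simp add: b_def)
    have "norm (x - b) \<le> norm (x - x')"
    proof -
      have "norm (x - b) = 1 - norm x"
      proof (cases "x = 0")
        case False
        then have "x - b = (norm x - 1) *\<^sub>R (x /\<^sub>R norm x)" by (simp add: b_def algebra_simps)
        then have "norm (x - b) = \<bar>norm x - 1\<bar> * norm (x /\<^sub>R norm x)" by (metis norm_scaleR)
        then show ?thesis using x False by simp
      qed (simp add: b_def)
      also have "\<dots> \<le> norm x' - norm x" using x by simp
      also have "\<dots> \<le> norm (x - x')" by (metis norm_minus_commute norm_triangle_ineq2)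
      finally show ?thesis .
    qed
    then have "(henon_energy \<alpha> p v + C) * norm (x - b) powr \<gamma> \<le> (henon_energy \<alpha> p v + C) * norm (x - x') powr \<gamma>"
      using C \<gamma> henon_energy_nonneg[of \<alpha> p v] by (intro mult_left_mono powr_mono2) auto
    moreover have "green_op F b = 0" "green_op F x' = 0" for F using b x(2) by (auto simp: green_op_def)
    ultimately show ?thesis using disc[OF v x(1), of b] b by simp
  qed
  have "\<bar>green_op (henon_density \<alpha> p v) x - green_op (henon_density \<alpha> p v) x'\<bar> \<le> (henon_energy \<alpha> p v + C) * norm (x - x') powr (1 / (p + 1))"
    if v: "disc_density v" for v x x'
  proof (cases "x \<in> ball 0 1")
    case True
    show ?thesis
      using half[OF v, of x x'] disc[OF v, of x x'] True by (cases "x' \<in> ball 0 1") (auto simp: \<gamma>_def)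
  next
    case x: False
    show ?thesis
    proof (cases "x' \<in> ball 0 1")
      case True
      then show ?thesis
        using half[OF v, of x' x] x by (simp add: \<gamma>_def abs_minus_commute norm_minus_commute)
    qed (use x C henon_energy_nonneg[of \<alpha> p v] in \<open>simp add: green_op_def\<close>)
  qed
  with C show ?thesis using that by blast
qed

section \<open>A variational problem in a symmetry class\<close>

lemma disc_density_cmult: "disc_density F \<Longrightarrow> disc_density (\<lambda>x. c * F x)"
  by (auto simp: disc_density_def intro!: continuous_intros)

lemma disc_density_add: "disc_density F \<Longrightarrow> disc_density G \<Longrightarrow> disc_density (\<lambda>x. F x + G x)"
  by (auto simp: disc_density_def intro!: continuous_intros)

lemma disc_density_diff: "disc_density F \<Longrightarrow> disc_density G \<Longrightarrow> disc_density (\<lambda>x. F x - G x)"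
  by (auto simp: disc_density_def intro!: continuous_intros)

lemma disc_density_mult: "disc_density F \<Longrightarrow> disc_density G \<Longrightarrow> disc_density (\<lambda>x. F x * G x)"
  by (auto simp: disc_density_def intro!: continuous_intros)

text \<open>The set where a continuous function does not vanish is open, and nonempty open sets are not negligible.\<close>

lemma disc_density_integral_0:
  assumes F: "disc_density F" and nn: "\<And>x. F x \<ge> 0" and 0: "integral\<^sup>L lborel F = 0"
  shows "F x = 0"
proof (rule ccontr)
  assume "F x \<noteq> 0"
  have Fc: "continuous_on UNIV F" using F by (simp add: disc_density_def)
  have "AE y in lborel. F y = 0"
    using 0 nn by (subst (asm) integral_nonneg_eq_0_iff_AE[OF disc_density_integrable[OF F]]) auto
  moreover have op: "open {y. F y \<noteq> 0}"
    using Fc by (intro open_Collect_neq continuous_on_const) auto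
  ultimately have "{y. F y \<noteq> 0} \<in> null_sets lborel"
    by (subst AE_iff_null_sets) auto
  then have "negligible {y. F y \<noteq> 0}"
    by (simp add: negligible_iff_null_sets null_sets_completionI)
  then show False using open_not_negligible[OF op] \<open>F x \<noteq> 0\<close> by blast
qed

lemma disc_integral_tendsto:
  assumes F: "\<And>n. disc_density (F n)" "disc_density G" and B: "\<And>n x. \<bar>F n x\<bar> \<le> B"
    and lim: "\<And>x. (\<lambda>n. F n x) \<longlonglongrightarrow> G x"
  shows "(\<lambda>n. LINT x|lborel. F n x) \<longlonglongrightarrow> (LINT x|lborel. G x)"
proof (rule integral_dominated_convergence[where w = "\<lambda>x. B * indicator (ball 0 1) x"])
  show "integrable lborel (\<lambda>x::real^2. B * indicator (ball 0 1) x)" by (rule integrable_indicator_disc)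
  show "AE x in lborel. norm (F n x) \<le> B * indicator (ball 0 1) x" for n
  proof (intro AE_I2)
    fix x show "norm (F n x) \<le> B * indicator (ball 0 1) x"
      using B[of n x] F(1)[of n] by (cases "x \<in> ball 0 1") (auto simp: disc_density_def)
  qed
qed (use F disc_density_measurable lim in auto)

lemma green_op_cmult: "green_op (\<lambda>x. c * F x) x = c * green_op F x"
  by (simp add: green_op_def green_def mult.left_commute)

lemma henon_density_scale: "c > 0 \<Longrightarrow> henon_density \<alpha> p (\<lambda>x. c * v x) = (\<lambda>x. c powr p * henon_density \<alpha> p v x)"
  by (simp add: fun_eq_iff henon_density_def signed_pow_scale mult.left_commute)

lemma henon_energy_scale: "c > 0 \<Longrightarrow> henon_energy \<alpha> p (\<lambda>x. c * v x) = c powr (p + 1) * henon_energy \<alpha> p v"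
proof -
  assume "c > 0"
  then have "(\<lambda>x. henon_weight \<alpha> x * \<bar>c * v x\<bar> powr (p + 1)) =
      (\<lambda>x. c powr (p + 1) * (henon_weight \<alpha> x * \<bar>v x\<bar> powr (p + 1)))"
    by (simp add: fun_eq_iff abs_mult powr_mult)
  then show ?thesis unfolding henon_energy_def by (simp only: integral_mult_right_zero)
qed

text \<open>The class of functions that change sign under an orthogonal map \<open>R\<close>. The nonlinearity is odd and everything else is invariant
  under \<open>R\<close>, so the problem can be solved inside the class, and its members vanish at the origin.\<close>

locale henon_class =
  fixes \<alpha> p :: real and R :: "real^2 \<Rightarrow> real^2"
  assumes \<alpha>: "\<alpha> \<ge> 0" and p: "p > 1" and R: "orthogonal_transformation R"
begin

definition X :: "(real^2 \<Rightarrow> real) set" where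
  "X = {v. disc_density v \<and> (\<forall>x. v (R x) = - v x)}"

abbreviation "dens \<equiv> henon_density \<alpha> p"
abbreviation "E \<equiv> henon_energy \<alpha> p"

text \<open>The solution operator composed with the nonlinearity. Solutions are, up to a factor, its eigenfunctions.\<close>

definition T :: "(real^2 \<Rightarrow> real) \<Rightarrow> real^2 \<Rightarrow> real" where
  "T v = green_op (dens v)"

definition pairing :: "(real^2 \<Rightarrow> real) \<Rightarrow> (real^2 \<Rightarrow> real) \<Rightarrow> real" where
  "pairing u z = (LINT x|lborel. dens u x * z x)"

text \<open>The weighted norm of exponent \<open>p + 1\<close>, whose power \<open>p + 1\<close> is the energy.\<close>

definition nrm :: "(real^2 \<Rightarrow> real) \<Rightarrow> real" where
  "nrm v = E v powr (1 / (p + 1))"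

lemma X_disc: "v \<in> X \<Longrightarrow> disc_density v" by (simp add: X_def)

lemma X_dens: "v \<in> X \<Longrightarrow> disc_density (dens v)"
  by (rule disc_density_henon[OF \<alpha> p X_disc])

lemma X_scale: "v \<in> X \<Longrightarrow> (\<lambda>x. c * v x) \<in> X"
  by (simp add: X_def disc_density_cmult)

lemma X_zero:
  assumes "v \<in> X" shows "v 0 = 0"
proof -
  have "R 0 = 0" using R by (simp add: orthogonal_transformation_linear linear_0)
  then have "v 0 = - v 0" using assms by (metis (mono_tags, lifting) X_def mem_Collect_eq)
  then show ?thesis by simp
qed

lemma dens_antisym: "v \<in> X \<Longrightarrow> dens v (R x) = - dens v x"
proof -
  assume v: "v \<in> X"
  have "henon_weight \<alpha> (R x) = henon_weight \<alpha> x"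
    using R by (simp add: henon_weight_def orthogonal_transformation_norm)
  then show ?thesis using v by (simp add: X_def henon_density_def signed_pow_minus)
qed

lemma holder_continuous_UNIV:
  fixes f :: "real^2 \<Rightarrow> real"
  assumes "\<And>x x'. \<bar>f x - f x'\<bar> \<le> C * norm (x - x') powr (1 / (p + 1))"
  shows "continuous_on UNIV f"
  unfolding continuous_on_def
proof (intro ballI)
  fix a :: "real^2"
  have "continuous_on UNIV (\<lambda>x. C * norm (x - a) powr (1 / (p + 1)))"
    using p by (intro continuous_intros continuous_on_powr') auto
  then have "((\<lambda>x. C * norm (x - a) powr (1 / (p + 1))) \<longlongrightarrow> C * norm (a - a) powr (1 / (p + 1))) (at a)"
    unfolding continuous_on_def by blast
  then have "((\<lambda>x. C * norm (x - a) powr (1 / (p + 1))) \<longlongrightarrow> 0) (at a)" by simp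
  then have "((\<lambda>x. f x - f a) \<longlongrightarrow> 0) (at a)"
    by (rule Lim_null_comparison[rotated]) (use assms in auto)
  then show "(f \<longlongrightarrow> f a) (at a within UNIV)" by (simp add: LIM_zero_iff)
qed

text \<open>Antisymmetry passes through the odd nonlinearity, the radial weight and the Green operator.\<close>

lemma T_in_X: assumes v: "v \<in> X" shows "T v \<in> X"
proof -
  obtain C where C: "\<And>v x x'. disc_density v \<Longrightarrow>
       \<bar>green_op (dens v) x - green_op (dens v) x'\<bar> \<le> (E v + C) * norm (x - x') powr (1 / (p + 1))"
    using green_op_holder[OF \<alpha> p] by metis
  have "continuous_on UNIV (T v)"
    unfolding T_def by (rule holder_continuous_UNIV[OF C[OF X_disc[OF v]]])
  moreover have "T v y = 0" if "y \<notin> ball 0 1" for y using that by (simp add: T_def green_op_def)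
  moreover have "T v (R x) = - T v x" for x
    unfolding T_def by (rule green_op_antisymmetric[OF X_dens[OF v] R dens_antisym[OF v]])
  ultimately show ?thesis by (simp add: X_def disc_density_def)
qed

lemma T_scale: "c > 0 \<Longrightarrow> T (\<lambda>x. c * v x) x = c powr p * T v x"
  by (simp add: T_def henon_density_scale green_op_cmult)

lemma pairing_sym: "u \<in> X \<Longrightarrow> v \<in> X \<Longrightarrow> pairing u (T v) = pairing v (T u)"
  unfolding pairing_def T_def by (rule green_op_symmetric) (rule X_dens; assumption)+

lemma pairing_self: "pairing u u = E u"
  by (simp add: pairing_def henon_energy_def henon_density_def mult.assoc signed_pow_mult_self)

lemma pairing_scale_right: "pairing u (\<lambda>x. c * z x) = c * pairing u z"
  by (simp add: pairing_def mult.left_commute)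

lemma pairing_scale_left: "c > 0 \<Longrightarrow> pairing (\<lambda>x. c * u x) z = c powr p * pairing u z"
  by (simp add: pairing_def henon_density_scale mult.assoc)

text \<open>The weight may vanish at the origin, where antisymmetry gives \<open>u 0 = 0\<close>.\<close>

lemma E_eq_0: assumes "u \<in> X" "E u = 0" shows "u x = 0"
proof (cases "x = 0")
  case False
  have "henon_weight \<alpha> x * \<bar>u x\<bar> powr (p + 1) = 0"
    by (rule disc_density_integral_0[OF disc_density_abs_powr[OF \<alpha> p X_disc[OF assms(1)]]])
      (use assms(2) in \<open>auto simp: henon_energy_def henon_weight_nonneg\<close>)
  then show ?thesis using henon_weight_pos[OF False, of \<alpha>] by simp
qed (use X_zero assms in simp)

text \<open>The pointwise Young inequality, integrated. Equality forces the nonnegative continuous gap to vanish wherever the weight is positive,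
  that is off the origin, where both functions are zero anyway.\<close>

lemma pairing_young:
  assumes u: "u \<in> X" and z: "z \<in> X"
  shows "pairing u z \<le> p / (p + 1) * E u + 1 / (p + 1) * E z"
    and "pairing u z = p / (p + 1) * E u + 1 / (p + 1) * E z \<Longrightarrow> u = z"
proof -
  let ?f = "\<lambda>x. p / (p + 1) * (henon_weight \<alpha> x * \<bar>u x\<bar> powr (p + 1)) + 1 / (p + 1) * (henon_weight \<alpha> x * \<bar>z x\<bar> powr (p + 1)) - dens u x * z x"
  note du = disc_density_abs_powr[OF \<alpha> p X_disc[OF u]] and dz = disc_density_abs_powr[OF \<alpha> p X_disc[OF z]]
    and duz = disc_density_mult[OF X_dens[OF u] X_disc[OF z]]
  have f_eq: "?f x = henon_weight \<alpha> x * (p / (p + 1) * \<bar>u x\<bar> powr (p + 1) + 1 / (p + 1) * \<bar>z x\<bar> powr (p + 1) - signed_pow p (u x) * z x)" for x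
    by (simp add: henon_density_def algebra_simps)
  have f_nn: "?f x \<ge> 0" for x
    unfolding f_eq by (intro mult_nonneg_nonneg henon_weight_nonneg young_signed_pow(2) p)
  have int: "integral\<^sup>L lborel ?f = p / (p + 1) * E u + 1 / (p + 1) * E z - pairing u z"
    unfolding henon_energy_def pairing_def
    using disc_density_integrable[OF du] disc_density_integrable[OF dz] disc_density_integrable[OF duz] by simp
  have "integral\<^sup>L lborel ?f \<ge> 0" by (rule integral_nonneg_AE) (use f_nn in auto)
  then show "pairing u z \<le> p / (p + 1) * E u + 1 / (p + 1) * E z" using int by simp
  assume eq: "pairing u z = p / (p + 1) * E u + 1 / (p + 1) * E z"
  have df: "disc_density ?f"
    by (intro disc_density_diff disc_density_add disc_density_cmult du dz duz)
  have f0: "?f x = 0" for x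
    by (rule disc_density_integral_0[OF df f_nn]) (use int eq in simp)
  show "u = z"
  proof
    fix x
    show "u x = z x"
    proof (cases "x = 0")
      case False
      then show ?thesis
        using f0[of x] henon_weight_pos[OF False, of \<alpha>] young_signed_pow(1)[OF p, of "u x" "z x"] unfolding f_eq by force
    qed (use X_zero[OF u] X_zero[OF z] in simp)
  qed
qed

lemma nrm_pos: "E z > 0 \<Longrightarrow> nrm z > 0" by (simp add: nrm_def)

lemma nrm_powr: "E z > 0 \<Longrightarrow> nrm z powr (p + 1) = E z"
  using p by (simp add: nrm_def powr_powr)

lemma E_normalise:
  assumes "E z > 0" shows "E (\<lambda>x. inverse (nrm z) * z x) = 1"
proof -
  have "inverse (nrm z) powr (p + 1) = inverse (E z)"
    using nrm_pos[OF assms] nrm_powr[OF assms] by (simp add: inverse_powr)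
  then show ?thesis using assms nrm_pos[OF assms] by (simp add: henon_energy_scale)
qed

text \<open>Hoelder's inequality, obtained from Young's by normalising \<open>z\<close>.\<close>

lemma pairing_le_nrm:
  assumes u: "u \<in> X" and z: "z \<in> X" and E: "E u = 1" "E z > 0"
  shows "pairing u z \<le> nrm z"
proof -
  have "pairing u (\<lambda>x. inverse (nrm z) * z x) \<le> p / (p + 1) * E u + 1 / (p + 1) * E (\<lambda>x. inverse (nrm z) * z x)"
    by (rule pairing_young(1)[OF u X_scale[OF z]])
  also have "\<dots> = 1" using E p by (simp add: E_normalise add_divide_distrib[symmetric])
  finally have "inverse (nrm z) * pairing u z \<le> 1" by (simp only: pairing_scale_right)
  then show ?thesis using nrm_pos[OF E(2)] by (simp add: field_simps)
qed

lemma pairing_normalised: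
  assumes "E z > 0"
  shows "pairing (\<lambda>x. inverse (nrm z) * z x) z = nrm z"
proof -
  have n: "nrm z > 0" by (rule nrm_pos[OF assms])
  have "pairing (\<lambda>x. inverse (nrm z) * z x) z = inverse (nrm z) powr p * E z"
    using n by (simp add: pairing_scale_left pairing_self)
  also have "E z = nrm z powr p * nrm z"
    using n nrm_powr[OF assms] by (simp add: powr_add)
  finally show ?thesis using n by (simp add: inverse_powr)
qed

text \<open>Maximise \<open>pairing u (T v)\<close> over all \<open>u\<close> and \<open>v\<close> of energy 1. For fixed \<open>v\<close> the best \<open>u\<close> is a multiple of \<open>T v\<close>,
  and symmetry of the pairing gives the same with the roles exchanged. So a maximising sequence can be replaced by images under \<open>T\<close>, which are
  equicontinuous, and a limit of these images attains the maximum \<open>m\<close>.\<close>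

theorem eigenpair:
  assumes v0: "v0 \<in> X" "T v0 x0 \<noteq> 0"
  obtains u v m where "u \<in> X" "v \<in> X" "E u = 1" "E v = 1" "m > 0"
    "\<And>x. T u x = m * v x" "\<And>x. T v x = m * u x"
proof -
  obtain C where C: "C \<ge> 0" "\<And>v x x'. disc_density v \<Longrightarrow>
       \<bar>green_op (dens v) x - green_op (dens v) x'\<bar> \<le> (E v + C) * norm (x - x') powr (1 / (p + 1))"
    using green_op_holder[OF \<alpha> p] by metis
  define X1 where "X1 = {u \<in> X. E u = 1}"
  have X1: "u \<in> X" "E u = 1" if "u \<in> X1" for u using that by (auto simp: X1_def)
  have hold: "\<bar>T v x - T v x'\<bar> \<le> (1 + C) * norm (x - x') powr (1 / (p + 1))" if "v \<in> X1" for v x x'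
    using C(2)[OF X_disc, of v x x'] X1[OF that] by (simp add: T_def)
  (* T v vanishes on the circle, and no point of the disc is farther than 2 from a given point of the circle. *)
  define D where "D = (1 + C) * 2"
  have D: "D > 0" using C(1) by (simp add: D_def)
  have bound: "\<bar>T v x\<bar> \<le> D" if "v \<in> X1" for v x
  proof (cases "x \<in> ball 0 1")
    case True
    let ?e = "axis 1 1 :: real^2"
    have "T v ?e = 0" by (simp add: T_def green_op_def)
    then have "\<bar>T v x\<bar> \<le> (1 + C) * norm (x - ?e) powr (1 / (p + 1))" using hold[OF that, of x ?e] by simp
    also have "norm (x - ?e) powr (1 / (p + 1)) \<le> 2 powr (1 / (p + 1))"
      using norm_triangle_ineq4[of x ?e] True p by (intro powr_mono2) auto
    also have "2 powr (1 / (p + 1)) \<le> 2 powr (1::real)" using p by (intro powr_mono) auto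
    finally show ?thesis using C(1) by (simp add: D_def)
  qed (use D in \<open>simp add: T_def green_op_def\<close>)
  have nonzero: "E z > 0" if "z \<in> X" "z x \<noteq> 0" for z x
    using E_eq_0[OF that(1), of x] that(2) henon_energy_nonneg[of \<alpha> p z] by fastforce
  have normalise: "(\<lambda>x. inverse (nrm z) * z x) \<in> X1" if "z \<in> X" "E z > 0" for z
    using that by (simp add: X1_def X_scale E_normalise)
  have ET_bound: "E (T v) \<le> D powr (p + 1) * (LINT x|lborel. indicator (ball 0 1) (x::real^2))" if "v \<in> X1" for v
  proof -
    have "E (T v) \<le> (LINT x|lborel. D powr (p + 1) * indicator (ball 0 1) (x::real^2))"
      unfolding henon_energy_def
    proof (rule integral_mono[OF disc_density_integrable[OF disc_density_abs_powr[OF \<alpha> p X_disc[OF T_in_X]]] integrable_indicator_disc])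
      show "v \<in> X" using that by (rule X1)
      fix x :: "real^2"
      show "henon_weight \<alpha> x * \<bar>T v x\<bar> powr (p + 1) \<le> D powr (p + 1) * indicator (ball 0 1) x"
      proof (cases "x \<in> ball 0 1")
        case True
        have "henon_weight \<alpha> x * \<bar>T v x\<bar> powr (p + 1) \<le> 1 * D powr (p + 1)"
          using henon_weight_le_1[OF \<alpha>, of x] True bound[OF that, of x] p
          by (intro mult_mono powr_mono2) auto
        then show ?thesis using True by simp
      qed (simp add: T_def green_op_def)
    qed
    then show ?thesis by simp
  qed
  define S where "S = {pairing u (T v) |u v. u \<in> X1 \<and> v \<in> X1}"
  define m where "m = Sup S"
  have bdd: "bdd_above S"
  proof (rule bdd_aboveI)
    fix s assume "s \<in> S"
    then obtain u v where uv: "u \<in> X1" "v \<in> X1" "s = pairing u (T v)" by (auto simp: S_def)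
    have "s \<le> p / (p + 1) * E u + 1 / (p + 1) * E (T v)"
      unfolding uv(3) by (intro pairing_young(1) T_in_X X1 uv)
    also have "\<dots> \<le> 1 * 1 + 1 * E (T v)"
      using X1(2)[OF uv(1)] p henon_energy_nonneg by (intro add_mono mult_mono) auto
    also have "\<dots> \<le> 1 + D powr (p + 1) * (LINT x|lborel. indicator (ball 0 1) (x::real^2))"
      using ET_bound[OF uv(2)] by simp
    finally show "s \<le> 1 + D powr (p + 1) * (LINT x|lborel. indicator (ball 0 1) (x::real^2))" .
  qed
  have le_m: "pairing u (T v) \<le> m" if "u \<in> X1" "v \<in> X1" for u v
    unfolding m_def by (rule cSup_upper[OF _ bdd]) (use that in \<open>auto simp: S_def\<close>)
  have nrm_le_m: "nrm (T v) \<le> m" if "v \<in> X1" "E (T v) > 0" for v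
    using le_m[OF normalise[OF T_in_X[OF X1(1)[OF that(1)]] that(2)] that(1)] pairing_normalised[OF that(2)] by simp
  have m_pos: "m > 0" and S_ne: "S \<noteq> {}"
  proof -
    have Ez: "E (T v0) > 0" using nonzero[OF T_in_X[OF v0(1)] v0(2)] .
    have "\<exists>x. v0 x \<noteq> 0"
    proof (rule ccontr)
      assume "\<not> (\<exists>x. v0 x \<noteq> 0)"
      then have "dens v0 = (\<lambda>x. 0)" by (simp add: henon_density_def fun_eq_iff)
      then show False using v0(2) by (auto simp: T_def green_op_def green_def split: if_splits)
    qed
    then have Ev: "E v0 > 0" using nonzero[OF v0(1)] by blast
    let ?v = "\<lambda>x. inverse (nrm v0) * v0 x"
    have v: "?v \<in> X1" by (rule normalise[OF v0(1) Ev])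
    have "T ?v x0 \<noteq> 0" using T_scale[of "inverse (nrm v0)" v0 x0] nrm_pos[OF Ev] v0(2) by simp
    then have E: "E (T ?v) > 0" using nonzero[OF T_in_X[OF X1(1)[OF v]]] by blast
    then show "m > 0" using nrm_le_m[OF v E] nrm_pos[OF E] by linarith
    show "S \<noteq> {}" using v by (auto simp: S_def)
  qed
  have "\<exists>u v. u \<in> X1 \<and> v \<in> X1 \<and> m - inverse (real (Suc n)) < pairing u (T v)" for n
  proof -
    have "m - inverse (real (Suc n)) < Sup S" by (simp add: m_def)
    then obtain s where "s \<in> S" "m - inverse (real (Suc n)) < s" by (rule less_cSupE[OF _ S_ne])
    then show ?thesis by (auto simp: S_def)
  qed
  then obtain U V where UV: "\<And>n. U n \<in> X1" "\<And>n. V n \<in> X1" "\<And>n. m - inverse (real (Suc n)) < pairing (U n) (T (V n))"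
    by metis
  have lim_m: "(\<lambda>n. pairing (U n) (T (V n))) \<longlonglongrightarrow> m"
  proof (rule tendsto_sandwich[where h = "\<lambda>n. m"])
    show "(\<lambda>n. m - inverse (real (Suc n))) \<longlonglongrightarrow> m"
      using tendsto_diff[OF tendsto_const LIMSEQ_inverse_real_of_nat, of m] by simp
  qed (use UV le_m in \<open>auto intro!: always_eventually less_imp_le\<close>)
  have equi: "\<exists>d>0. \<forall>n y. y \<in> cball 0 1 \<and> norm (x - y) < d \<longrightarrow> norm (T (V n) x - T (V n) y) < e"
    if "x \<in> cball 0 1" "0 < e" for x :: "real^2" and e :: real
  proof -
    have "((\<lambda>d. (1 + C) * d powr (1 / (p + 1))) \<longlongrightarrow> (1 + C) * 0 powr (1 / (p + 1))) (at_right 0)"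
      using p by (intro tendsto_intros tendsto_powr') (auto intro: eventually_mono[OF eventually_at_right_less])
    then have "\<forall>\<^sub>F d in at_right 0. (1 + C) * d powr (1 / (p + 1)) < e"
      by (rule order_tendstoD) (use that in simp)
    then obtain b where b: "b > 0" "\<And>d. 0 < d \<Longrightarrow> d < b \<Longrightarrow> (1 + C) * d powr (1 / (p + 1)) < e"
      unfolding eventually_at_right_field by auto
    show ?thesis
    proof (intro exI[of _ b] conjI allI impI b(1), elim conjE)
      fix n y assume y: "norm (x - y) < b"
      show "norm (T (V n) x - T (V n) y) < e"
      proof (cases "x = y")
        case False
        then show ?thesis using hold[OF UV(2), of n x y] b(2)[of "norm (x - y)"] y by simp
      qed (use that in simp)
    qed
  qed
  have TV_bound: "norm (T (V n) x) \<le> D" if "x \<in> cball 0 1" for n x using bound[OF UV(2)] by simp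
  obtain g and k :: "nat \<Rightarrow> nat" where "continuous_on (cball 0 1) g" and gk: "strict_mono k"
    "\<And>e. 0 < e \<Longrightarrow> \<exists>N. \<forall>n x. n \<ge> N \<and> x \<in> cball 0 1 \<longrightarrow> norm (T (V (k n)) x - g x) < e"
  proof (rule Arzela_Ascoli[of "cball 0 1" "\<lambda>n. T (V n)", OF compact_cball TV_bound equi], goal_cases)
    case (4 g k)
    show ?case by (rule 4(1)[OF 4(2) 4(3) 4(4)])
  qed
  (* z is only known to be a pointwise limit, but the Hoelder bound passes to the limit and makes it a member of the class. *)
  define z where "z x = (if x \<in> ball 0 1 then g x else 0)" for x
  have lim_z: "(\<lambda>n. T (V (k n)) x) \<longlonglongrightarrow> z x" for x
  proof (cases "x \<in> ball 0 1")
    case True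
    show ?thesis
    proof (rule LIMSEQ_I)
      fix e :: real assume "0 < e"
      then obtain N where "\<forall>n x. n \<ge> N \<and> x \<in> cball 0 1 \<longrightarrow> norm (T (V (k n)) x - g x) < e"
        using gk(2) by blast
      then have "norm (T (V (k n)) x - z x) < e" if "n \<ge> N" for n
        using True that by (simp add: z_def)
      then show "\<exists>N. \<forall>n\<ge>N. norm (T (V (k n)) x - z x) < e" by blast
    qed
  qed (simp add: z_def T_def green_op_def)
  have "\<bar>z x - z x'\<bar> \<le> (1 + C) * norm (x - x') powr (1 / (p + 1))" for x x'
    by (rule LIMSEQ_le_const2[OF tendsto_rabs[OF tendsto_diff[OF lim_z lim_z]]]) (use hold[OF UV(2)] in auto)
  then have z_cont: "continuous_on UNIV z" by (rule holder_continuous_UNIV)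
  have z_disc: "disc_density z" using z_cont by (simp add: disc_density_def z_def)
  have z_anti: "z (R x) = - z x" for x
  proof -
    have "T (V (k n)) (R x) = - T (V (k n)) x" for n using T_in_X[OF X1(1)[OF UV(2)]] by (simp add: X_def)
    then have "(\<lambda>n. - T (V (k n)) x) \<longlonglongrightarrow> z (R x)" using lim_z[of "R x"] by simp
    then show ?thesis using tendsto_minus[OF lim_z[of x]] LIMSEQ_unique by blast
  qed
  have zX: "z \<in> X" using z_disc z_anti by (simp add: X_def)
  have TX: "T (V n) \<in> X" for n by (intro T_in_X X1 UV)
  have "(\<lambda>n. E (T (V (k n)))) \<longlonglongrightarrow> E z"
    unfolding henon_energy_def
  proof (rule disc_integral_tendsto[where B = "D powr (p + 1)"])
    show "disc_density (\<lambda>x. henon_weight \<alpha> x * \<bar>T (V (k n)) x\<bar> powr (p + 1))" for n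
      by (rule disc_density_abs_powr[OF \<alpha> p X_disc[OF TX]])
    show "disc_density (\<lambda>x. henon_weight \<alpha> x * \<bar>z x\<bar> powr (p + 1))"
      by (rule disc_density_abs_powr[OF \<alpha> p z_disc])
    show "(\<lambda>n. henon_weight \<alpha> x * \<bar>T (V (k n)) x\<bar> powr (p + 1)) \<longlonglongrightarrow> henon_weight \<alpha> x * \<bar>z x\<bar> powr (p + 1)" for x
      using p by (intro tendsto_intros tendsto_powr' lim_z) auto
    show "\<bar>henon_weight \<alpha> x * \<bar>T (V (k n)) x\<bar> powr (p + 1)\<bar> \<le> D powr (p + 1)" for n x
    proof (cases "x \<in> ball 0 1")
      case True
      have "henon_weight \<alpha> x * \<bar>T (V (k n)) x\<bar> powr (p + 1) \<le> 1 * D powr (p + 1)"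
        using henon_weight_le_1[OF \<alpha>, of x] True bound[OF UV(2), of "k n" x] p
        by (intro mult_mono powr_mono2) auto
      then show ?thesis by (simp add: henon_weight_nonneg)
    qed (simp add: T_def green_op_def)
  qed
  then have "(\<lambda>n. nrm (T (V (k n)))) \<longlonglongrightarrow> nrm z"
    unfolding nrm_def using p henon_energy_nonneg by (intro tendsto_powr' tendsto_const) auto
  moreover have "pairing (U n) (T (V n)) \<le> nrm (T (V n))" if "E (T (V n)) > 0" for n
    using UV X1 that TX by (intro pairing_le_nrm) auto
  moreover have "pairing (U n) (T (V n)) \<le> nrm (T (V n))" if "\<not> E (T (V n)) > 0" for n
  proof -
    have "E (T (V n)) = 0" using that henon_energy_nonneg[of \<alpha> p "T (V n)"] by simp
    then have "T (V n) = (\<lambda>x. 0)" using E_eq_0[OF TX] by blast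
    then show ?thesis by (simp add: pairing_def nrm_def)
  qed
  ultimately have m_le: "m \<le> nrm z"
    by (intro LIMSEQ_le[OF LIMSEQ_subseq_LIMSEQ[OF lim_m gk(1)], of "\<lambda>n. nrm (T (V (k n)))"])
      (auto simp: comp_def)
  have Ez: "E z > 0"
    using m_le m_pos p by (cases "E z = 0") (use henon_energy_nonneg[of \<alpha> p z] in \<open>auto simp: nrm_def\<close>)
  define u where "u = (\<lambda>x. inverse (nrm z) * z x)"
  have u: "u \<in> X1" unfolding u_def by (rule normalise[OF zX Ez])
  have uX: "u \<in> X" "E u = 1" using X1 u by auto
  obtain B where B: "B \<ge> 0" "\<And>y. \<bar>dens u y\<bar> \<le> B" using disc_density_bounded[OF X_dens[OF uX(1)]] by metis
  have "(\<lambda>n. pairing u (T (V (k n)))) \<longlonglongrightarrow> pairing u z"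
    unfolding pairing_def
  proof (rule disc_integral_tendsto[where B = "B * D"])
    show "disc_density (\<lambda>x. dens u x * T (V (k n)) x)" for n
      by (rule disc_density_mult[OF X_dens[OF uX(1)] X_disc[OF TX]])
    show "disc_density (\<lambda>x. dens u x * z x)" by (rule disc_density_mult[OF X_dens[OF uX(1)] z_disc])
    show "\<bar>dens u x * T (V (k n)) x\<bar> \<le> B * D" for n x
      unfolding abs_mult using B bound[OF UV(2)] by (intro mult_mono) auto
  qed (intro tendsto_intros lim_z)
  then have lim_u: "(\<lambda>n. pairing u (T (V (k n)))) \<longlonglongrightarrow> nrm z"
    unfolding u_def pairing_normalised[OF Ez] .
  then have "nrm z \<le> m" by (rule LIMSEQ_le_const2) (use le_m[OF u UV(2)] in auto)
  with m_le have nz: "nrm z = m" by simp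
  (* Now u is fixed and pairing u (T (V (k n))) still tends to m, so by symmetry T u attains the maximum as well. *)
  define y where "y = T u"
  have yX: "y \<in> X" unfolding y_def by (rule T_in_X[OF uX(1)])
  have pair_y: "pairing u (T (V n)) = pairing (V n) y" for n
    unfolding y_def by (rule pairing_sym[OF uX(1) X1(1)[OF UV(2)]])
  have Ey: "E y > 0"
  proof (rule ccontr)
    assume "\<not> E y > 0"
    then have "E y = 0" using henon_energy_nonneg[of \<alpha> p y] by simp
    then have "y = (\<lambda>x. 0)" using E_eq_0[OF yX] by blast
    then have "pairing u (T (V n)) = 0" for n unfolding pair_y by (simp add: pairing_def)
    then show False using lim_u nz m_pos LIMSEQ_unique[OF lim_u, of 0] by simp
  qed
  have ny: "nrm y = m"
  proof (rule antisym)
    show "nrm y \<le> m" using nrm_le_m[OF u] Ey by (simp add: y_def)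
    have "pairing u (T (V (k n))) \<le> nrm y" for n
      unfolding pair_y using X1 UV by (intro pairing_le_nrm yX Ey) auto
    then show "m \<le> nrm y" using LIMSEQ_le_const2[OF lim_u] nz by auto
  qed
  define v where "v = (\<lambda>x. inverse (nrm y) * y x)"
  have v: "v \<in> X1" unfolding v_def by (rule normalise[OF yX Ey])
  have vX: "v \<in> X" "E v = 1" using X1 v by auto
  have Tu: "T u x = m * v x" for x using ny m_pos by (simp add: v_def y_def)
  have "pairing v (T u) = m" using pairing_normalised[OF Ey] ny by (simp add: v_def y_def)
  then have pm: "pairing u (T v) = m" using pairing_sym[OF uX(1) vX(1)] by simp
  (* The pair (u, v) is maximal, so u and T v / m attain equality in Young's inequality. *)
  define t where "t = (\<lambda>x. inverse m * T v x)"
  have tX: "t \<in> X" unfolding t_def by (intro X_scale T_in_X vX)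
  have pt: "pairing u t = 1" using pm m_pos by (simp add: t_def pairing_scale_right)
  have Et: "E t \<le> 1"
  proof (cases "E (T v) > 0")
    case True
    have "E (T v) = nrm (T v) powr (p + 1)" using nrm_powr[OF True] by simp
    also have "\<dots> \<le> m powr (p + 1)" using nrm_le_m[OF v True] nrm_pos[OF True] p by (intro powr_mono2) auto
    finally have "inverse m powr (p + 1) * E (T v) \<le> inverse m powr (p + 1) * m powr (p + 1)"
      by (intro mult_left_mono) auto
    also have "\<dots> = 1" using m_pos by (simp add: powr_mult[symmetric])
    finally show ?thesis using m_pos unfolding t_def by (subst henon_energy_scale) auto
  next
    case False
    then have "E (T v) = 0" using henon_energy_nonneg[of \<alpha> p "T v"] by simp
    then show ?thesis using m_pos unfolding t_def by (subst henon_energy_scale) auto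
  qed
  have "p / (p + 1) * E u + 1 / (p + 1) * E t \<le> p / (p + 1) * 1 + 1 / (p + 1) * 1"
    using Et uX p by (intro add_mono mult_left_mono) auto
  also have "\<dots> = 1" using p by (simp add: add_divide_distrib[symmetric])
  finally have "pairing u t = p / (p + 1) * E u + 1 / (p + 1) * E t"
    using pairing_young(1)[OF uX(1) tX] pt by linarith
  then have "u = t" by (rule pairing_young(2)[OF uX(1) tX])
  then have Tv: "T v x = m * u x" for x using m_pos by (simp add: t_def)
  show ?thesis by (rule that[OF uX(1) vX(1) uX(2) vX(2) m_pos Tu Tv])
qed

end

section \<open>Regularity of the nonlinear density\<close>

text \<open>Mean value inequality on the convex disc.\<close>

lemma gradient_bound_lipschitz:
  fixes v :: "'a::real_inner \<Rightarrow> real" and G :: "'a \<Rightarrow> 'a"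
  assumes der: "\<And>x. x \<in> ball 0 1 \<Longrightarrow> (v has_derivative (\<lambda>h. G x \<bullet> h)) (at x)"
    and bound: "\<And>x. x \<in> ball 0 1 \<Longrightarrow> norm (G x) \<le> C"
    and xy: "x \<in> ball 0 1" "y \<in> ball 0 1"
  shows "\<bar>v x - v y\<bar> \<le> C * norm (x - y)"
proof -
  have "norm (v x - v y) \<le> C * norm (x - y)"
  proof (rule differentiable_bound[where S = "ball 0 1" and f' = "\<lambda>x h. G x \<bullet> h"])
    fix z :: 'a assume z: "z \<in> ball 0 1"
    show "(v has_derivative (\<lambda>h. G z \<bullet> h)) (at z within ball 0 1)"
      using der[OF z] by (rule has_derivative_at_withinI)
    have "0 \<le> C" using bound[OF z] norm_ge_zero order_trans by blast
    then show "onorm (\<lambda>h. G z \<bullet> h) \<le> C"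
      by (rule onorm_bound) (metis Cauchy_Schwarz_ineq2 bound[OF z] mult_right_mono norm_ge_zero order_trans real_norm_def)
  qed (use xy in auto)
  then show ?thesis by simp
qed

text \<open>A function with bounded gradient that vanishes at the origin, on the circle and outside decays linearly at each of these points. In the
  boundary case one follows the ray through \<open>x\<close> up to the circle, as a limit from inside.\<close>

lemma disc_density_boundary_decay:
  assumes v: "disc_density v" and der: "\<And>x. x \<in> ball 0 1 \<Longrightarrow> (v has_derivative (\<lambda>h. G x \<bullet> h)) (at x)"
    and bound: "\<And>x. x \<in> ball 0 1 \<Longrightarrow> norm (G x) \<le> C" and v0: "v 0 = 0"
    and z: "z = 0 \<or> z \<notin> ball 0 1"
  shows "\<bar>v x\<bar> \<le> C * norm (x - z)"
proof (cases "x \<in> ball 0 1")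
  case x: True
  have C: "0 \<le> C" using bound[of 0] norm_ge_zero[of "G 0"] by (metis centre_in_ball order_trans zero_less_one)
  show ?thesis
  proof (cases "z = 0")
    case True
    then show ?thesis using gradient_bound_lipschitz[OF der bound x, of 0] v0 by simp
  next
    case False
    then have z1: "norm z \<ge> 1" using z by simp
    show ?thesis
    proof (cases "x = 0")
      case False
      define b where "b t = (t / norm x) *\<^sub>R x" for t
      have "\<bar>v x - v (b t)\<bar> \<le> C * (1 - norm x)" if t: "norm x < t" "t < 1" for t
      proof -
        have "t > 0" using t norm_ge_zero[of x] by linarith
        then have "b t \<in> ball 0 1" using t False by (simp add: b_def)
        then have "\<bar>v x - v (b t)\<bar> \<le> C * norm (x - b t)" by (intro gradient_bound_lipschitz[OF der bound x])
        also have "x - b t = ((norm x - t) / norm x) *\<^sub>R x"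
          using False by (simp add: b_def scaleR_diff_left diff_divide_distrib)
        also have "norm \<dots> = t - norm x" using t False by simp
        also have "C * (t - norm x) \<le> C * (1 - norm x)" using C t by (intro mult_left_mono) auto
        finally show ?thesis .
      qed
      then have "\<forall>\<^sub>F t in at_left 1. \<bar>v x - v (b t)\<bar> \<le> C * (1 - norm x)"
        using eventually_at_left_real[of "norm x" 1] x by (auto elim!: eventually_mono)
      moreover have "((\<lambda>t. \<bar>v x - v (b t)\<bar>) \<longlongrightarrow> \<bar>v x - v (b 1)\<bar>) (at_left 1)"
      proof -
        have vc: "continuous_on UNIV v" using v by (simp add: disc_density_def)
        have bc: "continuous_on UNIV b" unfolding b_def divide_inverse by (intro continuous_intros)
        have "continuous_on UNIV (\<lambda>t. \<bar>v x - v (b t)\<bar>)"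
          by (intro continuous_on_rabs continuous_on_diff continuous_on_const continuous_on_compose2[OF vc bc]) simp
        then show ?thesis by (simp add: continuous_on_def filterlim_at_split)
      qed
      moreover have "v (b 1) = 0" using v False by (simp add: disc_density_def b_def)
      ultimately have "\<bar>v x\<bar> \<le> C * (1 - norm x)"
        by (intro tendsto_upperbound[of "\<lambda>t. \<bar>v x - v (b t)\<bar>" _ "at_left 1"]) auto
      also have "\<dots> \<le> C * norm (x - z)"
        using z1 C norm_triangle_ineq2[of z x] by (intro mult_left_mono) (auto simp: norm_minus_commute)
      finally show ?thesis .
    qed (use v0 C in simp)
  qed
next
  case False
  have C: "0 \<le> C" using bound[of 0] norm_ge_zero[of "G 0"] by (metis centre_in_ball order_trans zero_less_one)
  then show ?thesis using v False by (simp add: disc_density_def)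
qed

lemma has_derivative_henon_weight:
  assumes "x \<noteq> 0"
  shows "(henon_weight \<alpha> has_derivative (\<lambda>h. (\<alpha> * norm x powr (\<alpha> - 1)) * (sgn x \<bullet> h))) (at x)"
proof -
  have "((\<lambda>r. r powr \<alpha>) has_real_derivative \<alpha> * norm x powr (\<alpha> - 1)) (at (norm x))"
    using assms by (intro has_real_derivative_powr) simp
  from DERIV_compose_FDERIV[OF this has_derivative_norm[OF assms]]
  have "((\<lambda>x. norm x powr \<alpha>) has_derivative (\<lambda>h. (\<alpha> * norm x powr (\<alpha> - 1)) * (sgn x \<bullet> h))) (at x)"
    by (simp add: mult.commute inner_commute)
  then show ?thesis
    by (rule has_derivative_transform_within_open[where s = "- {0}"]) (use assms in \<open>auto simp: henon_weight_powr\<close>)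
qed

text \<open>The product rule gives this formula off the origin; at the origin and outside the disc the gradient is zero.\<close>

definition henon_density_grad :: "real \<Rightarrow> real \<Rightarrow> (real^2 \<Rightarrow> real) \<Rightarrow> (real^2 \<Rightarrow> real^2) \<Rightarrow> real^2 \<Rightarrow> real^2" where
  "henon_density_grad \<alpha> p v G x = (if x \<in> ball 0 1 - {0}
     then (signed_pow p (v x) * (\<alpha> * norm x powr (\<alpha> - 1))) *\<^sub>R sgn x
        + (norm x powr \<alpha> * (p * \<bar>v x\<bar> powr (p - 1))) *\<^sub>R G x
     else 0)"

text \<open>The critical points are the origin, where the weight need not be differentiable, and the circle, where the density is cut off. At both
  \<open>v\<close> decays linearly, so the density is of order \<open>p > 1\<close> and its gradient of order \<open>p - 1 > 0\<close>.\<close>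

lemma disc_density_C1_henon:
  assumes \<alpha>: "\<alpha> \<ge> 0" and p: "p > 1" and v: "disc_density v" "v 0 = 0"
    and der: "\<And>x. x \<in> ball 0 1 \<Longrightarrow> (v has_derivative (\<lambda>h. G x \<bullet> h)) (at x)"
    and bound: "\<And>x. x \<in> ball 0 1 \<Longrightarrow> norm (G x) \<le> C"
    and cont: "continuous_on (ball 0 1) G"
  shows "disc_density_C1 (henon_density \<alpha> p v) (henon_density_grad \<alpha> p v G)"
proof -
  let ?F = "henon_density \<alpha> p v" and ?F' = "henon_density_grad \<alpha> p v G"
  have C: "0 \<le> C" using bound[of 0] norm_ge_zero[of "G 0"] by (metis centre_in_ball order_trans zero_less_one)
  have decay: "\<bar>v x\<bar> \<le> C * norm (x - z)" if "z = 0 \<or> z \<notin> ball 0 1" for x z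
    by (rule disc_density_boundary_decay[OF v(1) der bound v(2) that])
  have vc: "continuous_on UNIV v" using v by (simp add: disc_density_def)
  have F_bound: "\<bar>?F x\<bar> \<le> (C powr p) * norm (x - z) powr p" if "z = 0 \<or> z \<notin> ball 0 1" for x z
  proof (cases "x \<in> ball 0 1")
    case True
    have "\<bar>?F x\<bar> = henon_weight \<alpha> x * \<bar>v x\<bar> powr p"
      by (simp add: henon_density_def abs_mult abs_signed_pow henon_weight_nonneg)
    also have "\<dots> \<le> 1 * (C * norm (x - z)) powr p"
      using henon_weight_le_1[OF \<alpha>, of x] True decay[OF that, of x] p
      by (intro mult_mono powr_mono2) auto
    also have "\<dots> = (C powr p) * norm (x - z) powr p" using C by (simp add: powr_mult)
    finally show ?thesis .
  next
    case False
    then have "?F x = 0" using v by (simp add: henon_density_def disc_density_def)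
    then show ?thesis by simp
  qed
  have F'_bound: "norm (?F' x) \<le> (\<alpha> + p) * C * \<bar>v x\<bar> powr (p - 1)" for x
  proof (cases "x \<in> ball 0 1 - {0}")
    case True
    then have x: "x \<noteq> 0" "norm x < 1" by auto
    have w: "norm x powr \<alpha> \<le> 1" using x \<alpha> powr_mono2[of \<alpha> "norm x" 1] by simp
    have "\<bar>signed_pow p (v x)\<bar> * (\<alpha> * norm x powr (\<alpha> - 1)) = \<bar>v x\<bar> powr (p - 1) * (\<bar>v x\<bar> * (\<alpha> * norm x powr (\<alpha> - 1)))"
      by (simp add: signed_pow_def abs_mult)
    also have "\<dots> \<le> \<bar>v x\<bar> powr (p - 1) * (C * norm x * (\<alpha> * norm x powr (\<alpha> - 1)))"
      using decay[of 0 x] \<alpha> by (intro mult_left_mono mult_right_mono) auto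
    also have "C * norm x * (\<alpha> * norm x powr (\<alpha> - 1)) = C * \<alpha> * norm x powr \<alpha>"
      using abs_powr_mult_self[of "norm x" "\<alpha> - 1"] by (simp add: mult_ac)
    also have "\<bar>v x\<bar> powr (p - 1) * \<dots> \<le> \<bar>v x\<bar> powr (p - 1) * (C * \<alpha> * 1)"
      using w C \<alpha> by (intro mult_left_mono) auto
    finally have 1: "norm ((signed_pow p (v x) * (\<alpha> * norm x powr (\<alpha> - 1))) *\<^sub>R sgn x) \<le> \<bar>v x\<bar> powr (p - 1) * (C * \<alpha>)"
      using \<alpha> x by (simp add: abs_mult norm_sgn)
    have "norm x powr \<alpha> * (p * \<bar>v x\<bar> powr (p - 1)) * norm (G x) \<le> 1 * (p * \<bar>v x\<bar> powr (p - 1)) * C"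
      using w p bound[of x] x by (intro mult_mono) auto
    then have 2: "norm ((norm x powr \<alpha> * (p * \<bar>v x\<bar> powr (p - 1))) *\<^sub>R G x) \<le> p * \<bar>v x\<bar> powr (p - 1) * C"
      using p by (simp add: abs_mult)
    have "norm (?F' x) \<le> \<bar>v x\<bar> powr (p - 1) * (C * \<alpha>) + p * \<bar>v x\<bar> powr (p - 1) * C"
      using True norm_triangle_mono[OF 1 2] by (simp add: henon_density_grad_def)
    then show ?thesis by (simp add: algebra_simps)
  next
    case False
    then have "?F' x = 0" by (simp only: henon_density_grad_def if_False)
    then show ?thesis using C \<alpha> p by simp
  qed
  have deriv: "(?F has_derivative (\<lambda>h. ?F' z \<bullet> h)) (at z)" for z
  proof (cases "z \<in> ball 0 1 - {0}")
    case True
    have dv: "(v has_derivative (\<lambda>h. G z \<bullet> h)) (at z)" using der True by simp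
    have dg: "((\<lambda>x. signed_pow p (v x)) has_derivative (\<lambda>h. (G z \<bullet> h) * (p * \<bar>v z\<bar> powr (p - 1)))) (at z)"
      by (rule DERIV_compose_FDERIV[OF DERIV_signed_pow[OF p] dv])
    have dw: "(henon_weight \<alpha> has_derivative (\<lambda>h. (\<alpha> * norm z powr (\<alpha> - 1)) * (sgn z \<bullet> h))) (at z)"
      using True by (intro has_derivative_henon_weight) simp
    have "((\<lambda>x. henon_weight \<alpha> x * signed_pow p (v x)) has_derivative (\<lambda>h. ?F' z \<bullet> h)) (at z)"
      by (rule has_derivative_eq_rhs[OF has_derivative_mult[OF dw dg]])
        (use True in \<open>auto simp: fun_eq_iff henon_density_grad_def henon_weight_powr inner_add_left algebra_simps\<close>)
    then show ?thesis by (simp add: henon_density_def[abs_def])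
  next
    case False
    then have z: "z = 0 \<or> z \<notin> ball 0 1" by auto
    have Fz: "?F z = 0" using F_bound[OF z, of z] p by simp
    have F'z: "?F' z = 0" using False by (simp only: henon_density_grad_def if_False)
    have "((\<lambda>h. norm (?F (z + h) - ?F z) / norm h) \<longlongrightarrow> 0) (at 0)"
    proof (rule Lim_null_comparison)
      have "continuous_on UNIV (\<lambda>h::real^2. C powr p * norm h powr (p - 1))"
        using p by (intro continuous_intros continuous_on_powr') auto
      then have "((\<lambda>h::real^2. C powr p * norm h powr (p - 1)) \<longlongrightarrow> C powr p * norm (0::real^2) powr (p - 1)) (at 0)"
        unfolding continuous_on_def by blast
      then show "((\<lambda>h::real^2. C powr p * norm h powr (p - 1)) \<longlongrightarrow> 0) (at 0)" by simp
      have "\<bar>?F (z + h)\<bar> / norm h \<le> C powr p * norm h powr (p - 1)" if "h \<noteq> 0" for h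
      proof -
        have "\<bar>?F (z + h)\<bar> \<le> C powr p * norm h powr p" using F_bound[OF z, of "z + h"] by simp
        also have "norm h powr p = norm h powr (p - 1) * norm h" using abs_powr_mult_self[of "norm h" "p - 1"] by simp
        finally show ?thesis using that by (simp add: divide_le_eq mult.assoc)
      qed
      then show "\<forall>\<^sub>F h in at 0. norm (norm (?F (z + h) - ?F z) / norm h) \<le> C powr p * norm h powr (p - 1)"
        by (auto simp: eventually_at_filter Fz)
    qed
    then show ?thesis by (simp add: has_derivative_at F'z bounded_linear_zero)
  qed
  have "isCont ?F' z" for z
  proof (cases "z \<in> ball 0 1 - {0}")
    case True
    have op: "open (ball 0 1 - {0::real^2})" by (intro open_Diff) auto
    have "continuous_on (ball 0 1 - {0}) (\<lambda>x. (signed_pow p (v x) * (\<alpha> * norm x powr (\<alpha> - 1))) *\<^sub>R sgn x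
        + (norm x powr \<alpha> * (p * \<bar>v x\<bar> powr (p - 1))) *\<^sub>R G x)"
      using p by (intro continuous_intros continuous_on_compose2[OF continuous_signed_pow[OF p]]
          continuous_on_powr' continuous_on_subset[OF vc] continuous_on_subset[OF cont]) auto
    then have "continuous_on (ball 0 1 - {0}) ?F'"
      by (rule continuous_on_eq) (simp add: henon_density_grad_def)
    then show ?thesis using True op continuous_on_eq_continuous_at by blast
  next
    case False
    then have z: "z = 0 \<or> z \<notin> ball 0 1" by auto
    have F'z: "?F' z = 0" using False by (simp only: henon_density_grad_def if_False)
    have vz: "v z = 0" using decay[OF z, of z] by simp
    have "continuous_on UNIV (\<lambda>x. (\<alpha> + p) * C * \<bar>v x\<bar> powr (p - 1))"
      using p vc by (intro continuous_intros continuous_on_powr') auto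
    then have "((\<lambda>x. (\<alpha> + p) * C * \<bar>v x\<bar> powr (p - 1)) \<longlongrightarrow> (\<alpha> + p) * C * \<bar>v z\<bar> powr (p - 1)) (at z)"
      unfolding continuous_on_def by blast
    then have "((\<lambda>x. (\<alpha> + p) * C * \<bar>v x\<bar> powr (p - 1)) \<longlongrightarrow> 0) (at z)" by (simp add: vz)
    then have "(?F' \<longlongrightarrow> 0) (at z)"
      by (rule Lim_null_comparison[rotated]) (use F'_bound in auto)
    then show ?thesis by (simp add: isCont_def F'z)
  qed
  then have "continuous_on UNIV ?F'" by (simp add: continuous_at_imp_continuous_on)
  then show ?thesis
    using disc_density_henon[OF \<alpha> p v(1)] deriv by (simp add: disc_density_C1_def henon_density_grad_def)
qed

section \<open>From eigenpairs to solutions\<close>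

text \<open>Each pure second derivative is nonpositive: otherwise the first derivative, zero at the maximum, would be positive just to the right
  and the function would increase.\<close>

lemma laplacian_le_0_at_max:
  fixes u :: "real^'n::finite \<Rightarrow> real"
  assumes S: "open S" "x0 \<in> S" and u: "C2_on S u" and max: "\<And>x. x \<in> S \<Longrightarrow> u x \<le> u x0"
  shows "laplacian u x0 \<le> 0"
proof -
  obtain r where r: "r > 0" "ball x0 r \<subseteq> S" using S open_contains_ball by blast
  have "partial_deriv i (partial_deriv i u) x0 \<le> 0" for i
  proof (rule ccontr)
    assume neg: "\<not> partial_deriv i (partial_deriv i u) x0 \<le> 0"
    define l where "l s = x0 + s *\<^sub>R (axis i 1 :: real^'n)" for s
    have lS: "l s \<in> S" if "\<bar>s\<bar> < r" for s
      using r that by (auto simp: l_def dist_norm subset_eq)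
    have slice: "((\<lambda>s. w (l s)) has_real_derivative partial_deriv i w (l s)) (at s)"
      if w: "w differentiable_on S" and s: "\<bar>s\<bar> < r" for w s
    proof -
      have "w differentiable (at (l s))"
        using w lS[OF s] S(1) by (simp add: differentiable_on_eq_differentiable_at)
      then have dw: "(w has_derivative frechet_derivative w (at (l s))) (at (l s))"
        by (simp add: frechet_derivative_works)
      have "(l has_derivative (\<lambda>t. t *\<^sub>R axis i 1)) (at s)"
        unfolding l_def by (auto intro!: derivative_eq_intros)
      from has_derivative_compose[OF this dw]
      have "((\<lambda>s. w (l s)) has_derivative (\<lambda>t. frechet_derivative w (at (l s)) (t *\<^sub>R axis i 1))) (at s)" .
      also have "(\<lambda>t. frechet_derivative w (at (l s)) (t *\<^sub>R axis i 1)) = (\<lambda>t. partial_deriv i w (l s) * t)"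
        using linear_frechet_derivative[OF \<open>w differentiable (at (l s))\<close>]
        by (simp add: partial_deriv_def linear_cmul mult.commute fun_eq_iff)
      finally show ?thesis by (simp add: has_field_derivative_def)
    qed
    have d1: "((\<lambda>s. u (l s)) has_real_derivative partial_deriv i u (l s)) (at s)" if "\<bar>s\<bar> < r" for s
      using u that by (intro slice) (auto simp: C2_on_def)
    have d2: "((\<lambda>s. partial_deriv i u (l s)) has_real_derivative partial_deriv i (partial_deriv i u) (l 0)) (at 0)"
      using u r by (intro slice) (auto simp: C2_on_def)
    have l0: "l 0 = x0" by (simp add: l_def)
    have z: "partial_deriv i u (l 0) = 0"
    proof (rule DERIV_local_max[OF d1[of 0] r(1)])
      show "\<forall>y. \<bar>0 - y\<bar> < r \<longrightarrow> u (l y) \<le> u (l 0)" using max lS l0 by simp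
    qed (use r in simp)
    have "partial_deriv i (partial_deriv i u) (l 0) > 0" using neg l0 by simp
    from DERIV_pos_inc_right[OF d2 this]
    obtain d where d: "d > 0" "\<And>h. 0 < h \<Longrightarrow> h < d \<Longrightarrow> partial_deriv i u (l 0) < partial_deriv i u (l h)" by auto
    define h where "h = min d r / 2"
    have h: "0 < h" "h < d" "h < r" using d(1) r(1) by (auto simp: h_def)
    obtain \<xi> where \<xi>: "0 < \<xi>" "\<xi> < h" "u (l h) - u (l 0) = (h - 0) * partial_deriv i u (l \<xi>)"
      using MVT2[OF h(1), of "\<lambda>s. u (l s)" "\<lambda>s. partial_deriv i u (l s)"] d1 h by force
    have "partial_deriv i u (l \<xi>) > 0" using d(2)[of \<xi>] \<xi> h z by simp
    then have "(h - 0) * partial_deriv i u (l \<xi>) > 0" using h by simp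
    moreover have "u (l h) \<le> u (l 0)" using max[OF lS[of h]] h l0 by simp
    ultimately show False using \<xi>(3) by simp
  qed
  then show ?thesis unfolding laplacian_def by (intro sum_nonpos) auto
qed

lemma disc_density_C1_cmult:
  "disc_density_C1 F F' \<Longrightarrow> disc_density_C1 (\<lambda>x. c * F x) (\<lambda>x. c *\<^sub>R F' x)"
  unfolding disc_density_C1_def
  by (auto intro!: disc_density_cmult continuous_intros derivative_eq_intros)

lemma disc_density_C1_diff:
  assumes "disc_density_C1 F F'" "disc_density_C1 H H'"
  shows "disc_density_C1 (\<lambda>x. F x - H x) (\<lambda>x. F' x - H' x)"
proof -
  have "((\<lambda>x. F x - H x) has_derivative (\<lambda>h. (F' x - H' x) \<bullet> h)) (at x)" for x
    using assms unfolding inner_diff_left disc_density_C1_def by (intro has_derivative_diff) auto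
  then show ?thesis
    using assms by (auto simp: disc_density_C1_def intro!: disc_density_diff continuous_intros)
qed

lemma green_op_diff:
  assumes "disc_density F" "disc_density H"
  shows "green_op (\<lambda>x. F x - H x) x = green_op F x - green_op H x"
  using green_integrable[OF assms(1), of x] green_integrable[OF assms(2), of x]
  by (simp add: green_op_def green_def right_diff_distrib)

context henon_class
begin

text \<open>One application of the Green operator to a continuous density makes the nonlinear density continuously differentiable, which is what
  \<open>green_op_C2\<close> asks for.\<close>

lemma dens_C1:
  assumes v: "v \<in> X" and F: "disc_density F" and eq: "v = green_op F"
  obtains F' where "disc_density_C1 (dens v) F'"
proof -
  obtain C where "\<And>x. x \<in> ball 0 1 \<Longrightarrow> norm (green_grad F x) \<le> C"
    using green_grad_bounded[OF F] by metis
  from disc_density_C1_henon[OF \<alpha> p X_disc[OF v] X_zero[OF v] _ this green_grad_continuous[OF F]]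
  show ?thesis using that green_op_has_derivative[OF F] unfolding eq by blast
qed

text \<open>If \<open>T v\<close> were zero, so would be its Laplacian, which is a multiple of the density of \<open>v\<close>. The variational problem thus has a
  positive maximum.\<close>

lemma T_not_identically_zero:
  assumes v: "v \<in> X" and der: "\<And>x. x \<in> ball 0 1 \<Longrightarrow> (v has_derivative (\<lambda>h. G x \<bullet> h)) (at x)"
    and bound: "\<And>x. x \<in> ball 0 1 \<Longrightarrow> norm (G x) \<le> C" and cont: "continuous_on (ball 0 1) G"
    and x1: "v x1 \<noteq> 0"
  shows "\<exists>x0. T v x0 \<noteq> 0"
proof (rule ccontr)
  assume "\<not> (\<exists>x0. T v x0 \<noteq> 0)"
  then have zero: "green_op (dens v) = (\<lambda>x. 0)" by (simp add: T_def fun_eq_iff)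
  have x1': "x1 \<in> ball 0 1" "x1 \<noteq> 0" using x1 X_disc[OF v] X_zero[OF v] by (auto simp: disc_density_def)
  have "disc_density_C1 (dens v) (henon_density_grad \<alpha> p v G)"
    by (rule disc_density_C1_henon[OF \<alpha> p X_disc[OF v] X_zero[OF v] der bound cont])
  from green_op_C2(2)[OF this x1'(1)]
  have "laplacian (\<lambda>x::real^2. 0) x1 = - laplace_const * dens v x1" by (simp add: zero)
  moreover have "partial_deriv i (\<lambda>x::real^2. 0) = (\<lambda>x. 0)" for i
    by (simp add: partial_deriv_def fun_eq_iff)
  then have "laplacian (\<lambda>x::real^2. 0) x1 = 0" by (simp add: laplacian_def)
  ultimately have "dens v x1 = 0" using laplace_const_pos by simp
  moreover have "signed_pow p (v x1) \<noteq> 0" using x1 by (simp add: signed_pow_def)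
  ultimately show False using henon_weight_pos[OF x1'(2), of \<alpha>] by (simp add: henon_density_def)
qed

text \<open>A maximum principle. Let \<open>u - v\<close> have a positive maximum; it lies inside the disc and not at the origin. The Laplacian of \<open>u - v\<close>
  there is a positive multiple of the difference of the densities of \<open>u\<close> and \<open>v\<close>, hence positive, because the equations are crossed: the density
  of \<open>v\<close> generates \<open>u\<close> and conversely.\<close>

lemma eigenpair_le:
  assumes uv: "u \<in> X" "v \<in> X" and m: "m > 0"
    and Tu: "\<And>x. T u x = m * v x" and Tv: "\<And>x. T v x = m * u x"
  shows "u x \<le> v x"
proof (rule ccontr)
  assume "\<not> u x \<le> v x"
  then have pos: "u x - v x > 0" by simp
  let ?Fv = "\<lambda>x. inverse m * dens v x" and ?Fu = "\<lambda>x. inverse m * dens u x"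
  have u_eq: "u = green_op ?Fv"
    using Tv m unfolding T_def by (auto simp: fun_eq_iff green_op_cmult)
  have v_eq: "v = green_op ?Fu"
    using Tu m unfolding T_def by (auto simp: fun_eq_iff green_op_cmult)
  have dFv: "disc_density ?Fv" and dFu: "disc_density ?Fu" by (intro disc_density_cmult X_dens uv)+
  obtain A where A: "disc_density_C1 (dens v) A" using dens_C1[OF uv(2) dFu v_eq] .
  obtain B where B: "disc_density_C1 (dens u) B" using dens_C1[OF uv(1) dFv u_eq] .
  have C1: "disc_density_C1 (\<lambda>x. ?Fv x - ?Fu x) (\<lambda>x. inverse m *\<^sub>R A x - inverse m *\<^sub>R B x)"
    by (intro disc_density_C1_diff disc_density_C1_cmult A B)
  let ?\<phi> = "green_op (\<lambda>x. ?Fv x - ?Fu x)"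
  have \<phi>: "?\<phi> x = u x - v x" for x
    unfolding green_op_diff[OF dFv dFu] u_eq[symmetric] v_eq[symmetric] ..
  have "continuous_on (cball 0 1) (\<lambda>x. u x - v x)"
    using uv X_disc by (intro continuous_on_diff) (auto simp: disc_density_def intro: continuous_on_subset)
  then obtain x0 where x0: "x0 \<in> cball 0 1" "\<And>y. y \<in> cball 0 1 \<Longrightarrow> u y - v y \<le> u x0 - v x0"
    using continuous_attains_sup[OF compact_cball, of "0::real^2" 1] by force
  have in_ball: "y \<in> ball 0 1" if "u y - v y > 0" for y
  proof (rule ccontr)
    assume "y \<notin> ball 0 1"
    then have "u y = 0" "v y = 0" using X_disc[OF uv(1)] X_disc[OF uv(2)] by (auto simp: disc_density_def)
    then show False using that by simp
  qed
  have x: "x \<in> cball 0 1" using in_ball[OF pos] by simp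
  have pos0: "u x0 - v x0 > 0" using x0(2)[OF x] pos by simp
  have ball: "x0 \<in> ball 0 1" by (rule in_ball[OF pos0])
  have nz: "x0 \<noteq> 0" using pos0 X_zero[OF uv(1)] X_zero[OF uv(2)] by auto
  have "laplacian ?\<phi> x0 \<le> 0"
    by (rule laplacian_le_0_at_max[OF open_ball ball green_op_C2(1)[OF C1]]) (use x0(2) in \<open>auto simp: \<phi>\<close>)
  then have "0 \<le> laplace_const * (inverse m * dens v x0 - inverse m * dens u x0)"
    by (simp add: green_op_C2(2)[OF C1 ball])
  then have "0 \<le> inverse m * (dens v x0 - dens u x0)"
    using laplace_const_pos by (simp add: zero_le_mult_iff right_diff_distrib)
  then have "dens u x0 \<le> dens v x0" using m by (simp add: zero_le_mult_iff)
  moreover have "signed_pow p (v x0) < signed_pow p (u x0)"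
    using pos0 by (intro signed_pow_strict_mono p) simp
  ultimately show False using henon_weight_pos[OF nz, of \<alpha>] by (simp add: henon_density_def)
qed

text \<open>The two eigenfunctions coincide, and since the equation is homogeneous of degree \<open>p\<close> on one side and 1 on the other, a multiple of
  the eigenfunction solves it with the right constant. The function \<open>v0\<close> witnesses that the class is nontrivial.\<close>

theorem antisymmetric_solution:
  assumes v0: "v0 \<in> X" and der: "\<And>x. x \<in> ball 0 1 \<Longrightarrow> (v0 has_derivative (\<lambda>h. G x \<bullet> h)) (at x)"
    and bound: "\<And>x. x \<in> ball 0 1 \<Longrightarrow> norm (G x) \<le> C" and cont: "continuous_on (ball 0 1) G"
    and x1: "v0 x1 \<noteq> 0"
  obtains w x where "henon_solution \<alpha> p w" "\<And>x. w (R x) = - w x" "x \<in> ball 0 1" "w x \<noteq> 0"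
proof -
  obtain x0 where "T v0 x0 \<noteq> 0" using T_not_identically_zero[OF v0 der bound cont x1] by blast
  from eigenpair[OF v0 this]
  obtain u v m where uv: "u \<in> X" "v \<in> X" "E u = 1" "m > 0"
    "\<And>x. T u x = m * v x" "\<And>x. T v x = m * u x" by metis
  have "u = v"
    using eigenpair_le[OF uv(1,2,4,5,6)] eigenpair_le[OF uv(2,1,4,6,5)] by (auto intro: antisym)
  then have Tu: "T u x = m * u x" for x using uv(5) by simp
  (* The eigenfunction satisfies the equation with the factor \<kappa> on the right; multiplying it by c changes the factor by c powr (1 - p). *)
  define \<kappa> where "\<kappa> = laplace_const / m"
  have \<kappa>: "\<kappa> > 0" using laplace_const_pos uv(4) by (simp add: \<kappa>_def)
  define c where "c = \<kappa> powr (1 / (p - 1))"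
  have c: "c > 0" using \<kappa> by (simp add: c_def)
  have cp: "c powr p = \<kappa> * c"
  proof -
    have "c powr (p - 1) = \<kappa>" using \<kappa> p by (simp add: c_def powr_powr)
    moreover have "c powr p = c powr (p - 1) * c" using abs_powr_mult_self[of c "p - 1"] c by simp
    ultimately show ?thesis by simp
  qed
  let ?w = "\<lambda>x. c * u x" and ?F = "\<lambda>x. (c / m) * dens u x"
  have u_eq: "u = green_op (\<lambda>x. inverse m * dens u x)"
    using Tu uv(4) unfolding T_def by (auto simp: fun_eq_iff green_op_cmult)
  have w_eq: "?w = green_op ?F"
  proof
    fix x
    have "green_op ?F x = (c / m) * T u x" unfolding T_def by (rule green_op_cmult)
    then show "?w x = green_op ?F x" using Tu uv(4) by simp
  qed
  obtain A where A: "disc_density_C1 (dens u) A"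
    using dens_C1[OF uv(1) disc_density_cmult[OF X_dens[OF uv(1)]] u_eq] .
  have C1: "disc_density_C1 ?F (\<lambda>x. (c / m) *\<^sub>R A x)" by (rule disc_density_C1_cmult[OF A])
  have wX: "?w \<in> X" by (rule X_scale[OF uv(1)])
  have "henon_solution \<alpha> p ?w"
    unfolding henon_solution_def
  proof (intro conjI ballI)
    show "C2_on (ball 0 1) ?w" unfolding w_eq by (rule green_op_C2(1)[OF C1])
    show "continuous_on (cball 0 1) ?w"
      using X_disc[OF wX] by (auto simp: disc_density_def intro: continuous_on_subset)
    fix x :: "real^2" assume x: "x \<in> ball 0 1"
    have "- laplacian ?w x = laplace_const * ((c / m) * dens u x)"
      unfolding w_eq green_op_C2(2)[OF C1 x] by simp
    also have "\<dots> = c powr p * dens u x" unfolding cp by (simp add: \<kappa>_def)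
    also have "\<dots> = dens ?w x" using c by (simp add: henon_density_scale)
    finally show "- laplacian ?w x = henon_weight \<alpha> x * \<bar>?w x\<bar> powr (p - 1) * ?w x"
      by (simp add: henon_density_def signed_pow_def mult.assoc)
  next
    fix x :: "real^2" assume "x \<in> sphere 0 1"
    then show "?w x = 0" using X_disc[OF uv(1)] by (simp add: disc_density_def)
  qed
  moreover have "?w (R x) = - ?w x" for x using wX by (simp add: X_def)
  moreover obtain x where "u x \<noteq> 0"
  proof (rule ccontr)
    assume "\<not> thesis"
    then have "u = (\<lambda>x. 0)" using that by blast
    then show False using uv(3) by (simp add: henon_energy_def)
  qed
  moreover from this have "x \<in> ball 0 1" using X_disc[OF uv(1)] by (auto simp: disc_density_def)
  ultimately show ?thesis using that[of ?w x] c by simp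
qed

end

section \<open>Rotations, reflections and distinctness\<close>

definition plane_rot :: "real \<Rightarrow> real^2 \<Rightarrow> real^2" where
  "plane_rot t x = vector [cos t * x$1 - sin t * x$2, sin t * x$1 + cos t * x$2]"

definition to_complex :: "real^2 \<Rightarrow> complex" where
  "to_complex x = Complex (x$1) (x$2)"

lemma plane_rot_nth[simp]:
  "plane_rot t x $ 1 = cos t * x$1 - sin t * x$2"
  "plane_rot t x $ 2 = sin t * x$1 + cos t * x$2"
  by (simp_all add: plane_rot_def)

lemma vec2_eqI: "x $ 1 = y $ 1 \<Longrightarrow> x $ 2 = y $ 2 \<Longrightarrow> x = y" for x y :: "'a^2"
  by (simp add: vec_eq_iff forall_2)

lemma inner_vec2: "x \<bullet> y = x$1 * y$1 + x$2 * y$2" for x y :: "real^2"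
  by (simp add: inner_vec_def sum_2)

lemma plane_rot_add: "plane_rot (s + t) x = plane_rot s (plane_rot t x)"
  by (rule vec2_eqI) (simp_all add: cos_add sin_add algebra_simps)

lemma plane_rot_0[simp]: "plane_rot 0 x = x"
  by (rule vec2_eqI) simp_all

lemma orthogonal_plane_rot: "orthogonal_transformation (plane_rot t)"
  unfolding orthogonal_transformation_def
proof (intro conjI allI)
  show "linear (plane_rot t)"
    by (rule linearI; rule vec2_eqI) (simp_all add: algebra_simps)
  fix v w :: "real^2"
  have "(c * a - s * b) * (c * a' - s * b') + (s * a + c * b) * (s * a' + c * b') = (s\<^sup>2 + c\<^sup>2) * (a * a' + b * b')"
    for c s a b a' b' :: real by (simp add: power2_eq_square algebra_simps)
  then have "plane_rot t v \<bullet> plane_rot t w = ((sin t)\<^sup>2 + (cos t)\<^sup>2) * (v \<bullet> w)"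
    by (simp only: inner_vec2 plane_rot_nth)
  then show "plane_rot t v \<bullet> plane_rot t w = v \<bullet> w" by simp
qed

lemma norm_plane_rot[simp]: "norm (plane_rot t x) = norm x"
  by (rule orthogonal_transformation_norm[OF orthogonal_plane_rot])

lemma to_complex_plane_rot: "to_complex (plane_rot t x) = cis t * to_complex x"
  by (simp add: to_complex_def complex_eq_iff)

lemma bounded_linear_to_complex: "bounded_linear to_complex"
proof -
  have "linear to_complex"
    by (rule linearI) (simp_all add: to_complex_def complex_eq_iff)
  then show ?thesis by (rule linear_conv_bounded_linear[THEN iffD1])
qed

lemma continuous_to_complex: "continuous_on A to_complex"
  by (rule linear_continuous_on[OF bounded_linear_to_complex])


text \<open>A nonzero member of the class for the rotation by \<open>pi / n\<close>: the harmonic polynomial \<open>Re (z ^ n)\<close> changes sign under this rotation,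
  and the factor makes it vanish on and outside the circle.\<close>

definition seed :: "nat \<Rightarrow> real^2 \<Rightarrow> real" where
  "seed n x = Re (to_complex x ^ n) * max 0 (1 - x \<bullet> x)"

definition seed_grad :: "nat \<Rightarrow> real^2 \<Rightarrow> real^2" where
  "seed_grad n x = (1 - x \<bullet> x) *\<^sub>R vector [Re (of_nat n * to_complex x ^ (n - 1)), - Im (of_nat n * to_complex x ^ (n - 1))]
     - (2 * Re (to_complex x ^ n)) *\<^sub>R x"

lemma disc_density_seed: "disc_density (seed n)"
proof -
  have "continuous_on UNIV (seed n)"
    unfolding seed_def by (intro continuous_intros continuous_to_complex)
  moreover have "seed n y = 0" if "y \<notin> ball 0 1" for y
  proof -
    have "1 \<le> (norm y)\<^sup>2" using that by (simp add: one_le_power)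
    then show ?thesis by (simp add: seed_def dot_square_norm)
  qed
  ultimately show ?thesis by (simp add: disc_density_def)
qed

lemma seed_antisymmetric:
  assumes "n \<ge> 1" shows "seed n (plane_rot (pi / n) x) = - seed n x"
proof -
  have "cis (pi / n) ^ n = -1" by (subst Complex.DeMoivre) (use assms in simp)
  then have "to_complex (plane_rot (pi / n) x) ^ n = - (to_complex x ^ n)"
    by (simp add: to_complex_plane_rot power_mult_distrib)
  moreover have "plane_rot (pi / n) x \<bullet> plane_rot (pi / n) x = x \<bullet> x"
    using orthogonal_plane_rot[of "pi / n"] by (simp add: orthogonal_transformation_def)
  ultimately show ?thesis by (simp add: seed_def)
qed

lemma seed_has_derivative:
  assumes x: "x \<in> ball 0 1"
  shows "(seed n has_derivative (\<lambda>h. seed_grad n x \<bullet> h)) (at x)"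
proof -
  have d1: "((\<lambda>x. to_complex x ^ n) has_derivative (\<lambda>h. of_nat n * to_complex x ^ (n - 1) * to_complex h)) (at x)"
    by (rule has_derivative_eq_rhs[OF has_derivative_power[OF bounded_linear.has_derivative[OF bounded_linear_to_complex has_derivative_ident]]])
      (simp add: fun_eq_iff mult_ac)
  have d2: "((\<lambda>x. Re (to_complex x ^ n)) has_derivative (\<lambda>h. Re (of_nat n * to_complex x ^ (n - 1) * to_complex h))) (at x)"
    by (rule bounded_linear.has_derivative[OF bounded_linear_Re d1])
  have d3: "((\<lambda>x. 1 - x \<bullet> x) has_derivative (\<lambda>h. - 2 * (x \<bullet> h))) (at x)"
    by (auto intro!: derivative_eq_intros simp: inner_commute)
  have "((\<lambda>x. Re (to_complex x ^ n) * (1 - x \<bullet> x)) has_derivative (\<lambda>h. seed_grad n x \<bullet> h)) (at x)"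
    by (rule has_derivative_eq_rhs[OF has_derivative_mult[OF d2 d3]])
      (simp add: fun_eq_iff seed_grad_def inner_vec2[of "vector _"] inner_diff_left to_complex_def algebra_simps)
  then show ?thesis
  proof (rule has_derivative_transform_within_open[OF _ open_ball x])
    fix y :: "real^2" assume "y \<in> ball 0 1"
    then have "y \<bullet> y \<le> 1" by (simp add: dot_square_norm power_le_one)
    then show "Re (to_complex y ^ n) * (1 - y \<bullet> y) = seed n y" by (simp add: seed_def)
  qed
qed

lemma continuous_seed_grad: "continuous_on A (seed_grad n)"
proof -
  have v: "continuous_on A (\<lambda>x. vector [f x, g x] :: real^2)" if "continuous_on A f" "continuous_on A g" for f g :: "real^2 \<Rightarrow> real"
  proof -
    have "(\<lambda>x. vector [f x, g x] :: real^2) = (\<lambda>x. f x *\<^sub>R axis 1 1 + g x *\<^sub>R axis 2 1)"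
      by (intro ext vec2_eqI) (simp_all add: axis_def)
    show ?thesis unfolding \<open>(\<lambda>x. vector [f x, g x] :: real^2) = _\<close> by (intro continuous_intros that)
  qed
  show ?thesis unfolding seed_grad_def
    by (intro continuous_intros v continuous_to_complex)
qed

lemma seed_nonzero: "seed n (vector [1/2, 0]) \<noteq> 0"
proof -
  have "to_complex (vector [1/2, 0]) = of_real (1/2)"
    by (simp add: to_complex_def complex_eq_iff)
  then have "Re (to_complex (vector [1/2, 0]) ^ n) = (1/2) ^ n"
    by (metis Re_complex_of_real of_real_power)
  moreover have "(vector [1/2, 0] :: real^2) \<bullet> vector [1/2, 0] = 1/4" by (simp add: inner_vec2)
  ultimately show ?thesis by (simp add: seed_def)
qed

lemma rotation_antisymmetric_solution:
  assumes "\<alpha> \<ge> 0" "p > 1" "n \<ge> (1::nat)"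
  shows "\<exists>u. henon_solution \<alpha> p u \<and> (\<forall>x. u (plane_rot (pi / n) x) = - u x) \<and> (\<exists>x\<in>ball 0 1. u x \<noteq> 0)"
proof -
  interpret henon_class \<alpha> p "plane_rot (pi / n)"
    by unfold_locales (use assms orthogonal_plane_rot in auto)
  have X: "seed n \<in> X"
    using disc_density_seed seed_antisymmetric[OF assms(3)] by (simp add: X_def)
  have "compact (seed_grad n ` cball 0 1)"
    by (intro compact_continuous_image continuous_seed_grad) simp
  then obtain C where C: "\<And>x. x \<in> cball 0 1 \<Longrightarrow> norm (seed_grad n x) \<le> C"
    by (meson bounded_iff compact_imp_bounded image_eqI)
  obtain w x where "henon_solution \<alpha> p w" "\<And>x. w (plane_rot (pi / n) x) = - w x" "x \<in> ball 0 1" "w x \<noteq> 0"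
    by (rule antisymmetric_solution[OF X seed_has_derivative _ continuous_seed_grad seed_nonzero, of C]) (use C in auto)
  then show ?thesis by blast
qed

text \<open>The entries \<open>a, b; c, d\<close> of a rotation matrix satisfy \<open>(a - d)\<^sup>2 + (b + c)\<^sup>2 = 0\<close>, because this is the sum of the squared column lengths
  minus twice the determinant.\<close>

lemma plane_rotation_commutes:
  assumes "plane_rotation T"
  shows "T (plane_rot t x) = plane_rot t (T x)" "norm (T x) = norm x"
proof -
  obtain Q :: "real^2^2" where Q: "orthogonal_matrix Q" "det Q = 1" "T = (\<lambda>x. Q *v x)"
    using assms by (auto simp: plane_rotation_def rotation_matrix_def)
  have "transpose Q ** Q = mat 1" using Q(1) by (simp add: orthogonal_matrix_def)
  then have e: "(transpose Q ** Q) $ i $ j = (if i = j then 1 else 0)" for i j by (simp add: mat_def)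
  have e1: "Q$1$1 * Q$1$1 + Q$2$1 * Q$2$1 = 1" and e2: "Q$1$2 * Q$1$2 + Q$2$2 * Q$2$2 = 1"
    using e[of 1 1] e[of 2 2] by (simp_all add: matrix_matrix_mult_def transpose_def sum_2)
  have d: "Q$1$1 * Q$2$2 - Q$1$2 * Q$2$1 = 1" using Q(2) by (simp add: det_2)
  have "(Q$1$1 - Q$2$2)\<^sup>2 + (Q$1$2 + Q$2$1)\<^sup>2 = 0"
    using e1 e2 d by (simp add: power2_eq_square algebra_simps)
  then have *: "Q$2$2 = Q$1$1" "Q$2$1 = - Q$1$2" by (simp_all add: sum_power2_eq_zero_iff)
  have Qx: "Q *v y = vector [Q$1$1 * y$1 + Q$1$2 * y$2, - Q$1$2 * y$1 + Q$1$1 * y$2]" for y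
    by (rule vec2_eqI) (simp_all add: matrix_vector_mult_def sum_2 *)
  show "T (plane_rot t x) = plane_rot t (T x)"
    unfolding Q(3) Qx by (rule vec2_eqI) (simp_all add: algebra_simps)
  show "norm (T x) = norm x"
  proof -
    have "orthogonal_transformation ((*v) Q)"
      using Q(1) by (simp add: orthogonal_transformation_matrix)
    then show ?thesis unfolding Q(3) by (rule orthogonal_transformation_norm)
  qed
qed

text \<open>In coordinates a reflection is \<open>(y, z) \<mapsto> (a y + b z, b y - a z)\<close>. It conjugates each rotation into the inverse rotation.\<close>

lemma plane_reflection_commutes:
  assumes "plane_reflection T"
  shows "T (plane_rot t x) = plane_rot (- t) (T x)" "norm (T x) = norm x"
proof -
  obtain e :: "real^2" where e: "norm e = 1" "T = (\<lambda>x. (2 * (x \<bullet> e)) *\<^sub>R e - x)"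
    using assms by (auto simp: plane_reflection_def)
  have ee: "e \<bullet> e = 1" using e(1) by (simp add: dot_square_norm)
  then have e2: "e$2 * e$2 = 1 - e$1 * e$1" by (simp add: inner_vec2)
  define a b where "a = 2 * (e$1 * e$1) - 1" and "b = 2 * (e$1 * e$2)"
  have Tx: "T y = vector [a * y$1 + b * y$2, b * y$1 - a * y$2]" for y
    unfolding e(2)
  proof (rule vec2_eqI)
    show "((2 * (y \<bullet> e)) *\<^sub>R e - y) $ 1 = (vector [a * y$1 + b * y$2, b * y$1 - a * y$2] :: real^2) $ 1"
      by (simp add: inner_vec2 a_def b_def algebra_simps)
    have "((2 * (y \<bullet> e)) *\<^sub>R e - y) $ 2 = 2 * (y$1 * (e$1 * e$2)) + 2 * y$2 * (e$2 * e$2) - y$2"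
      by (simp add: inner_vec2 algebra_simps)
    then show "((2 * (y \<bullet> e)) *\<^sub>R e - y) $ 2 = (vector [a * y$1 + b * y$2, b * y$1 - a * y$2] :: real^2) $ 2"
      unfolding e2 by (simp add: a_def b_def algebra_simps)
  qed
  show "T (plane_rot t x) = plane_rot (- t) (T x)"
    unfolding Tx by (rule vec2_eqI) (simp_all add: algebra_simps)
  have "T x \<bullet> T x = x \<bullet> x"
    unfolding e(2) inner_diff_left inner_diff_right inner_scaleR_left inner_scaleR_right
    using ee by (simp add: inner_commute algebra_simps)
  then show "norm (T x) = norm x" by (simp add: norm_eq_sqrt_inner)
qed

text \<open>Both properties, changing sign and being invariant under a rotation, survive composition with rotations and reflections and multiplication
  by \<open>-1\<close>, and only the zero function has both.\<close>

lemma essentially_distinctI: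
  assumes u: "\<And>x. u (plane_rot t x) = - u x" and v: "\<And>x. v (plane_rot t x) = v x"
    and nz: "x \<in> cball 0 1" "u x \<noteq> 0" "y \<in> cball 0 1" "v y \<noteq> 0"
  shows "essentially_distinct u v" "essentially_distinct v u"
proof -
  have inv: "plane_rot t (plane_rot (- t) z) = z" for z using plane_rot_add[of t "- t" z] by simp
  have u': "u (plane_rot (- t) z) = - u z" for z using u[of "plane_rot (- t) z"] inv[of z] by simp
  have v': "v (plane_rot (- t) z) = v z" for z using v[of "plane_rot (- t) z"] inv[of z] by simp
  have comm: "(T (plane_rot t z) = plane_rot t (T z) \<or> T (plane_rot t z) = plane_rot (- t) (T z))"
    if "plane_rotation T \<or> plane_reflection T" for T z
    using that plane_rotation_commutes(1) plane_reflection_commutes(1) by blast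
  have rc: "plane_rot t z \<in> cball 0 1" if "z \<in> cball 0 1" for z using that by simp
  have 1: False if T: "plane_rotation T \<or> plane_reflection T" "\<forall>x\<in>cball 0 1. v x = u (T x)" for T
  proof -
    have "v y = u (T (plane_rot t y))" using v[of y] T(2) rc[OF nz(3)] by metis
    also have "\<dots> = - u (T y)" using comm[OF T(1), of y] u u' by metis
    also have "\<dots> = - v y" using T(2) nz(3) by simp
    finally show False using nz(4) by simp
  qed
  have 2: False if T: "plane_rotation T \<or> plane_reflection T" "\<forall>x\<in>cball 0 1. u x = v (T x)" for T
  proof -
    have "- u x = v (T (plane_rot t x))" using u[of x] T(2) rc[OF nz(1)] by metis
    also have "\<dots> = v (T x)" using comm[OF T(1), of x] v v' by metis
    also have "\<dots> = u x" using T(2) nz(1) by simp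
    finally show False using nz(2) by simp
  qed
  have 3: False if "\<forall>x\<in>cball 0 1. v x = - u x"
    using that rc[OF nz(3)] nz(3,4) u[of y] v[of y] by force
  have 4: False if "\<forall>x\<in>cball 0 1. u x = - v x"
    using that 3 by simp
  show "essentially_distinct u v" "essentially_distinct v u"
    unfolding essentially_distinct_def using 1 2 3 4 by blast+
qed

lemma plane_rot_iterate:
  assumes "\<And>x. u (plane_rot t x) = - u x"
  shows "u (plane_rot (real k * t) x) = (-1) ^ k * (u x :: real)"
proof (induction k)
  case (Suc k)
  have "plane_rot (real (Suc k) * t) x = plane_rot t (plane_rot (real k * t) x)"
    using plane_rot_add[of t "real k * t" x] by (simp add: distrib_right add.commute)
  then show ?case using assms Suc by simp
qed simp

section \<open>Many nonradial nodal solutions\<close>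

text \<open>The solutions for the angles \<open>pi / 2 ^ j\<close> are pairwise essentially distinct: for \<open>i < j\<close> the rotation by \<open>pi / 2 ^ i\<close> is an
  even power of the rotation by \<open>pi / 2 ^ j\<close>, so it leaves the \<open>j\<close>-th solution invariant and changes the sign of the \<open>i\<close>-th.\<close>

theorem theorem1p4:
  fixes \<alpha> \<beta> :: real
  assumes "\<alpha> \<ge> 0"
    and "\<beta> > 0" and "bessel_zero 1 \<beta> = bessel_zero 2 0"
  shows "\<exists>pbar>1. \<forall>p. 1 < p \<and> p < pbar \<longrightarrow>
    (\<exists>S :: (real^2 \<Rightarrow> real) set.
       finite S \<and> int (card S) \<ge> \<lceil>(2 + \<alpha>) / 2 * \<beta> - 1\<rceil> \<and>
       (\<forall>u\<in>S. henon_solution \<alpha> p u \<and> nodal u \<and> \<not> radial u) \<and>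
       (\<forall>u\<in>S. \<forall>v\<in>S. u \<noteq> v \<longrightarrow> essentially_distinct u v))"
proof (intro exI[of _ 2] conjI allI impI)
  (* The construction applies to each p > 1, so 2 can serve as the upper end of the interval. *)
  show "(1::real) < 2" by simp
  fix p :: real assume p: "1 < p \<and> p < 2"
  have "\<exists>u. henon_solution \<alpha> p u \<and> (\<forall>x. u (plane_rot (pi / (2 ^ j)) x) = - u x) \<and> (\<exists>x\<in>ball 0 1. u x \<noteq> 0)" for j :: nat
    using rotation_antisymmetric_solution[OF assms(1), of p "2 ^ j"] p by simp
  then obtain U where sol: "\<And>j. henon_solution \<alpha> p (U j)"
    and anti: "\<And>j x. U j (plane_rot (pi / (2 ^ j)) x) = - U j x"
    and nz: "\<And>j. \<exists>x\<in>ball 0 1. U j x \<noteq> 0" by metis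
  have inv: "U j (plane_rot (pi / (2 ^ i)) x) = U j x" if "i < j" for i j :: nat and x
  proof -
    have "pi / 2 ^ i = real (2 ^ (j - i)) * (pi / 2 ^ j)"
      using that by (simp add: field_simps flip: power_add)
    then have "U j (plane_rot (pi / (2 ^ i)) x) = (-1) ^ (2 ^ (j - i)) * U j x"
      using plane_rot_iterate[of "U j", OF anti] by metis
    then show ?thesis using that by simp
  qed
  have dist: "essentially_distinct (U i) (U j)" if ij: "i \<noteq> j" for i j
  proof -
    obtain x y where xy: "x \<in> cball 0 1" "U i x \<noteq> 0" "y \<in> cball 0 1" "U j y \<noteq> 0"
      using nz[of i] nz[of j] ball_subset_cball by blast
    show ?thesis
    proof (cases "i < j")
      case True
      show ?thesis by (rule essentially_distinctI(1)[OF anti inv[OF True] xy])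
    next
      case False
      then have "j < i" using ij by simp
      show ?thesis by (rule essentially_distinctI(2)[OF anti inv[OF \<open>j < i\<close>] xy(3,4,1,2)])
    qed
  qed
  have "U i \<noteq> U j" if "i < j" for i j
  proof
    assume eq: "U i = U j"
    obtain x where "U i x \<noteq> 0" using nz by blast
    then show False using anti[of i x] inv[OF that, of x] eq by simp
  qed
  then have inj: "inj U" by (metis injI linorder_neqE_nat)
  define K where "K = nat \<lceil>(2 + \<alpha>) / 2 * \<beta> - 1\<rceil>"
  let ?S = "U ` {..<K}"
  have "card ?S = K" using inj by (simp add: card_image inj_on_subset)
  then have "int (card ?S) \<ge> \<lceil>(2 + \<alpha>) / 2 * \<beta> - 1\<rceil>" by (simp add: K_def)
  moreover have "nodal (U j) \<and> \<not> radial (U j)" for j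
  proof -
    obtain x where x: "x \<in> ball 0 1" "U j x \<noteq> 0" using nz by blast
    let ?y = "plane_rot (pi / (2 ^ j)) x"
    have y: "?y \<in> ball 0 1" "norm ?y = norm x" "U j ?y = - U j x" using x anti by simp_all
    have "nodal (U j)"
    proof (cases "U j x > 0")
      case True
      then have "U j ?y < 0" using y(3) by simp
      then show ?thesis unfolding nodal_def using True x(1) y(1) by blast
    next
      case False
      then have "U j x < 0" "U j ?y > 0" using x(2) y(3) by auto
      then show ?thesis unfolding nodal_def using x(1) y(1) by blast
    qed
    moreover have "\<not> radial (U j)"
    proof
      assume "radial (U j)"
      then have "U j x = U j ?y" unfolding radial_def using x(1) y(1,2) by metis
      then show False using x(2) y(3) by simp
    qed
    ultimately show ?thesis by simp
  qed
  moreover have "essentially_distinct u v" if uv: "u \<in> ?S" "v \<in> ?S" "u \<noteq> v" for u v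
  proof -
    obtain i j where "u = U i" "v = U j" using uv(1,2) by blast
    then show ?thesis using dist[of i j] uv(3) by blast
  qed
  ultimately show "\<exists>S. finite S \<and> int (card S) \<ge> \<lceil>(2 + \<alpha>) / 2 * \<beta> - 1\<rceil> \<and>
       (\<forall>u\<in>S. henon_solution \<alpha> p u \<and> nodal u \<and> \<not> radial u) \<and>
       (\<forall>u\<in>S. \<forall>v\<in>S. u \<noteq> v \<longrightarrow> essentially_distinct u v)"
    using sol by (intro exI[of _ ?S]) blast
qed

end
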